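(* Let $A$ be a simple infinite-dimensional C*-algebra, not necessarily unital, let $G$ be a finite group, and let $\alpha\colon G\to\operatorname{Aut}(A)$ be an action with the weak tracial Rokhlin property. Let $A^\alpha=\{a\in A:\alpha_g(a)=a\text{ for all }g\in G\}$, let $a,b\in (A^{\alpha})_+$, and assume that $0$ is a limit point of the spectrum $\operatorname{sp}(b)$. Then $a\precsim_A b$ if and only if $a\precsim_{A^\alpha} b$.
   Context: Cuntz subequivalence: for a C*-algebra $B$ and $a,b\in (B\otimes\mathcal K)_+$ (with $B\subset M_n(B)\subset B\otimes \mathcal K$ as usual, $\mathcal K$ the compact operators on a separable infinite-dimensional Hilbert space), write $a\precsim_B b$ if there is a sequence $(w_n)$ in $B\otimes\mathcal K$ with $w_n b w_n^*\to a$. For $a\ge 0$ and $\varepsilon\ge 0$, $(a-\varepsilon)_+=f(a)$ with $f(t)=\max(0,t-\varepsilon)$. Weak tracial Rokhlin property: an action $\alpha\colon G\to\operatorname{Aut}(A)$ of a finite group $G$ on a simple (not necessarily unital) C*-algebra $A$ has the weak tracial Rokhlin property if for every $\varepsilon>0$, every finite set $F\subset A$, and every pair of positive elements $x,y\in A$ with $\|x\|=1$, there exist orthogonal positive contractions $f_g\in A$, $g\in G$, such that with $f=\sum_{g\in G}f_g$: (1) $\|af_g-f_ga\|<\varepsilon$ for all $g\in G$, $a\in F$; (2) $\|\alpha_g(f_h)-f_{gh}\|<\varepsilon$ for all $g,h\in G$; (3) $(y^2-yfy-\varepsilon)_+\precsim_A x$; (4) $\|fxf\|>1-\varepsilon$.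 *)

theory Defs
  imports "HOL-Analysis.Analysis" "HOL-Algebra.Group" "HOL-Computational_Algebra.Polynomial"
begin

section \<open>C*-algebras\<close>

class scaleC =
  fixes scaleC :: "complex \<Rightarrow> 'a \<Rightarrow> 'a" (infixr \<open>*\<^sub>C\<close> 75)

class star =
  fixes star :: "'a \<Rightarrow> 'a"

text \<open>Complex C*-algebras, not necessarily unital.\<close>

class cstar_algebra = real_normed_algebra + banach + scaleC + star +
  assumes scaleR_scaleC: "r *\<^sub>R x = complex_of_real r *\<^sub>C x"
    and scaleC_add_right: "c *\<^sub>C (x + y) = c *\<^sub>C x + c *\<^sub>C y"
    and scaleC_add_left: "(c + d) *\<^sub>C x = c *\<^sub>C x + d *\<^sub>C x"
    and scaleC_scaleC: "c *\<^sub>C d *\<^sub>C x = (c * d) *\<^sub>C x"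
    and mult_scaleC_left: "(c *\<^sub>C x) * y = c *\<^sub>C (x * y)"
    and mult_scaleC_right: "x * (c *\<^sub>C y) = c *\<^sub>C (x * y)"
    and norm_scaleC: "norm (c *\<^sub>C x) = cmod c * norm x"
    and star_star: "star (star x) = x"
    and star_add: "star (x + y) = star x + star y"
    and star_mult: "star (x * y) = star y * star x"
    and star_scaleC: "star (c *\<^sub>C x) = cnj c *\<^sub>C star x"
    and cstar_identity: "norm (star x * x) = (norm x)\<^sup>2"

lemma vector_space_scaleC: "vector_space (scaleC :: complex \<Rightarrow> 'a::cstar_algebra \<Rightarrow> 'a)"
proof
  fix x :: 'a
  show "1 *\<^sub>C x = x"
    using scaleR_scaleC[of 1 x] by simp
qed (simp_all add: scaleC_add_right scaleC_add_left scaleC_scaleC)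

definition infinite_dimensional :: "'a::cstar_algebra itself \<Rightarrow> bool" where
  "infinite_dimensional _ \<longleftrightarrow>
    \<not> (\<exists>S :: 'a set. finite S \<and> module.span scaleC S = UNIV)"

definition closed_ideal :: "'a::cstar_algebra set \<Rightarrow> bool" where
  "closed_ideal I \<longleftrightarrow> closed I \<and> module.subspace scaleC I \<and>
    (\<forall>x\<in>I. \<forall>a. a * x \<in> I \<and> x * a \<in> I)"

definition simple_cstar :: "'a::cstar_algebra itself \<Rightarrow> bool" where
  "simple_cstar _ \<longleftrightarrow> (UNIV :: 'a set) \<noteq> {0} \<and>
    (\<forall>I :: 'a set. closed_ideal I \<longrightarrow> I = {0} \<or> I = UNIV)"


section \<open>Spectrum, positivity, functional calculus\<close>

text \<open>
  The argument \<open>B\<close> below is the carrier of a C*-algebra: a closed *-subalgebra of the ambient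
  type, which may be \<open>UNIV\<close>. Units, spectra, positivity and the stabilization are
  intrinsic to \<open>B\<close>; in particular a unit of \<open>B\<close> need not be a unit of the ambient algebra.
\<close>

definition unit_of :: "'a::cstar_algebra set \<Rightarrow> 'a \<Rightarrow> bool" where
  "unit_of B e \<longleftrightarrow> e \<in> B \<and> (\<forall>x\<in>B. e * x = x \<and> x * e = x)"

text \<open>The product of the unitization, where \<open>(c, x)\<close> stands for \<open>c 1 + x\<close>.\<close>

definition unitization_mult ::
  "complex \<times> 'a::cstar_algebra \<Rightarrow> complex \<times> 'a \<Rightarrow> complex \<times> 'a" where
  "unitization_mult p q =
    (fst p * fst q, fst p *\<^sub>C snd q + fst q *\<^sub>C snd p + snd p * snd q)"

text \<open>The spectrum is taken in \<open>B\<close> if \<open>B\<close> is unital, and in its unitization otherwise.\<close>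

definition spectrum :: "'a::cstar_algebra set \<Rightarrow> 'a \<Rightarrow> complex set" where
  "spectrum B a =
    (if \<exists>e. unit_of B e
     then {c. \<not> (\<exists>e z. unit_of B e \<and> z \<in> B \<and>
                (c *\<^sub>C e - a) * z = e \<and> z * (c *\<^sub>C e - a) = e)}
     else {c. \<not> (\<exists>z. snd z \<in> B \<and>
                unitization_mult (c, - a) z = (1, 0) \<and> unitization_mult z (c, - a) = (1, 0))})"

definition positive_elt :: "'a::cstar_algebra set \<Rightarrow> 'a \<Rightarrow> bool" where
  "positive_elt B a \<longleftrightarrow> a \<in> B \<and> star a = a \<and> spectrum B a \<subseteq> complex_of_real ` {0..}"

text \<open>
  \<open>poly_calc q a\<close> is \<open>p(a)\<close> for \<open>p(t) = t q(t)\<close>; the polynomials without constant term are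
  the ones that can be evaluated without a unit.
\<close>

definition poly_calc :: "real poly \<Rightarrow> 'a::cstar_algebra \<Rightarrow> 'a" where
  "poly_calc q a = (\<Sum>i\<le>degree q. coeff q i *\<^sub>R ((\<lambda>x. a * x) ^^ i) a)"

text \<open>
  Continuous functional calculus for self-adjoint \<open>a\<close> and real continuous \<open>f\<close> with \<open>f(0) = 0\<close>:
  \<open>f(a)\<close> is the common limit of \<open>p\<^sub>n(a)\<close> over all sequences of polynomials \<open>p\<^sub>n\<close> with
  \<open>p\<^sub>n(0) = 0\<close> that converge to \<open>f\<close> uniformly on the spectrum of \<open>a\<close>.
\<close>

definition fun_calc :: "'a::cstar_algebra set \<Rightarrow> (real \<Rightarrow> real) \<Rightarrow> 'a \<Rightarrow> 'a" where
  "fun_calc B f a = (THE c. \<exists>q :: nat \<Rightarrow> real poly.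
      uniform_limit {t. complex_of_real t \<in> spectrum B a} (\<lambda>n t. t * poly (q n) t) f sequentially \<and>
      (\<lambda>n. poly_calc (q n) a) \<longlonglongrightarrow> c)"

text \<open>\<open>cut_down B a \<epsilon>\<close> is \<open>(a - \<epsilon>)\<^sub>+\<close>, for positive \<open>a\<close> and \<open>\<epsilon> \<ge> 0\<close>.\<close>

definition cut_down :: "'a::cstar_algebra set \<Rightarrow> 'a \<Rightarrow> real \<Rightarrow> 'a" where
  "cut_down B a \<epsilon> = fun_calc B (\<lambda>t. max 0 (t - \<epsilon>)) a"


section \<open>Stabilization and Cuntz subequivalence\<close>

text \<open>
  \<open>B \<otimes> K\<close>, with \<open>K\<close> the compact operators on \<open>\<ell>\<^sup>2(\<nat>)\<close>, is modelled by infinite matrices over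
  \<open>B\<close>: it is the completion of the union of the \<open>M\<^sub>n(B)\<close> (upper left corners), and matrix units
  turn an elementary tensor \<open>b \<otimes> k\<close> into the matrix with entries \<open>\<langle>e\<^sub>i, k e\<^sub>j\<rangle> b\<close>.
  The C*-norm of \<open>M\<^sub>n(B)\<close> is the operator norm for its action on the Hilbert \<open>B\<close>-module \<open>B\<^sup>n\<close>
  of columns, with \<open>\<parallel>v\<parallel>\<^sup>2 = \<parallel>\<Sum>i<n. v\<^sub>i\<^sup>* v\<^sub>i\<parallel>\<close>.
\<close>

type_synonym 'a matrix = "nat \<Rightarrow> nat \<Rightarrow> 'a"

definition column_norm :: "nat \<Rightarrow> (nat \<Rightarrow> 'a::cstar_algebra) \<Rightarrow> real" where
  "column_norm n v = sqrt (norm (\<Sum>i<n. star (v i) * v i))"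

definition corner_norm :: "'a::cstar_algebra set \<Rightarrow> nat \<Rightarrow> 'a matrix \<Rightarrow> real" where
  "corner_norm B n X =
    Sup {column_norm n (\<lambda>i. \<Sum>j<n. X i j * v j) |v. (\<forall>i<n. v i \<in> B) \<and> column_norm n v \<le> 1}"

definition bounded_matrix :: "'a::cstar_algebra set \<Rightarrow> 'a matrix \<Rightarrow> bool" where
  "bounded_matrix B X \<longleftrightarrow> (\<forall>i j. X i j \<in> B) \<and> bdd_above (range (\<lambda>n. corner_norm B n X))"

text \<open>Meaningful for bounded matrices only.\<close>

definition matrix_norm :: "'a::cstar_algebra set \<Rightarrow> 'a matrix \<Rightarrow> real" where
  "matrix_norm B X = (SUP n. corner_norm B n X)"

definition matrix_diff :: "'a::cstar_algebra matrix \<Rightarrow> 'a matrix \<Rightarrow> 'a matrix" where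
  "matrix_diff X Y = (\<lambda>i j. X i j - Y i j)"

definition matrix_mult :: "'a::cstar_algebra matrix \<Rightarrow> 'a matrix \<Rightarrow> 'a matrix" where
  "matrix_mult X Y = (\<lambda>i j. \<Sum>k. X i k * Y k j)"

definition matrix_star :: "'a::cstar_algebra matrix \<Rightarrow> 'a matrix" where
  "matrix_star X = (\<lambda>i j. star (X j i))"

text \<open>The inclusion of \<open>B\<close> into \<open>B \<otimes> K\<close> as the upper left corner.\<close>

definition corner :: "'a::cstar_algebra \<Rightarrow> 'a matrix" where
  "corner a = (\<lambda>i j. if i = 0 \<and> j = 0 then a else 0)"

definition finite_matrices :: "'a::cstar_algebra set \<Rightarrow> 'a matrix set" where
  "finite_matrices B =
    {X. (\<forall>i j. X i j \<in> B) \<and> (\<exists>n. \<forall>i j. n \<le> i \<or> n \<le> j \<longrightarrow> X i j = 0)}"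

definition stabilization :: "'a::cstar_algebra set \<Rightarrow> 'a matrix set" where
  "stabilization B =
    {X. bounded_matrix B X \<and>
        (\<exists>Y. (\<forall>n. Y n \<in> finite_matrices B) \<and>
             (\<lambda>n. matrix_norm B (matrix_diff X (Y n))) \<longlonglongrightarrow> 0)}"

text \<open>Meant for positive elements \<open>a\<close>, \<open>b\<close> of \<open>stabilization B\<close>.\<close>

definition cuntz_le :: "'a::cstar_algebra set \<Rightarrow> 'a matrix \<Rightarrow> 'a matrix \<Rightarrow> bool" where
  "cuntz_le B a b \<longleftrightarrow>
    (\<exists>w. (\<forall>n. w n \<in> stabilization B) \<and>
      (\<lambda>n. matrix_norm B
         (matrix_diff (matrix_mult (matrix_mult (w n) b) (matrix_star (w n))) a)) \<longlonglongrightarrow> 0)"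


section \<open>Actions and the weak tracial Rokhlin property\<close>

definition star_automorphism :: "('a::cstar_algebra \<Rightarrow> 'a) \<Rightarrow> bool" where
  "star_automorphism \<phi> \<longleftrightarrow> bij \<phi> \<and>
    (\<forall>x y. \<phi> (x + y) = \<phi> x + \<phi> y) \<and> (\<forall>c x. \<phi> (c *\<^sub>C x) = c *\<^sub>C \<phi> x) \<and>
    (\<forall>x y. \<phi> (x * y) = \<phi> x * \<phi> y) \<and> (\<forall>x. \<phi> (star x) = star (\<phi> x))"

definition Aut :: "('a::cstar_algebra \<Rightarrow> 'a) monoid" where
  "Aut = \<lparr>carrier = {\<phi>. star_automorphism \<phi>}, mult = (\<circ>), one = id\<rparr>"

lemma star_automorphism_inv:
  assumes "star_automorphism \<phi>"
  shows "star_automorphism (inv_into UNIV \<phi>)"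
proof -
  have b: "bij \<phi>" and s: "\<And>x. \<phi> (inv_into UNIV \<phi> x) = x" and i: "\<And>x. inv_into UNIV \<phi> (\<phi> x) = x"
    using assms by (auto simp: star_automorphism_def bij_is_surj surj_f_inv_f bij_is_inj)
  have eqI: "inv_into UNIV \<phi> u = v" if "\<phi> v = u" for u v
    using that i by auto
  show ?thesis
    unfolding star_automorphism_def
    using assms b by (auto intro!: eqI simp: star_automorphism_def s bij_imp_bij_inv)
qed

lemma group_Aut: "group (Aut :: ('a::cstar_algebra \<Rightarrow> 'a) monoid)"
proof (rule groupI)
  fix \<phi> :: "'a \<Rightarrow> 'a" assume "\<phi> \<in> carrier Aut"
  then have "star_automorphism \<phi>" by (simp add: Aut_def)
  then have "star_automorphism (inv_into UNIV \<phi>)" "inv_into UNIV \<phi> \<circ> \<phi> = id"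
    by (auto simp: star_automorphism_inv) (auto simp: star_automorphism_def bij_is_inj)
  then show "\<exists>\<psi>\<in>carrier Aut. \<psi> \<otimes>\<^bsub>Aut\<^esub> \<phi> = \<one>\<^bsub>Aut\<^esub>"
    by (auto simp: Aut_def)
qed (auto simp: Aut_def star_automorphism_def bij_comp)

definition fixed_algebra ::
  "('g, 'm) monoid_scheme \<Rightarrow> ('g \<Rightarrow> 'a \<Rightarrow> 'a) \<Rightarrow> 'a::cstar_algebra set" where
  "fixed_algebra G \<alpha> = {a. \<forall>g\<in>carrier G. \<alpha> g a = a}"

definition weak_tracial_Rokhlin ::
  "('g, 'm) monoid_scheme \<Rightarrow> ('g \<Rightarrow> 'a \<Rightarrow> 'a::cstar_algebra) \<Rightarrow> bool" where
  "weak_tracial_Rokhlin G \<alpha> \<longleftrightarrow>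
    (\<forall>\<epsilon>>0. \<forall>F x y. finite F \<and> positive_elt UNIV x \<and> positive_elt UNIV y \<and> norm x = 1 \<longrightarrow>
      (\<exists>f :: 'g \<Rightarrow> 'a.
        (\<forall>g\<in>carrier G. positive_elt UNIV (f g) \<and> norm (f g) \<le> 1) \<and>
        (\<forall>g\<in>carrier G. \<forall>h\<in>carrier G. g \<noteq> h \<longrightarrow> f g * f h = 0) \<and>
        (\<forall>g\<in>carrier G. \<forall>a\<in>F. norm (a * f g - f g * a) < \<epsilon>) \<and>
        (\<forall>g\<in>carrier G. \<forall>h\<in>carrier G. norm (\<alpha> g (f h) - f (g \<otimes>\<^bsub>G\<^esub> h)) < \<epsilon>) \<and>
        (let s = (\<Sum>g\<in>carrier G. f g) in
          cuntz_le UNIV (corner (cut_down UNIV (y * y - y * s * y) \<epsilon>)) (corner x) \<and>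
          norm (s * x * s) > 1 - \<epsilon>)))"

end

theory Submission
  imports Defs "HOL-Computational_Algebra.Fundamental_Theorem_Algebra"
begin

text \<open>
  Only the passage from \<open>A\<close> to \<open>A\<^sup>\<alpha>\<close> needs an argument. On corners, \<open>a \<precsim> b\<close> means \<open>w\<^sub>n b w\<^sub>n\<^sup>* \<longlonglongrightarrow> a\<close>. Let
  \<open>w b w\<^sup>* \<approx> a\<close> in \<open>A\<close>. Cutting \<open>b\<close> off near \<open>0\<close> costs little, and since \<open>0\<close> is a limit point of \<open>sp(b)\<close> it
  leaves room for a nonzero \<open>c\<^sup>2 = \<psi>(b) b \<psi>(b)\<close> orthogonal to the rest. With Rokhlin elements \<open>f\<^sub>g\<close>, \<open>s = \<Sum>\<^sub>g f\<^sub>g\<close>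
  and \<open>y = a\<^bsup>1/2\<^esup>\<close>, the invariant element \<open>z = \<Sum>\<^sub>g \<alpha>\<^sub>g(f\<^sub>1 w)\<close> satisfies \<open>z b z\<^sup>* \<approx> y s\<^sup>2 y\<close>, and the defect
  \<open>y (1 - s\<^sup>2) y\<close> is approximated by \<open>v x v\<^sup>*\<close> for any prescribed \<open>x \<ge> 0\<close> of norm \<open>1\<close>. A preliminary use of the Rokhlin
  property provides \<open>x\<close> under \<open>c\<^sup>2\<close> with almost orthogonal translates \<open>\<alpha>\<^sub>g(x)\<close>; then the average of
  \<open>v x\<^bsup>1/2\<^esup>\<close> over the group is invariant and compares the (almost invariant) defect with \<open>c\<^sup>2\<close> inside \<open>A\<^sup>\<alpha>\<close>.
\<close>

section \<open>Self-adjoint and positive elements of unital C*-algebras\<close>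

text \<open>The obstacle is the norm of \<open>v\<close> in the defect
  \<open>v * x * star v\<close>: \<open>v\<close> is produced only after \<open>x\<close> has been
  fixed, and nothing bounds it, so orthogonality of the translates of \<open>x\<close> cannot be
  prescribed relative to it. What is bounded in advance is \<open>v * x * star v\<close> itself, by
  about twice the square of \<open>norm y\<close>. For that reason \<open>x\<close> is the square of
  a bump function of an element \<open>d\<close>, supported away from 0: \<open>v\<close> times this
  bump has controlled norm and factors boundedly through \<open>d\<close>, so that almost
  orthogonality has to be prescribed for \<open>d\<close> only. A second mismatch: condition (3)
  compares \<open>y * y - y * s * y\<close>, whereas the average over the group yields
  \<open>y * s * s * y\<close>. A polynomial in \<open>s\<close> close to the root of
  \<open>1 + s\<close> converts one defect into the other. The two averages are scaled differently.
  The Rokhlin elements split \<open>s\<close> into orthogonal pieces, but every translate of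
  \<open>v\<close> times the bump reproduces the whole defect, hence a factor 1 / sqrt N in the
  second average only.\<close>

interpretation scaleC: vector_space "scaleC :: complex \<Rightarrow> 'a::cstar_algebra \<Rightarrow> 'a"
  by (rule vector_space_scaleC)

lemma star_zero [simp]: "star (0::'a::cstar_algebra) = 0"
  using star_scaleC[of 0 "0::'a"] by simp

lemma star_minus [simp]: "star (- x) = - star (x::'a::cstar_algebra)"
  using star_scaleC[of "-1" x] by simp

lemma star_diff: "star (x - y) = star x - star (y::'a::cstar_algebra)"
  using star_add[of x "- y"] by simp

lemma star_scaleR: "star (r *\<^sub>R x) = r *\<^sub>R star (x::'a::cstar_algebra)"
  by (simp add: scaleR_scaleC star_scaleC)

lemma star_sum: "star (sum f A) = (\<Sum>i\<in>A. star (f i :: 'a::cstar_algebra))"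
  by (induction A rule: infinite_finite_induct) (simp_all add: star_add)

lemma norm_star [simp]: "norm (star x) = norm (x::'a::cstar_algebra)"
proof -
  have le: "norm y \<le> norm (star y)" for y :: 'a
  proof (cases "y = 0")
    case False
    have "(norm y)\<^sup>2 \<le> norm (star y) * norm y"
      by (metis cstar_identity norm_mult_ineq)
    with False show ?thesis
      by (simp add: power2_eq_square)
  qed simp
  from le[of x] le[of "star x"] show ?thesis
    by (simp add: star_star)
qed

lemma cstar_identity': "norm (x * star x) = (norm (x::'a::cstar_algebra))\<^sup>2"
  using cstar_identity[of "star x"] by (simp add: star_star)

lemma norm_selfadjoint_square: "star x = x \<Longrightarrow> norm (x * x) = (norm (x::'a::cstar_algebra))\<^sup>2"
  using cstar_identity[of x] by simp

lemma bounded_linear_star: "bounded_linear (star :: 'a::cstar_algebra \<Rightarrow> 'a)"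
  by (rule bounded_linear_intro[where K=1]) (simp_all add: star_add star_scaleR)

lemmas tendsto_star = bounded_linear.tendsto[OF bounded_linear_star]

section \<open>The order of a unital C*-algebra, described by norms alone\<close>

class unital_cstar_algebra = cstar_algebra + real_normed_algebra_1

lemma star_one [simp]: "star (1::'a::unital_cstar_algebra) = 1"
  by (metis mult.right_neutral mult.left_neutral star_mult star_star)

text \<open>A norm estimate in place of a spectral condition: for self-adjoint \<open>a\<close> it
  confines the spectrum to the disc of radius \<open>t\<close> around \<open>t\<close>. In this form
  sums are positive by the triangle inequality, before any spectral theory;
  \<open>unital_spectrum_psd\<close> and \<open>psdI_spectrum\<close> recover the spectral
  description.\<close>

definition psd :: "'a::unital_cstar_algebra \<Rightarrow> bool" where
  "psd a \<longleftrightarrow> star a = a \<and> (\<exists>t. norm (t *\<^sub>R 1 - a) \<le> t)"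

definition invertible_elt :: "'a::unital_cstar_algebra \<Rightarrow> bool" where
  "invertible_elt a \<longleftrightarrow> (\<exists>z. a * z = 1 \<and> z * a = 1)"

definition unital_spectrum :: "'a::unital_cstar_algebra \<Rightarrow> complex set" where
  "unital_spectrum a = {c. \<not> invertible_elt (c *\<^sub>C 1 - a)}"

lemma psd_selfadjoint: "psd a \<Longrightarrow> star a = a"
  by (simp add: psd_def)

lemma psd_add: "psd a \<Longrightarrow> psd b \<Longrightarrow> psd (a + b)"
proof -
  assume "psd a" "psd b"
  then obtain s t where st: "norm (s *\<^sub>R 1 - a) \<le> s" "norm (t *\<^sub>R 1 - b) \<le> t"
    and sa: "star a = a" "star b = b"
    by (auto simp: psd_def)
  have "norm ((s + t) *\<^sub>R 1 - (a + b)) = norm ((s *\<^sub>R 1 - a) + (t *\<^sub>R 1 - b))"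
    by (simp add: algebra_simps)
  also have "\<dots> \<le> s + t"
    using norm_triangle_ineq[of "s *\<^sub>R 1 - a" "t *\<^sub>R 1 - b"] st by linarith
  finally show ?thesis
    using sa unfolding psd_def by (auto simp: star_add)
qed

lemma psd_scaleR:
  assumes "psd a" "0 \<le> r" shows "psd (r *\<^sub>R a)"
proof -
  obtain t where "norm (t *\<^sub>R 1 - a) \<le> t" "star a = a"
    using assms by (auto simp: psd_def)
  moreover have "norm ((r * t) *\<^sub>R 1 - r *\<^sub>R a) = r * norm (t *\<^sub>R 1 - a)"
    using assms by (metis abs_of_nonneg norm_scaleR scaleR_diff_right scaleR_scaleR)
  ultimately show ?thesis
    using assms unfolding psd_def by (auto simp: star_scaleR intro!: exI[of _ "r * t"] mult_left_mono)
qed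

lemma psd_of_real: "0 \<le> r \<Longrightarrow> psd (r *\<^sub>R 1)"
  unfolding psd_def by (auto simp: star_scaleR intro!: exI[of _ r])

lemma psd_norm_minus: "star a = a \<Longrightarrow> psd (norm a *\<^sub>R 1 - a)"
  unfolding psd_def by (auto simp: star_diff star_scaleR intro!: exI[of _ "norm a"])

text \<open>The iteration \<open>v \<mapsto> (u + v\<^sup>2) / 2\<close> has a fixed point \<open>v\<close>, and \<open>(1 - v)\<^sup>2 = 1 - u\<close>.
  It is dominated by the same iteration for the number \<open>u = 1\<close>.\<close>

primrec sqrt_iter :: "'a::real_algebra \<Rightarrow> nat \<Rightarrow> 'a" where
  "sqrt_iter u 0 = 0"
| "sqrt_iter u (Suc n) = (1/2) *\<^sub>R (u + sqrt_iter u n * sqrt_iter u n)"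

lemma sqrt_iter_commute:
  assumes "y * u = u * y" shows "y * sqrt_iter u n = sqrt_iter u n * y"
proof (induction n)
  case (Suc n)
  have "y * (sqrt_iter u n * sqrt_iter u n) = sqrt_iter u n * sqrt_iter u n * y"
    by (metis Suc mult.assoc)
  with assms show ?case
    by (simp add: algebra_simps)
qed simp

lemma sqrt_iter_selfadjoint:
  "star u = u \<Longrightarrow> star (sqrt_iter u n) = sqrt_iter (u::'a::cstar_algebra) n"
  by (induction n) (simp_all add: star_add star_scaleR star_mult)

lemma sqrt_iter_real: "0 \<le> sqrt_iter (1::real) n \<and> sqrt_iter (1::real) n \<le> 1"
proof (induction n)
  case (Suc n)
  then have "sqrt_iter (1::real) n * sqrt_iter 1 n \<le> 1 * 1"
    by (intro mult_mono) auto
  with Suc show ?case by simp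
qed simp

lemma sqrt_iter_norm:
  fixes u :: "'a::real_normed_algebra"
  assumes "norm u \<le> 1" shows "norm (sqrt_iter u n) \<le> sqrt_iter 1 n"
proof (induction n)
  case (Suc n)
  have "norm (sqrt_iter u n * sqrt_iter u n) \<le> sqrt_iter 1 n * sqrt_iter 1 n"
    using Suc sqrt_iter_real[of n]
    by (meson mult_mono norm_ge_zero norm_mult_ineq order_trans)
  then show ?case
    using assms norm_triangle_ineq[of u "sqrt_iter u n * sqrt_iter u n"] by simp
qed simp

lemma sqrt_iter_diff:
  fixes u :: "'a::real_normed_algebra"
  assumes "norm u \<le> 1"
  shows "norm (sqrt_iter u (Suc n) - sqrt_iter u n) \<le> sqrt_iter 1 (Suc n) - sqrt_iter 1 n"
proof (induction n)
  case (Suc n)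
  let ?v = "sqrt_iter u" and ?t = "sqrt_iter (1::real)"
  \<comment> \<open>Consecutive iterates are polynomials in \<open>u\<close> and commute, so a
    difference of squares factors. The numerical iteration factors in the same way, which preserves
    the domination.\<close>
  have c: "?v (Suc n) * ?v n = ?v n * ?v (Suc n)"
    using sqrt_iter_commute[of "?v n" u "Suc n"] sqrt_iter_commute[of u u n] by simp
  have e: "(1/2) *\<^sub>R (u + x) - (1/2) *\<^sub>R (u + y) = (1/2) *\<^sub>R (x - y)" for x y :: 'a
    by (simp add: algebra_simps)
  have "?v (Suc (Suc n)) - ?v (Suc n) = (1/2) *\<^sub>R (?v (Suc n) * ?v (Suc n) - ?v n * ?v n)"
    using e[of "?v (Suc n) * ?v (Suc n)" "?v n * ?v n"] by (metis sqrt_iter.simps(2))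
  also have "?v (Suc n) * ?v (Suc n) - ?v n * ?v n = (?v (Suc n) - ?v n) * (?v (Suc n) + ?v n)"
    using c by (simp only: algebra_simps)
  finally have "norm (?v (Suc (Suc n)) - ?v (Suc n))
      = 1/2 * norm ((?v (Suc n) - ?v n) * (?v (Suc n) + ?v n))" by simp
  also have "\<dots> \<le> 1/2 * ((?t (Suc n) - ?t n) * (?t (Suc n) + ?t n))"
  proof -
    have "norm (?v (Suc n) + ?v n) \<le> ?t (Suc n) + ?t n"
      using norm_triangle_ineq[of "?v (Suc n)" "?v n"] sqrt_iter_norm[OF assms, of n]
        sqrt_iter_norm[OF assms, of "Suc n"] by linarith
    moreover have "0 \<le> ?t (Suc n) - ?t n"
      using Suc norm_ge_zero order_trans by blast
    ultimately show ?thesis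
      using Suc by (intro mult_left_mono order_trans[OF norm_mult_ineq mult_mono])
        (simp_all del: sqrt_iter.simps)
  qed
  also have "\<dots> = ?t (Suc (Suc n)) - ?t (Suc n)"
    by (simp add: field_simps)
  finally show ?case .
qed (use assms in simp)

lemma sqrt_one_minus:
  fixes u :: "'a::unital_cstar_algebra"
  assumes "norm u \<le> 1" "star u = u"
  shows "\<exists>s. star s = s \<and> s * s = 1 - u \<and> (\<forall>y. y * u = u * y \<longrightarrow> y * s = s * y)"
proof -
  let ?v = "sqrt_iter u" and ?t = "sqrt_iter (1::real)"
  \<comment> \<open>The numerical increments are nonnegative and telescope inside [0, 1]; they are
    the summable majorant for the increments of \<open>?v\<close>.\<close>
  have "summable (\<lambda>n. ?t (Suc n) - ?t n)"
  proof -
    have mono: "?t n \<le> ?t (Suc n)" for n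
      using sqrt_iter_diff[of "1::real" n] norm_ge_zero order_trans by fastforce
    then have "convergent ?t"
      using sqrt_iter_real incseq_SucI[of ?t, OF mono]
      by (intro Bseq_mono_convergent BseqI'[where K=1]) (auto simp: incseq_def)
    then show ?thesis
      using telescope_summable convergent_LIMSEQ_iff by blast
  qed
  then have "summable (\<lambda>n. ?v (Suc n) - ?v n)"
    by (rule summable_comparison_test') (use sqrt_iter_diff[OF assms(1)] in blast)
  then have "convergent (\<lambda>N. \<Sum>n<N. ?v (Suc n) - ?v n)"
    by (simp add: summable_iff_convergent)
  then have "convergent ?v"
    by (simp only: sum_lessThan_telescope) simp
  then obtain v where v: "?v \<longlonglongrightarrow> v"
    by (auto simp: convergent_def)
  then have "(\<lambda>n. ?v (Suc n)) \<longlonglongrightarrow> (1/2) *\<^sub>R (u + v * v)"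
    by (auto intro!: tendsto_intros)
  with v have "v = (1/2) *\<^sub>R (u + v * v)"
    using LIMSEQ_Suc LIMSEQ_unique by blast
  then have "2 *\<^sub>R v = u + v * v"
    by (metis scaleR_half_double scaleR_2 scaleR_left_commute)
  then have 1: "(1 - v) * (1 - v) = 1 - u"
    by (simp add: algebra_simps scaleR_2)
  have "star v = v"
    using tendsto_star[OF v] v sqrt_iter_selfadjoint[OF assms(2)] LIMSEQ_unique by auto
  then have 2: "star (1 - v) = 1 - v"
    by (simp only: star_diff star_one)
  have 3: "y * (1 - v) = (1 - v) * y" if "y * u = u * y" for y
  proof -
    have "(\<lambda>n. y * ?v n) \<longlonglongrightarrow> v * y"
      unfolding sqrt_iter_commute[OF that] by (intro tendsto_intros v)
    then have "y * v = v * y"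
      by (rule LIMSEQ_unique[OF tendsto_mult_left[OF v]])
    then show ?thesis
      by (simp only: left_diff_distrib right_diff_distrib mult_1_left mult_1_right)
  qed
  show ?thesis
    by (intro exI[of _ "1 - v"] conjI allI impI) (fact 2, fact 1, erule 3)
qed

text \<open>Dividing by \<open>t\<close> turns the defining estimate into
  \<open>norm (1 - a/t) \<le> 1\<close>, the situation of \<open>sqrt_one_minus\<close>. The clause
  on commuting elements lets roots of commuting positive elements commute in turn.\<close>

lemma psd_sqrt:
  fixes a :: "'a::unital_cstar_algebra"
  assumes "psd a"
  shows "\<exists>s. star s = s \<and> s * s = a \<and> (\<forall>y. y * a = a * y \<longrightarrow> y * s = s * y)"
proof -
  obtain t where t: "norm (t *\<^sub>R 1 - a) \<le> t" and sa: "star a = a"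
    using assms by (auto simp: psd_def)
  then have t0: "0 \<le> t" using norm_ge_zero order_trans by blast
  show ?thesis
  proof (cases "t = 0")
    case True
    then show ?thesis using t by (intro exI[of _ 0]) auto
  next
    case False
    define u where "u = 1 - (1/t) *\<^sub>R a"
    have "u = (1/t) *\<^sub>R (t *\<^sub>R 1 - a)"
      using False by (simp add: u_def algebra_simps)
    then have "norm u = (1/t) * norm (t *\<^sub>R 1 - a)"
      using t0 by (metis abs_of_nonneg norm_scaleR zero_le_divide_1_iff)
    then have "norm u \<le> 1"
      using t t0 False by simp
    moreover have "star u = u"
      using sa by (simp add: u_def star_diff star_scaleR)
    ultimately obtain s where s: "star s = s" "s * s = 1 - u" "\<And>y. y * u = u * y \<Longrightarrow> y * s = s * y"
      using sqrt_one_minus by blast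
    have "(sqrt t *\<^sub>R s) * (sqrt t *\<^sub>R s) = t *\<^sub>R (s * s)"
      using t0 by simp
    also have "\<dots> = a"
      using False by (simp add: s(2) u_def)
    finally have "(sqrt t *\<^sub>R s) * (sqrt t *\<^sub>R s) = a" .
    moreover have "y * (sqrt t *\<^sub>R s) = (sqrt t *\<^sub>R s) * y" if "y * a = a * y" for y
      using s(3)[of y] that by (simp add: u_def algebra_simps)
    ultimately show ?thesis
      using s(1) by (intro exI[of _ "sqrt t *\<^sub>R s"]) (simp add: star_scaleR)
  qed
qed

text \<open>\<open>h + \<i>k\<close> is a multiple of a unitary.\<close>

lemma norm_le_of_sum_squares:
  fixes h k :: "'a::unital_cstar_algebra"
  assumes "star h = h" "star k = k" "h * k = k * h" "h * h + k * k = r *\<^sub>R 1" "0 \<le> r"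
  shows "(norm h)\<^sup>2 \<le> r"
proof -
  define w where "w = h + \<i> *\<^sub>C k"
  have sw: "star w = h - \<i> *\<^sub>C k"
    using assms by (simp add: w_def star_add star_scaleC)
  have "star w * w = h * h + k * k"
    unfolding sw using assms(3)
    by (simp add: w_def algebra_simps mult_scaleC_left mult_scaleC_right scaleC_scaleC)
  then have "(norm w)\<^sup>2 = r"
    using cstar_identity[of w] assms by simp
  then have "norm w = sqrt r"
    by (metis norm_ge_zero real_sqrt_unique)
  moreover have "2 *\<^sub>R h = w + star w"
    by (simp only: sw) (simp add: w_def scaleR_2)
  then have "2 * norm h \<le> 2 * norm w"
    using norm_triangle_ineq[of w "star w"] by (metis mult_2 norm_scaleR norm_star abs_numeral)
  ultimately have "norm h \<le> sqrt r" by simp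
  then show ?thesis
    using assms(5) by (metis norm_ge_zero power_mono real_sqrt_pow2)
qed

text \<open>With T the square of \<open>norm h\<close>, the element \<open>T - h * h\<close> has a
  root \<open>s\<close> commuting with \<open>h\<close>, and the squares of \<open>s\<close> and
  \<open>h\<close> add up to T. Hence \<open>norm (T - h * h) \<le> T\<close>, so T is the witness
  that \<open>psd\<close> asks for.\<close>

lemma psd_square:
  fixes h :: "'a::unital_cstar_algebra"
  assumes "star h = h"
  shows "psd (h * h)"
proof -
  let ?T = "(norm h)\<^sup>2"
  let ?a = "?T *\<^sub>R 1 - h * h"
  have sa: "star (h * h) = h * h" using assms by (simp add: star_mult)
  have "norm (h * h) = ?T" using assms by (simp add: norm_selfadjoint_square)
  then have "psd ?a"
    using psd_norm_minus[OF sa] by simp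
  then obtain s where s: "star s = s" "s * s = ?a" "\<And>y. y * ?a = ?a * y \<Longrightarrow> y * s = s * y"
    using psd_sqrt by blast
  have "h * s = s * h"
    by (rule s(3)) (simp add: left_diff_distrib right_diff_distrib mult.assoc)
  then have "(norm s)\<^sup>2 \<le> ?T"
    by (intro norm_le_of_sum_squares[of s h]) (simp_all only: assms s(1,2) diff_add_cancel zero_le_power2)
  then have "norm ?a \<le> ?T"
    using s(1,2) by (metis norm_selfadjoint_square)
  with sa show ?thesis
    unfolding psd_def by blast
qed

text \<open>The roots of \<open>a\<close> and of \<open>r - a\<close> commute and their squares add
  up to \<open>r\<close>, so \<open>norm_le_of_sum_squares\<close> bounds the root of
  \<open>a\<close>.\<close>

lemma psd_norm_le:
  fixes a :: "'a::unital_cstar_algebra"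
  assumes "psd a" "psd (r *\<^sub>R 1 - a)" "0 \<le> r"
  shows "norm a \<le> r"
proof -
  obtain h where h: "star h = h" "h * h = a" "\<And>y. y * a = a * y \<Longrightarrow> y * h = h * y"
    using psd_sqrt[OF assms(1)] by blast
  let ?b = "r *\<^sub>R 1 - a"
  obtain k where k: "star k = k" "k * k = ?b" "\<And>y. y * ?b = ?b * y \<Longrightarrow> y * k = k * y"
    using psd_sqrt[OF assms(2)] by blast
  have "h * ?b = ?b * h"
    unfolding h(2)[symmetric] by (simp add: left_diff_distrib right_diff_distrib mult.assoc)
  then have "h * k = k * h" by (rule k(3))
  then have "(norm h)\<^sup>2 \<le> r"
    by (intro norm_le_of_sum_squares[of h k]) (simp_all add: h(1,2) k(1,2) assms(3))
  then show ?thesis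
    using h(1,2) by (metis norm_selfadjoint_square)
qed

lemma psd_norm_mono:
  fixes a :: "'a::unital_cstar_algebra"
  assumes "psd a" "psd (b - a)"
  shows "norm a \<le> norm b"
proof (rule psd_norm_le[OF assms(1)])
  have "star b = b"
    using assms by (metis diff_add_cancel psd_selfadjoint star_add)
  then have "psd ((norm b *\<^sub>R 1 - b) + (b - a))"
    by (intro psd_add psd_norm_minus assms)
  then show "psd (norm b *\<^sub>R 1 - a)" by (simp add: algebra_simps)
qed simp

lemma psd_antisym:
  fixes a :: "'a::unital_cstar_algebra"
  assumes "psd a" "psd (- a)" shows "a = 0"
  using psd_norm_mono[of a 0] assms by simp

section \<open>Spectra of self-adjoint elements and their agreement with the norm order\<close>

lemma invertible_one_minus:
  fixes u :: "'a::unital_cstar_algebra"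
  assumes "norm u < 1" shows "invertible_elt (1 - u)"
proof -
  have s: "summable (\<lambda>n. u ^ n)"
    by (rule summable_comparison_test'[where g="\<lambda>n. norm u ^ n" and N=0])
      (use assms in \<open>auto simp: norm_power_ineq summable_geometric\<close>)
  let ?S = "\<Sum>n. u ^ n"
  have S: "?S - 1 = (\<Sum>n. u ^ Suc n)"
    using suminf_split_head[OF s] by simp
  also have "\<dots> = u * ?S" using suminf_mult[OF s, of u] by simp
  finally have 1: "(1 - u) * ?S = 1" by (simp add: algebra_simps)
  have "(\<Sum>n. u ^ Suc n) = ?S * u"
    using suminf_mult2[OF s, of u] by (simp add: power_commutes)
  with S have "?S * (1 - u) = 1" by (simp add: algebra_simps)
  with 1 show ?thesis unfolding invertible_elt_def by blast
qed

lemma invertible_mult: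
  "invertible_elt x \<Longrightarrow> invertible_elt y \<Longrightarrow> invertible_elt (x * y)"
  unfolding invertible_elt_def
proof (elim exE conjE)
  fix a b assume *: "x * a = 1" "a * x = 1" "y * b = 1" "b * y = 1"
  have "x * y * (b * a) = x * (y * b) * a" "b * a * (x * y) = b * (a * x) * y"
    by (simp_all only: mult.assoc)
  with * show "\<exists>z. x * y * z = 1 \<and> z * (x * y) = 1" by auto
qed

lemma invertible_commuting_factor:
  assumes "invertible_elt (x * y)" "x * y = y * x"
  shows "invertible_elt x"
proof -
  obtain z where z: "x * y * z = 1" "z * (x * y) = 1"
    using assms(1) by (auto simp: invertible_elt_def)
  have l: "(z * y) * x = 1" using z(2) assms(2) by (metis mult.assoc)
  have r: "x * (y * z) = 1" using z(1) by (simp add: mult.assoc)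
  have "z * y = y * z" by (metis l r mult.assoc mult.left_neutral mult.right_neutral)
  with l r show ?thesis unfolding invertible_elt_def by auto
qed

lemma invertible_scaleC:
  assumes "invertible_elt x" "c \<noteq> 0" shows "invertible_elt (c *\<^sub>C x)"
proof -
  obtain z where "x * z = 1" "z * x = 1" using assms(1) by (auto simp: invertible_elt_def)
  then show ?thesis
    using assms(2) unfolding invertible_elt_def
    by (intro exI[of _ "inverse c *\<^sub>C z"]) (simp add: mult_scaleC_left mult_scaleC_right)
qed

lemma invertible_minus: "invertible_elt (- x) \<longleftrightarrow> invertible_elt x"
  using invertible_scaleC[of x "-1"] invertible_scaleC[of "-x" "-1"] by auto

lemma invertible_of_norm_less:
  fixes u :: "'a::unital_cstar_algebra"
  assumes "norm u < cmod c" shows "invertible_elt (c *\<^sub>C 1 - u)"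
proof -
  have c: "c \<noteq> 0" using assms norm_ge_zero[of u] by auto
  have "norm (inverse c *\<^sub>C u) < 1"
    using assms c by (simp add: norm_scaleC norm_divide field_simps)
  from invertible_scaleC[OF invertible_one_minus[OF this] c] show ?thesis
    using c by (simp add: scaleC.scale_right_diff_distrib scaleC_scaleC)
qed

lemma unital_spectrum_norm: "c \<in> unital_spectrum u \<Longrightarrow> cmod c \<le> norm u"
  using invertible_of_norm_less[of u c] by (force simp: unital_spectrum_def)

text \<open>\<open>r + a\<close> is \<open>r + t\<close> minus \<open>t - a\<close>, and the norm of
  \<open>t - a\<close> is at most \<open>t < r + t\<close>.\<close>

lemma psd_plus_invertible:
  fixes a :: "'a::unital_cstar_algebra"
  assumes "psd a" "0 < r" shows "invertible_elt (r *\<^sub>R 1 + a)"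
proof -
  obtain t where t: "norm (t *\<^sub>R 1 - a) \<le> t" using assms by (auto simp: psd_def)
  then have "norm (t *\<^sub>R 1 - a) < cmod (of_real (r + t))"
    unfolding norm_of_real using assms(2) by linarith
  from invertible_of_norm_less[OF this] show ?thesis
    by (simp add: scaleR_scaleC[symmetric] algebra_simps)
qed

text \<open>After shifting by the real part and scaling by the imaginary part of \<open>c\<close>,
  the point is \<i>. There \<open>(\<i> - k) * (\<i> + k) = - (1 + k * k)\<close> is invertible
  because \<open>k * k\<close> is positive, and the factors commute.\<close>

lemma unital_spectrum_selfadjoint:
  fixes h :: "'a::unital_cstar_algebra"
  assumes "star h = h" "c \<in> unital_spectrum h" shows "c \<in> \<real>"
proof (rule ccontr)
  assume "c \<notin> \<real>"
  then have b: "Im c \<noteq> 0" by (simp add: complex_is_Real_iff)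
  define k where "k = (1 / Im c) *\<^sub>R (h - Re c *\<^sub>R 1)"
  have "star k = k" using assms by (simp add: k_def star_scaleR star_diff)
  then have "invertible_elt (1 *\<^sub>R 1 + k * k)"
    by (intro psd_plus_invertible psd_square) auto
  moreover have "(\<i> *\<^sub>C 1 - k) * (\<i> *\<^sub>C 1 + k) = - (1 *\<^sub>R 1 + k * k)"
    "(\<i> *\<^sub>C 1 + k) * (\<i> *\<^sub>C 1 - k) = - (1 *\<^sub>R 1 + k * k)"
    by (simp_all add: left_diff_distrib right_diff_distrib distrib_left distrib_right
      mult_scaleC_left mult_scaleC_right scaleC_scaleC scaleC_add_right scaleC.scale_right_diff_distrib)
  ultimately have "invertible_elt (\<i> *\<^sub>C 1 - k)"
    by (metis invertible_commuting_factor invertible_minus)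
  then have "invertible_elt (complex_of_real (Im c) *\<^sub>C (\<i> *\<^sub>C 1 - k))"
    using b by (intro invertible_scaleC) auto
  also have "complex_of_real (Im c) *\<^sub>C (\<i> *\<^sub>C 1 - k) = c *\<^sub>C 1 - h"
  proof -
    have "complex_of_real (Im c) *\<^sub>C k = h - complex_of_real (Re c) *\<^sub>C 1"
      using b by (simp add: k_def scaleR_scaleC scaleC_scaleC)
    then have "complex_of_real (Im c) *\<^sub>C (\<i> *\<^sub>C 1 - k)
        = (complex_of_real (Im c) * \<i>) *\<^sub>C 1 + complex_of_real (Re c) *\<^sub>C 1 - h"
      by (simp add: scaleC.scale_right_diff_distrib scaleC_scaleC)
    also have "\<dots> = c *\<^sub>C 1 - h"
      by (simp add: scaleC_add_left[symmetric]) (metis add.commute complex_eq mult.commute)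
    finally show ?thesis .
  qed
  finally show False using assms(2) by (simp add: unital_spectrum_def)
qed

lemma unital_spectrum_psd:
  fixes a :: "'a::unital_cstar_algebra"
  assumes "psd a" shows "unital_spectrum a \<subseteq> complex_of_real ` {0..}"
proof
  fix c assume c: "c \<in> unital_spectrum a"
  then have "c \<in> \<real>" using assms psd_selfadjoint unital_spectrum_selfadjoint by blast
  then obtain r where r: "c = of_real r" by (auto elim: Reals_cases)
  have "0 \<le> r"
  proof (rule ccontr)
    assume "\<not> 0 \<le> r"
    then have "invertible_elt (- ((- r) *\<^sub>R 1 + a))"
      unfolding invertible_minus using assms by (intro psd_plus_invertible) auto
    with c r show False
      by (simp add: unital_spectrum_def scaleR_scaleC)
  qed
  with r show "c \<in> complex_of_real ` {0..}" by auto
qed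

text \<open>For the inverse \<open>z\<close> of \<open>a\<close>, the positive element
  \<open>norm z - z\<close> and \<open>a\<close> have commuting roots, so the product
  \<open>norm z * a - 1\<close> is the square of a self-adjoint element. This gives the bound with
  constant \<open>1 / norm z\<close>.\<close>

lemma psd_invertible_bounded_below:
  fixes a :: "'a::unital_cstar_algebra"
  assumes "psd a" "invertible_elt a"
  shows "\<exists>\<delta>>0. psd (a - \<delta> *\<^sub>R 1)"
proof -
  obtain z where z: "a * z = 1" "z * a = 1" using assms(2) by (auto simp: invertible_elt_def)
  have sz: "star z = z"
  proof -
    have "star z * a = 1" using z(1) psd_selfadjoint[OF assms(1)] by (metis star_mult star_one)
    then show ?thesis using z by (metis mult.assoc mult.left_neutral mult.right_neutral)
  qed
  have zp: "0 < norm z" using z by auto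
  obtain s where s: "star s = s" "s * s = a" "\<And>y. y * a = a * y \<Longrightarrow> y * s = s * y"
    using psd_sqrt[OF assms(1)] by blast
  let ?b = "norm z *\<^sub>R 1 - z"
  obtain k where k: "star k = k" "k * k = ?b" "\<And>y. y * ?b = ?b * y \<Longrightarrow> y * k = k * y"
    using psd_sqrt[OF psd_norm_minus[OF sz]] by blast
  have "z * s = s * z" using z by (intro s(3)) simp
  then have c: "s * k = k * s" by (intro k(3)) (simp add: left_diff_distrib right_diff_distrib)
  have "psd ((k * s) * (k * s))"
    by (rule psd_square) (simp add: star_mult s k c)
  also have "(k * s) * (k * s) = ?b * a"
    using c s(2) k(2) by (metis mult.assoc)
  also have "\<dots> = norm z *\<^sub>R a - 1"
    using z by (simp add: algebra_simps)
  finally have "psd ((1 / norm z) *\<^sub>R (norm z *\<^sub>R a - 1))"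
    using zp by (intro psd_scaleR) auto
  then have "psd (a - (1 / norm z) *\<^sub>R 1)"
    using zp by (simp add: algebra_simps)
  with zp show ?thesis by (intro exI[of _ "1 / norm z"]) auto
qed

text \<open>If neither T nor -T, with T the norm of \<open>u\<close>, were in the spectrum, then the
  positive element \<open>T^2 - u * u\<close> would be invertible, hence bounded below by some
  \<open>d > 0\<close>. Then \<open>u * u\<close> would have norm at most \<open>T^2 - d\<close>,
  against the C*-identity.\<close>

lemma norm_in_unital_spectrum:
  fixes u :: "'a::unital_cstar_algebra"
  assumes "star u = u"
  shows "\<exists>r. \<bar>r\<bar> = norm u \<and> complex_of_real r \<in> unital_spectrum u"
proof (rule ccontr)
  assume no: "\<not> ?thesis"
  let ?T = "norm u"
  have "complex_of_real ?T \<notin> unital_spectrum u" "complex_of_real (- ?T) \<notin> unital_spectrum u"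
    using no by (metis abs_norm_cancel abs_minus_cancel)+
  then have "invertible_elt (?T *\<^sub>R 1 - u)" "invertible_elt ((- ?T) *\<^sub>R 1 - u)"
    by (simp_all only: unital_spectrum_def mem_Collect_eq not_not scaleR_scaleC)
  then have "invertible_elt ((?T *\<^sub>R 1 - u) * - ((- ?T) *\<^sub>R 1 - u))"
    by (intro invertible_mult) (simp_all only: invertible_minus)
  also have "(?T *\<^sub>R 1 - u) * - ((- ?T) *\<^sub>R 1 - u) = ?T\<^sup>2 *\<^sub>R 1 - u * u"
    by (simp add: algebra_simps power2_eq_square)
  finally have inv: "invertible_elt (?T\<^sup>2 *\<^sub>R 1 - u * u)" .
  have n: "norm (u * u) = ?T\<^sup>2" using assms by (rule norm_selfadjoint_square)
  have "star (u * u) = u * u" using assms by (simp add: star_mult)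
  from psd_norm_minus[OF this] n have "psd (?T\<^sup>2 *\<^sub>R 1 - u * u)" by simp
  from psd_invertible_bounded_below[OF this inv] obtain d where d: "0 < d"
    "psd (?T\<^sup>2 *\<^sub>R 1 - u * u - d *\<^sub>R 1)" by blast
  have "psd (u * u + (?T\<^sup>2 *\<^sub>R 1 - u * u - d *\<^sub>R 1))"
    by (intro psd_add psd_square assms d)
  then have p: "psd ((?T\<^sup>2 - d) *\<^sub>R 1 :: 'a)" by (simp add: algebra_simps)
  have "0 \<le> ?T\<^sup>2 - d"
  proof (rule ccontr)
    assume neg: "\<not> 0 \<le> ?T\<^sup>2 - d"
    then have "psd (- ((?T\<^sup>2 - d) *\<^sub>R 1) :: 'a)"
      using psd_of_real[of "- (?T\<^sup>2 - d)"] by (simp add: algebra_simps)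
    from psd_antisym[OF p this] neg show False by simp
  qed
  then have "norm (u * u) \<le> ?T\<^sup>2 - d"
    using d(2) by (intro psd_norm_le psd_square assms) (simp_all add: algebra_simps)
  with n d(1) show False by simp
qed

lemma unital_spectrum_diff:
  "complex_of_real r \<in> unital_spectrum (t *\<^sub>R 1 - a) \<Longrightarrow> complex_of_real (t - r) \<in> unital_spectrum a"
proof -
  have "complex_of_real r *\<^sub>C 1 - (t *\<^sub>R 1 - a) = - (complex_of_real (t - r) *\<^sub>C 1 - a)"
    by (simp add: scaleR_scaleC[symmetric] algebra_simps)
  then show "complex_of_real r \<in> unital_spectrum (t *\<^sub>R 1 - a) \<Longrightarrow> ?thesis"
    unfolding unital_spectrum_def mem_Collect_eq by (metis invertible_minus)
qed

text \<open>The norm of \<open>norm a - a\<close> is attained at a spectral value \<open>r\<close>,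
  and \<open>norm a - r\<close> lies in the spectrum of \<open>a\<close>, so between 0 and
  \<open>norm a\<close>. Thus \<open>t = norm a\<close> is a witness for \<open>psd\<close>.\<close>

lemma psdI_spectrum:
  fixes a :: "'a::unital_cstar_algebra"
  assumes "star a = a" "unital_spectrum a \<subseteq> complex_of_real ` {0..}"
  shows "psd a"
proof -
  let ?u = "norm a *\<^sub>R 1 - a"
  have "star ?u = ?u" using assms(1) by (simp add: star_diff star_scaleR)
  then obtain r where r: "\<bar>r\<bar> = norm ?u" "complex_of_real r \<in> unital_spectrum ?u"
    using norm_in_unital_spectrum by blast
  then have s: "complex_of_real (norm a - r) \<in> unital_spectrum a"
    by (intro unital_spectrum_diff)
  from subsetD[OF assms(2) this] have "0 \<le> norm a - r" by (auto simp flip: of_real_diff)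
  moreover from unital_spectrum_norm[OF s] have "\<bar>norm a - r\<bar> \<le> norm a"
    by (metis norm_of_real real_norm_def)
  ultimately have "norm ?u \<le> norm a" using r(1) by linarith
  with assms(1) show ?thesis unfolding psd_def by blast
qed

text \<open>Jacobson's formula: if \<open>z\<close> inverts \<open>c - y * x\<close>, then
  \<open>1 + x * z * y\<close> inverts \<open>c - x * y\<close> up to the factor
  \<open>c\<close>.\<close>

lemma unital_spectrum_mult_commute:
  fixes x y :: "'a::unital_cstar_algebra"
  assumes "c \<in> unital_spectrum (x * y)" "c \<noteq> 0"
  shows "c \<in> unital_spectrum (y * x)"
proof (rule ccontr)
  assume "c \<notin> unital_spectrum (y * x)"
  then obtain z where z: "(c *\<^sub>C 1 - y * x) * z = 1" "z * (c *\<^sub>C 1 - y * x) = 1"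
    by (auto simp: unital_spectrum_def invertible_elt_def)
  let ?v = "1 + x * z * y"
  have "(c *\<^sub>C 1 - x * y) * ?v = c *\<^sub>C 1 - x * y + x * ((c *\<^sub>C 1 - y * x) * z) * y"
    by (simp add: left_diff_distrib right_diff_distrib distrib_left distrib_right mult.assoc
      mult_scaleC_left mult_scaleC_right)
  then have 1: "(c *\<^sub>C 1 - x * y) * ?v = c *\<^sub>C 1" by (simp add: z)
  have "?v * (c *\<^sub>C 1 - x * y) = c *\<^sub>C 1 - x * y + x * (z * (c *\<^sub>C 1 - y * x)) * y"
    by (simp add: left_diff_distrib right_diff_distrib distrib_left distrib_right mult.assoc
      mult_scaleC_left mult_scaleC_right scaleC_add_right)
  then have 2: "?v * (c *\<^sub>C 1 - x * y) = c *\<^sub>C 1" by (simp add: z)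
  have "invertible_elt (c *\<^sub>C 1 - x * y)"
    unfolding invertible_elt_def using 1 2 assms(2)
    by (intro exI[of _ "inverse c *\<^sub>C ?v"]) (simp add: mult_scaleC_left mult_scaleC_right)
  with assms(1) show False by (simp add: unital_spectrum_def)
qed

section \<open>Polynomial functional calculus\<close>

definition peval :: "complex poly \<Rightarrow> 'a::unital_cstar_algebra \<Rightarrow> 'a" where
  "peval p a = fold_coeffs (\<lambda>c v. c *\<^sub>C 1 + a * v) p 0"

lemma peval_0 [simp]: "peval 0 a = 0"
  by (simp add: peval_def)

lemma peval_pCons [simp]: "peval (pCons c p) a = c *\<^sub>C 1 + a * peval p a"
  by (cases "p = 0 \<and> c = 0") (auto simp: peval_def)

lemma peval_add: "peval (p + q) a = peval p a + peval q a"
  by (induction p q rule: poly_induct2) (simp_all add: scaleC_add_left distrib_left)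

lemma peval_smult: "peval (smult c p) a = c *\<^sub>C peval p a"
  by (induction p) (simp_all add: scaleC_add_right scaleC_scaleC mult_scaleC_right)

lemma peval_diff: "peval (p - q) a = peval p a - peval q a"
  using peval_add[of p "- q" a] peval_smult[of "-1" q a] by simp

lemma peval_mult: "peval (p * q) a = peval p a * peval q a"
  by (induction p) (simp_all add: peval_add peval_smult distrib_right mult.assoc mult_scaleC_left)

text \<open>A polynomial splits into linear factors, and a factor belonging to a root outside the
  spectrum is invertible; some root must therefore be a spectral value.\<close>

lemma invertible_pevalD:
  assumes "\<not> invertible_elt (peval p a)" "p \<noteq> 0"
  shows "\<exists>c\<in>unital_spectrum a. poly p c = 0"
  using assms
proof (induction "degree p" arbitrary: p)
  case 0
  then obtain c where "p = [:c:]" "c \<noteq> 0"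
    by (metis degree_eq_zeroE pCons_0_0)
  with 0 have "\<not> invertible_elt (c *\<^sub>C (1::'a))" by simp
  moreover have "invertible_elt (1::'a)" by (auto simp: invertible_elt_def)
  ultimately show ?case using invertible_scaleC \<open>c \<noteq> 0\<close> by blast
next
  case (Suc n)
  then have "\<not> constant (poly p)" by (simp add: constant_degree)
  then obtain z where z: "poly p z = 0"
    using fundamental_theorem_of_algebra by blast
  then obtain q where q: "p = [:- z, 1:] * q" by (auto simp: poly_eq_0_iff_dvd)
  then have q0: "q \<noteq> 0" using Suc.prems(2) by auto
  then have dq: "n = degree q"
    using Suc.hyps(2) degree_mult_eq[of "[:- z, 1:]" q] unfolding q[symmetric] by simp
  show ?case
  proof (cases "z \<in> unital_spectrum a")
    case False
    then have "invertible_elt (- (z *\<^sub>C 1 - a))"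
      unfolding invertible_minus by (simp add: unital_spectrum_def)
    then have "invertible_elt (peval [:- z, 1:] a)" by simp
    then have "\<not> invertible_elt (peval q a)"
      using Suc.prems(1) unfolding q peval_mult by (blast intro: invertible_mult)
    from Suc.hyps(1)[OF dq this q0] obtain c where "c \<in> unital_spectrum a" "poly q c = 0" by blast
    then show ?thesis unfolding q by (intro bexI[of _ c]) auto
  qed (use z in blast)
qed

lemma unital_spectrum_peval:
  assumes "c \<in> unital_spectrum a"
  shows "poly p c \<in> unital_spectrum (peval p a)"
proof -
  have "poly (p - [:poly p c:]) c = 0" by simp
  then obtain q where q: "p - [:poly p c:] = [:- c, 1:] * q"
    unfolding poly_eq_0_iff_dvd by (elim dvdE)
  have l: "peval [:- c, 1:] a = - (c *\<^sub>C 1 - a)" by simp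
  have "peval (p - [:poly p c:]) a = - (poly p c *\<^sub>C 1 - peval p a)" by (simp add: peval_diff)
  moreover have "\<not> invertible_elt (peval [:- c, 1:] a * peval q a)"
  proof
    assume "invertible_elt (peval [:- c, 1:] a * peval q a)"
    moreover have "peval [:- c, 1:] a * peval q a = peval q a * peval [:- c, 1:] a"
      by (metis peval_mult mult.commute)
    ultimately have "invertible_elt (peval [:- c, 1:] a)" by (rule invertible_commuting_factor)
    with assms show False unfolding l invertible_minus by (simp add: unital_spectrum_def)
  qed
  ultimately show ?thesis
    unfolding q peval_mult unital_spectrum_def mem_Collect_eq by (metis invertible_minus)
qed

lemma poly_map_complex_of_real:
  "poly (map_poly complex_of_real q) (complex_of_real t) = complex_of_real (poly q t)"
  by (induction q) (simp_all add: map_poly_pCons)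

text \<open>Real coefficients keep the values at self-adjoint elements self-adjoint; the passage
  through complex polynomials gives access to the splitting into linear factors.\<close>

definition rpeval :: "real poly \<Rightarrow> 'a::unital_cstar_algebra \<Rightarrow> 'a" where
  "rpeval q a = peval (map_poly complex_of_real q) a"

lemma rpeval_0 [simp]: "rpeval 0 a = 0"
  by (simp add: rpeval_def)

lemma rpeval_pCons [simp]: "rpeval (pCons c q) a = c *\<^sub>R 1 + a * rpeval q a"
  by (cases "q = 0 \<and> c = 0") (auto simp: rpeval_def map_poly_pCons scaleR_scaleC)

lemma rpeval_add: "rpeval (p + q) a = rpeval p a + rpeval q a"
  by (induction p q rule: poly_induct2) (simp_all add: scaleR_add_left distrib_left)

lemma rpeval_smult: "rpeval (smult c p) a = c *\<^sub>R rpeval p a"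
  by (induction p) (simp_all add: scaleR_add_right)

lemma rpeval_diff: "rpeval (p - q) a = rpeval p a - rpeval q a"
  using rpeval_add[of p "- q" a] rpeval_smult[of "-1" q a] by simp

lemma rpeval_mult: "rpeval (p * q) a = rpeval p a * rpeval q a"
  by (induction p) (simp_all add: rpeval_add rpeval_smult distrib_right mult.assoc)

lemma rpeval_commute: "a * rpeval q a = rpeval q a * a"
  using rpeval_mult[of "[:0, 1:]" q a] rpeval_mult[of q "[:0, 1:]" a] by (simp add: mult.commute)

lemma rpeval_selfadjoint: "star h = h \<Longrightarrow> star (rpeval q h) = rpeval q h"
  by (induction q) (simp_all add: star_add star_scaleR star_mult rpeval_commute)

lemma norm_rpeval_le:
  fixes h :: "'a::unital_cstar_algebra"
  assumes h: "star h = h"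
    and M: "\<And>t. complex_of_real t \<in> unital_spectrum h \<Longrightarrow> \<bar>poly q t\<bar> \<le> M"
  shows "norm (rpeval q h) \<le> M"
proof -
  let ?p = "map_poly complex_of_real q"
  obtain r where r: "\<bar>r\<bar> = norm (rpeval q h)" "complex_of_real r \<in> unital_spectrum (rpeval q h)"
    using norm_in_unital_spectrum[OF rpeval_selfadjoint[OF h]] by blast
  have "\<exists>c\<in>unital_spectrum h. poly (?p - [:of_real r:]) c = 0"
  proof (cases "?p - [:of_real r:] = 0")
    case True
    \<comment> \<open>A constant polynomial equal to \<open>r\<close> has every point as a root, and
      the spectrum of a self-adjoint element is nonempty.\<close>
    then show ?thesis using norm_in_unital_spectrum[OF h] by auto
  next
    case False
    have "\<not> invertible_elt (peval (?p - [:of_real r:]) h)"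
      using r(2) unfolding peval_diff rpeval_def[symmetric] unital_spectrum_def mem_Collect_eq
      by (metis (no_types, lifting) add.right_neutral invertible_minus minus_diff_eq mult_zero_right peval_0 peval_pCons)
    from invertible_pevalD[OF this False] show ?thesis .
  qed
  then obtain c where c: "c \<in> unital_spectrum h" "poly ?p c = of_real r" by auto
  then obtain t where t: "c = of_real t"
    using unital_spectrum_selfadjoint[OF h c(1)] by (auto elim: Reals_cases)
  with c(2) have "poly q t = r" by (simp add: poly_map_complex_of_real)
  with M[of t] c(1) t r(1) show ?thesis by simp
qed

lemma norm_rpeval_ge:
  assumes "complex_of_real t \<in> unital_spectrum h"
  shows "\<bar>poly q t\<bar> \<le> norm (rpeval q h)"
  using unital_spectrum_norm[OF unital_spectrum_peval[OF assms, of "map_poly complex_of_real q"]]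
  by (simp add: rpeval_def poly_map_complex_of_real)

section \<open>The unitization\<close>

text \<open>For every C*-algebra \<open>A\<close>, unital or not, \<open>\<complex> \<times> A\<close> is a unital C*-algebra under the maximum
  of \<open>\<bar>c\<bar>\<close> and the operator norm of \<open>x \<mapsto> c x + a x\<close>.\<close>

definition left_mult :: "complex \<Rightarrow> 'a::cstar_algebra \<Rightarrow> 'a \<Rightarrow> 'a" where
  "left_mult c a x = c *\<^sub>C x + a * x"

lemma bounded_linear_left_mult: "bounded_linear (left_mult c a)"
proof (rule bounded_linear_intro[where K="cmod c + norm a"])
  show "norm (left_mult c a x) \<le> norm x * (cmod c + norm a)" for x
    using norm_triangle_ineq[of "c *\<^sub>C x" "a * x"] norm_mult_ineq[of a x]
    by (simp add: left_mult_def norm_scaleC algebra_simps)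
qed (simp_all add: left_mult_def scaleC_add_right distrib_left scaleR_scaleC scaleC_scaleC
    mult_scaleC_right mult.commute)

text \<open>A type of its own, because pairs already carry the Euclidean norm of the
  product.\<close>

typedef (overloaded) 'a uz = "UNIV :: (complex \<times> 'a::cstar_algebra) set" ..

setup_lifting type_definition_uz

lift_definition Uz :: "complex \<Rightarrow> 'a::cstar_algebra \<Rightarrow> 'a uz" is Pair .
lift_definition uz_scalar :: "'a::cstar_algebra uz \<Rightarrow> complex" is fst .
lift_definition uz_part :: "'a::cstar_algebra uz \<Rightarrow> 'a" is snd .

lemma uz_scalar_Uz [simp]: "uz_scalar (Uz c a) = c"
  by transfer simp

lemma uz_part_Uz [simp]: "uz_part (Uz c a) = a"
  by transfer simp

lemma uz_eq_iff: "u = v \<longleftrightarrow> uz_scalar u = uz_scalar v \<and> uz_part u = uz_part v"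
  by transfer (auto simp: prod_eq_iff)

instantiation uz :: (cstar_algebra) "{ring_1, scaleC, star}"
begin

definition zero_uz :: "'a uz" where "0 = Uz 0 0"
definition one_uz :: "'a uz" where "1 = Uz 1 0"
definition plus_uz :: "'a uz \<Rightarrow> 'a uz \<Rightarrow> 'a uz" where
  "u + v = Uz (uz_scalar u + uz_scalar v) (uz_part u + uz_part v)"
definition minus_uz :: "'a uz \<Rightarrow> 'a uz \<Rightarrow> 'a uz" where
  "u - v = Uz (uz_scalar u - uz_scalar v) (uz_part u - uz_part v)"
definition uminus_uz :: "'a uz \<Rightarrow> 'a uz" where
  "- u = Uz (- uz_scalar u) (- uz_part u)"
definition times_uz :: "'a uz \<Rightarrow> 'a uz \<Rightarrow> 'a uz" where
  "u * v = Uz (uz_scalar u * uz_scalar v)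
    (uz_scalar u *\<^sub>C uz_part v + uz_scalar v *\<^sub>C uz_part u + uz_part u * uz_part v)"
definition scaleC_uz :: "complex \<Rightarrow> 'a uz \<Rightarrow> 'a uz" where
  "c *\<^sub>C u = Uz (c * uz_scalar u) (c *\<^sub>C uz_part u)"
definition star_uz :: "'a uz \<Rightarrow> 'a uz" where
  "star u = Uz (cnj (uz_scalar u)) (star (uz_part u))"

instance
  by standard
    (simp_all add: zero_uz_def one_uz_def plus_uz_def minus_uz_def uminus_uz_def times_uz_def
      scaleC_uz_def uz_eq_iff algebra_simps scaleC_add_right scaleC_add_left
      scaleC_scaleC mult_scaleC_left mult_scaleC_right)

end

instantiation uz :: (cstar_algebra) real_algebra_1
begin

definition scaleR_uz :: "real \<Rightarrow> 'a uz \<Rightarrow> 'a uz" where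
  "scaleR_uz r u = complex_of_real r *\<^sub>C u"

instance
  by standard
    (simp_all add: scaleR_uz_def scaleC_uz_def plus_uz_def times_uz_def
      uz_eq_iff algebra_simps scaleC_add_right scaleC_add_left
      scaleC_scaleC mult_scaleC_left mult_scaleC_right one_uz_def)

end

lemma uz_scalar_simps [simp]:
  "uz_scalar 0 = 0" "uz_scalar 1 = 1" "uz_scalar (u + v) = uz_scalar u + uz_scalar v"
  "uz_scalar (u - v) = uz_scalar u - uz_scalar v" "uz_scalar (- u) = - uz_scalar u"
  "uz_scalar (u * v) = uz_scalar u * uz_scalar v" "uz_scalar (c *\<^sub>C u) = c * uz_scalar u"
  "uz_scalar (r *\<^sub>R u) = complex_of_real r * uz_scalar u" "uz_scalar (star u) = cnj (uz_scalar u)"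
  for u v :: "'a::cstar_algebra uz"
  by (simp_all add: zero_uz_def one_uz_def plus_uz_def minus_uz_def uminus_uz_def times_uz_def
      scaleC_uz_def scaleR_uz_def star_uz_def)

lemma uz_part_simps [simp]:
  "uz_part 0 = 0" "uz_part 1 = 0" "uz_part (u + v) = uz_part u + uz_part v"
  "uz_part (u - v) = uz_part u - uz_part v" "uz_part (- u) = - uz_part u"
  "uz_part (u * v) = uz_scalar u *\<^sub>C uz_part v + uz_scalar v *\<^sub>C uz_part u + uz_part u * uz_part v"
  "uz_part (c *\<^sub>C u) = c *\<^sub>C uz_part u" "uz_part (r *\<^sub>R u) = r *\<^sub>R uz_part u"
  "uz_part (star u) = star (uz_part u)"
  for u v :: "'a::cstar_algebra uz"
  by (simp_all add: zero_uz_def one_uz_def plus_uz_def minus_uz_def uminus_uz_def times_uz_def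
      scaleC_uz_def scaleR_uz_def star_uz_def scaleR_scaleC)

definition uz_act :: "'a::cstar_algebra uz \<Rightarrow> 'a \<Rightarrow> 'a" where
  "uz_act u = left_mult (uz_scalar u) (uz_part u)"

lemma bounded_linear_uz_act: "bounded_linear (uz_act u)"
  by (simp add: uz_act_def bounded_linear_left_mult)

lemma uz_act_simps:
  "uz_act (u + v) x = uz_act u x + uz_act v x" "uz_act (u * v) x = uz_act u (uz_act v x)"
  "uz_act (c *\<^sub>C u) x = c *\<^sub>C uz_act u x" "uz_act 1 x = x" "uz_act (Uz 0 a) x = a * x"
  "star y * uz_act u x = star (uz_act (star u) y) * x"
  by (simp_all add: uz_act_def left_mult_def scaleC_add_left scaleC_add_right scaleC_scaleC
      distrib_left distrib_right mult_scaleC_left mult_scaleC_right mult.assoc star_add star_mult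
      star_scaleC star_star)

lemma norm_uz_act: "norm (uz_act u x) \<le> onorm (uz_act u) * norm x"
  by (rule onorm[OF bounded_linear_uz_act])

lemma onorm_uz_act_le: "(\<And>x. norm (uz_act u x) \<le> b * norm x) \<Longrightarrow> 0 \<le> b \<Longrightarrow> onorm (uz_act u) \<le> b"
  by (rule onorm_bound)

lemma onorm_uz_act_ge0: "0 \<le> onorm (uz_act u)"
  by (rule onorm_pos_le[OF bounded_linear_uz_act])

lemma onorm_uz_act_mult: "onorm (uz_act (u * v)) \<le> onorm (uz_act u) * onorm (uz_act v)"
proof (rule onorm_uz_act_le)
  fix x
  have "norm (uz_act u (uz_act v x)) \<le> onorm (uz_act u) * (onorm (uz_act v) * norm x)"
    by (meson norm_uz_act mult_left_mono onorm_uz_act_ge0 order_trans)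
  then show "norm (uz_act (u * v) x) \<le> onorm (uz_act u) * onorm (uz_act v) * norm x"
    by (simp add: uz_act_simps)
qed (simp add: onorm_uz_act_ge0)

text \<open>Left multiplication by \<open>a\<close> attains the norm of \<open>a\<close> at the
  multiples of \<open>star a\<close>, by the C*-identity.\<close>

lemma onorm_uz_act_Uz: "onorm (uz_act (Uz 0 a)) = norm a"
proof (rule antisym)
  show "onorm (uz_act (Uz 0 a)) \<le> norm a"
    by (rule onorm_uz_act_le) (simp_all add: uz_act_simps norm_mult_ineq)
  show "norm a \<le> onorm (uz_act (Uz 0 a))"
  proof (cases "a = 0")
    case False
    have "norm a * norm a \<le> onorm (uz_act (Uz 0 a)) * norm a"
      using norm_uz_act[of "Uz 0 a" "star a"] cstar_identity'[of a]
      by (simp add: uz_act_simps power2_eq_square)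
    with False show ?thesis by simp
  qed (simp add: onorm_uz_act_ge0)
qed

lemma onorm_uz_act_cstar: "(onorm (uz_act u))\<^sup>2 \<le> onorm (uz_act (star u * u))"
proof -
  have "norm (uz_act u x) \<le> sqrt (onorm (uz_act (star u * u))) * norm x" for x
  proof -
    have "(norm (uz_act u x))\<^sup>2 = norm (star (uz_act u x) * uz_act u x)"
      by (rule cstar_identity[symmetric])
    also have "\<dots> = norm (star (uz_act (star u * u) x) * x)"
      by (simp add: uz_act_simps)
    also have "\<dots> \<le> onorm (uz_act (star u * u)) * norm x * norm x"
      by (rule order_trans[OF norm_mult_ineq]) (simp add: norm_uz_act mult_right_mono)
    finally have "norm (uz_act u x) \<le> sqrt (onorm (uz_act (star u * u)) * (norm x)\<^sup>2)"
      by (simp add: real_le_rsqrt power2_eq_square)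
    then show ?thesis by (simp add: real_sqrt_mult)
  qed
  then have "onorm (uz_act u) \<le> sqrt (onorm (uz_act (star u * u)))"
    by (intro onorm_uz_act_le) (simp_all add: onorm_uz_act_ge0)
  then show ?thesis
    using onorm_uz_act_ge0 by (metis power_mono real_sqrt_pow2)
qed

lemma onorm_uz_act_scaleC: "onorm (uz_act (c *\<^sub>C u)) = cmod c * onorm (uz_act u)"
proof -
  have le: "onorm (uz_act (c *\<^sub>C u)) \<le> cmod c * onorm (uz_act u)" for c and u :: "'a uz"
    by (rule onorm_uz_act_le)
      (simp_all add: uz_act_simps norm_scaleC mult.assoc mult_left_mono norm_uz_act onorm_uz_act_ge0)
  have "cmod c * onorm (uz_act u) \<le> onorm (uz_act (c *\<^sub>C u))"
  proof (cases "c = 0")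
    case False
    have "inverse c *\<^sub>C (c *\<^sub>C u) = u"
      using False by (simp add: uz_eq_iff scaleC_scaleC)
    with le[of "inverse c" "c *\<^sub>C u"] have "onorm (uz_act u) \<le> cmod (inverse c) * onorm (uz_act (c *\<^sub>C u))"
      by simp
    with False show ?thesis by (simp add: norm_divide field_simps)
  qed (simp add: onorm_uz_act_ge0)
  with le[of c u] show ?thesis by linarith
qed

instantiation uz :: (cstar_algebra) real_normed_algebra_1
begin

text \<open>If \<open>A\<close> has a unit \<open>e\<close>, the nonzero element
  \<open>1 - e\<close> acts as 0, so the operator norm alone is only a seminorm; the modulus of the
  scalar repairs this and is multiplicative itself.\<close>

definition norm_uz :: "'a uz \<Rightarrow> real" where
  "norm u = max (cmod (uz_scalar u)) (onorm (uz_act u))"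
definition dist_uz :: "'a uz \<Rightarrow> 'a uz \<Rightarrow> real" where
  "dist_uz u v = norm (u - v)"
definition sgn_uz :: "'a uz \<Rightarrow> 'a uz" where
  "sgn_uz u = u /\<^sub>R norm u"
definition uniformity_uz :: "('a uz \<times> 'a uz) filter" where
  "uniformity_uz = (INF e\<in>{0<..}. principal {(u, v). dist (u::'a uz) v < e})"
definition open_uz :: "'a uz set \<Rightarrow> bool" where
  "open_uz U = (\<forall>u\<in>U. eventually (\<lambda>(u', v). u' = u \<longrightarrow> v \<in> U) uniformity)"

instance
proof
  fix u v :: "'a uz" and r :: real
  show "dist u v = norm (u - v)" by (rule dist_uz_def)
  show "sgn u = u /\<^sub>R norm u" by (rule sgn_uz_def)
  show "(uniformity :: ('a uz \<times> 'a uz) filter) = (INF e\<in>{0<..}. principal {(u, v). dist u v < e})"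
    by (rule uniformity_uz_def)
  show "open U = (\<forall>u\<in>U. \<forall>\<^sub>F (u', v) in uniformity. u' = u \<longrightarrow> v \<in> U)" for U :: "'a uz set"
    by (rule open_uz_def)
  show "norm u = 0 \<longleftrightarrow> u = 0"
  proof
    assume n: "norm u = 0"
    then have c: "uz_scalar u = 0"
      unfolding norm_uz_def by (metis max.cobounded1 norm_le_zero_iff)
    then have "u = Uz 0 (uz_part u)" by (simp add: uz_eq_iff)
    then have "norm (uz_part u) \<le> 0"
      using n unfolding norm_uz_def by (metis max.cobounded2 onorm_uz_act_Uz)
    with c show "u = 0" by (simp add: uz_eq_iff)
  next
    assume "u = 0"
    then show "norm u = 0"
      using onorm_uz_act_Uz[of "0::'a"] by (simp add: norm_uz_def zero_uz_def)
  qed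
  have "onorm (uz_act (u + v)) \<le> onorm (uz_act u) + onorm (uz_act v)"
    unfolding uz_act_simps(1)[abs_def] by (intro onorm_triangle bounded_linear_uz_act)
  then show "norm (u + v) \<le> norm u + norm v"
    using norm_triangle_ineq[of "uz_scalar u" "uz_scalar v"] by (auto simp: norm_uz_def)
  show "norm (r *\<^sub>R u) = \<bar>r\<bar> * norm u"
    by (simp add: norm_uz_def scaleR_uz_def onorm_uz_act_scaleC norm_mult max_mult_distrib_left)
  show "norm (u * v) \<le> norm u * norm v"
    unfolding norm_uz_def
  proof (rule max.boundedI)
    let ?U = "max (cmod (uz_scalar u)) (onorm (uz_act u))"
    let ?V = "max (cmod (uz_scalar v)) (onorm (uz_act v))"
    have "cmod (uz_scalar u) * cmod (uz_scalar v) \<le> ?U * ?V"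
      by (intro mult_mono) (auto simp: le_max_iff_disj)
    then show "cmod (uz_scalar (u * v)) \<le> ?U * ?V" by (simp add: norm_mult)
    have "onorm (uz_act u) * onorm (uz_act v) \<le> ?U * ?V"
      by (intro mult_mono) (auto simp: le_max_iff_disj onorm_uz_act_ge0)
    then show "onorm (uz_act (u * v)) \<le> ?U * ?V"
      using onorm_uz_act_mult order_trans by blast
  qed
  have "onorm (uz_act (1 :: 'a uz)) \<le> 1"
    by (rule onorm_uz_act_le) (simp_all add: uz_act_simps)
  then show "norm (1 :: 'a uz) = 1" by (simp add: norm_uz_def)
qed

end

instance uz :: (cstar_algebra) unital_cstar_algebra
proof
  fix u v :: "'a uz" and r :: real and c d :: complex
  show "r *\<^sub>R u = complex_of_real r *\<^sub>C u" by (rule scaleR_uz_def)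
  show "norm (c *\<^sub>C u) = cmod c * norm u"
    by (simp add: norm_uz_def onorm_uz_act_scaleC norm_mult max_mult_distrib_left)
  show "c *\<^sub>C (u + v) = c *\<^sub>C u + c *\<^sub>C v" "(c + d) *\<^sub>C u = c *\<^sub>C u + d *\<^sub>C u"
    "c *\<^sub>C d *\<^sub>C u = (c * d) *\<^sub>C u" "(c *\<^sub>C u) * v = c *\<^sub>C (u * v)" "u * (c *\<^sub>C v) = c *\<^sub>C (u * v)"
    "star (star u) = u" "star (u + v) = star u + star v" "star (u * v) = star v * star u"
    "star (c *\<^sub>C u) = cnj c *\<^sub>C star u"
    by (simp_all add: uz_eq_iff algebra_simps scaleC_add_right scaleC_add_left
      scaleC_scaleC mult_scaleC_left mult_scaleC_right star_star star_add star_mult star_scaleC)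
  show "norm (star u * u) = (norm u)\<^sup>2"
  proof (rule antisym)
    \<comment> \<open>The square of the operator norm of \<open>w\<close> is at most that of
      \<open>star w * w\<close>, hence at most the product of those of \<open>star w\<close> and
      \<open>w\<close>; cancelling gives one inequality, and applying it to \<open>star w\<close>
      the other.\<close>
    have st: "onorm (uz_act (star u)) = onorm (uz_act u)"
    proof -
      have le: "onorm (uz_act w) \<le> onorm (uz_act (star w))" for w :: "'a uz"
      proof (cases "onorm (uz_act w) = 0")
        case False
        have "onorm (uz_act w) * onorm (uz_act w) \<le> onorm (uz_act (star w)) * onorm (uz_act w)"
          using onorm_uz_act_cstar[of w] onorm_uz_act_mult[of "star w" w]
          by (simp add: power2_eq_square)
        with False onorm_uz_act_ge0[of w] show ?thesis by simp
      qed (simp add: onorm_uz_act_ge0)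
      have "star (star u) = u" by (simp add: uz_eq_iff star_star)
      with le[of u] le[of "star u"] show ?thesis by simp
    qed
    have c: "onorm (uz_act (star u * u)) = (onorm (uz_act u))\<^sup>2"
      using onorm_uz_act_cstar[of u] onorm_uz_act_mult[of "star u" u]
      by (simp add: st power2_eq_square)
    have m: "(max x y)\<^sup>2 = max (x\<^sup>2) (y\<^sup>2)" if "0 \<le> x" "0 \<le> y" for x y :: real
      using that by (auto simp: max_def power2_le_iff_abs_le)
    show "norm (star u * u) \<le> (norm u)\<^sup>2" "(norm u)\<^sup>2 \<le> norm (star u * u)"
      unfolding norm_uz_def c m[OF norm_ge_zero onorm_uz_act_ge0]
      by (simp_all add: norm_mult power2_eq_square)
  qed
next
  fix X :: "nat \<Rightarrow> 'a uz" assume C: "Cauchy X"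
  have "Cauchy (\<lambda>n. uz_scalar (X n))"
  proof (rule metric_CauchyI)
    fix e :: real assume "0 < e"
    with C obtain M where "\<forall>m\<ge>M. \<forall>n\<ge>M. norm (X m - X n) < e"
      unfolding Cauchy_def dist_uz_def by blast
    then show "\<exists>M. \<forall>m\<ge>M. \<forall>n\<ge>M. dist (uz_scalar (X m)) (uz_scalar (X n)) < e"
      by (auto simp: norm_uz_def dist_norm)
  qed
  then obtain c where c: "(\<lambda>n. uz_scalar (X n)) \<longlonglongrightarrow> c"
    by (auto simp: Cauchy_convergent_iff convergent_def)
  \<comment> \<open>The part in \<open>A\<close> acts as \<open>w\<close> minus its scalar, and both
    have operator norm at most \<open>norm w\<close>. Hence a Cauchy sequence is Cauchy in each
    coordinate.\<close>
  have le: "norm (uz_part w) \<le> 2 * norm w" for w :: "'a uz"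
  proof -
    have "norm (uz_part w) = onorm (uz_act (Uz 0 (uz_part w)))" by (simp add: onorm_uz_act_Uz)
    also have "\<dots> \<le> 2 * norm w"
    proof (rule onorm_uz_act_le)
      fix x
      have "uz_act (Uz 0 (uz_part w)) x = uz_act w x - uz_scalar w *\<^sub>C x"
        by (simp add: uz_act_def left_mult_def)
      then have "norm (uz_act (Uz 0 (uz_part w)) x) \<le> norm (uz_act w x) + cmod (uz_scalar w) * norm x"
        by (metis norm_scaleC norm_triangle_ineq4)
      also have "\<dots> \<le> norm w * norm x + norm w * norm x"
        using norm_uz_act[of w x]
        by (intro add_mono order_trans[OF norm_uz_act] mult_right_mono) (auto simp: norm_uz_def)
      finally show "norm (uz_act (Uz 0 (uz_part w)) x) \<le> 2 * norm w * norm x" by (simp add: mult_ac)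
    qed (auto simp: norm_uz_def le_max_iff_disj)
    finally show ?thesis .
  qed
  have "Cauchy (\<lambda>n. uz_part (X n))"
  proof (rule metric_CauchyI)
    fix e :: real assume "0 < e"
    with C obtain M where M: "\<forall>m\<ge>M. \<forall>n\<ge>M. norm (X m - X n) < e / 2"
      unfolding Cauchy_def dist_uz_def by (meson half_gt_zero)
    have "norm (uz_part (X m) - uz_part (X n)) < e" if "m \<ge> M" "n \<ge> M" for m n
      using le[of "X m - X n"] M that by fastforce
    then show "\<exists>M. \<forall>m\<ge>M. \<forall>n\<ge>M. dist (uz_part (X m)) (uz_part (X n)) < e"
      by (auto simp: dist_norm)
  qed
  then obtain a where a: "(\<lambda>n. uz_part (X n)) \<longlonglongrightarrow> a"
    by (auto simp: Cauchy_convergent_iff convergent_def)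
  have le2: "norm w \<le> cmod (uz_scalar w) + norm (uz_part w)" for w :: "'a uz"
  proof -
    have "onorm (uz_act w) \<le> cmod (uz_scalar w) + norm (uz_part w)"
    proof (rule onorm_uz_act_le)
      fix x
      show "norm (uz_act w x) \<le> (cmod (uz_scalar w) + norm (uz_part w)) * norm x"
        unfolding uz_act_def left_mult_def distrib_right
        using norm_mult_ineq[of "uz_part w" x]
        by (intro norm_triangle_le add_mono) (simp_all add: norm_scaleC)
    qed simp
    then show ?thesis by (simp add: norm_uz_def)
  qed
  have "(\<lambda>n. dist (X n) (Uz c a)) \<longlonglongrightarrow> 0"
  proof (rule Lim_null_comparison)
    show "\<forall>\<^sub>F n in sequentially. norm (dist (X n) (Uz c a))
        \<le> dist (uz_scalar (X n)) c + dist (uz_part (X n)) a"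
      using le2 by (intro always_eventually allI) (metis abs_norm_cancel dist_norm dist_uz_def
          real_norm_def uz_part_Uz uz_part_simps(4) uz_scalar_Uz uz_scalar_simps(4))
    show "(\<lambda>n. dist (uz_scalar (X n)) c + dist (uz_part (X n)) a) \<longlonglongrightarrow> 0"
      using tendsto_add[OF c[THEN tendsto_dist_iff[THEN iffD1]] a[THEN tendsto_dist_iff[THEN iffD1]]]
      by simp
  qed
  then have "\<exists>l. \<forall>e>0. \<exists>N. \<forall>n\<ge>N. dist (X n) l < e"
    by (auto simp: LIMSEQ_def)
  then obtain l where "\<forall>e>0. \<exists>N. \<forall>n\<ge>N. dist (X n) l < e" by blast
  then show "convergent X"
    unfolding convergent_def tendsto_iff eventually_sequentially by blast
qed

lemma Uz_simps:
  "Uz 0 (a + b) = Uz 0 a + Uz 0 b" "Uz 0 (a - b) = Uz 0 a - Uz 0 b" "Uz 0 (- a) = - Uz 0 a"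
  "Uz 0 (a * b) = Uz 0 a * Uz 0 b" "Uz 0 (r *\<^sub>R a) = r *\<^sub>R Uz 0 a" "Uz 0 (c *\<^sub>C a) = c *\<^sub>C Uz 0 a"
  "Uz 0 (star a) = star (Uz 0 a)" "Uz 0 0 = 0"
  for a b :: "'a::cstar_algebra"
  by (simp_all add: uz_eq_iff)

lemma norm_Uz [simp]: "norm (Uz 0 a) = norm a"
  by (simp add: norm_uz_def onorm_uz_act_Uz)

lemma Uz_eq_iff [simp]: "Uz 0 a = Uz 0 b \<longleftrightarrow> a = b"
  by (simp add: uz_eq_iff)

lemma Uz_sum: "Uz 0 (\<Sum>i\<in>A. f i) = (\<Sum>i\<in>A. Uz 0 (f i :: 'a::cstar_algebra))"
  by (induction A rule: infinite_finite_induct) (simp_all add: Uz_simps)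

section \<open>Intrinsic spectra compared with the spectrum in the unitization\<close>

lemma unit_of_unique: "unit_of B e \<Longrightarrow> unit_of B e' \<Longrightarrow> e = e'"
  unfolding unit_of_def by metis

text \<open>A unit is adjoined even if \<open>B\<close> has one, which accounts for the extra value
  0. If \<open>e\<close> is the unit of \<open>B\<close>, an inverse of \<open>c e - a\<close> in
  \<open>B\<close> is completed by \<open>1/c\<close> on the complement \<open>1 - e\<close>;
  otherwise the inverse in the unitization of \<open>B\<close> serves as it is.\<close>

lemma unital_spectrum_Uz_subset:
  assumes "a \<in> B"
  shows "unital_spectrum (Uz 0 a) \<subseteq> spectrum B a \<union> {0}"
proof (rule subsetI, rule ccontr)
  fix c assume c: "c \<in> unital_spectrum (Uz 0 a)" and "c \<notin> spectrum B a \<union> {0}"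
  then have nc: "c \<notin> spectrum B a" and c0: "c \<noteq> 0" by auto
  have "invertible_elt (c *\<^sub>C 1 - Uz 0 a)"
  proof (cases "\<exists>e. unit_of B e")
    case True
    with nc obtain e z where e: "unit_of B e" and z: "z \<in> B"
      "(c *\<^sub>C e - a) * z = e" "z * (c *\<^sub>C e - a) = e"
      by (auto simp: spectrum_def)
    have "a * e = a" "e * a = a" "e * z = z" "z * e = z"
      using e z(1) assms by (auto simp: unit_of_def)
    then have az: "a * z = c *\<^sub>C z - e" "z * a = c *\<^sub>C z - e"
      using z by (simp_all add: left_diff_distrib right_diff_distrib mult_scaleC_left
          mult_scaleC_right algebra_simps)
    show ?thesis
      unfolding invertible_elt_def
      by (intro exI[of _ "Uz (inverse c) (z - inverse c *\<^sub>C e)"])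
        (simp add: uz_eq_iff c0 az \<open>a * e = a\<close> \<open>e * a = a\<close> scaleC_scaleC mult_scaleC_left
          mult_scaleC_right scaleC.scale_right_diff_distrib left_diff_distrib right_diff_distrib)
  next
    case False
    with nc obtain z where z: "unitization_mult (c, - a) z = (1, 0)" "unitization_mult z (c, - a) = (1, 0)"
      by (auto simp: spectrum_def)
    then show ?thesis
      unfolding invertible_elt_def
      by (intro exI[of _ "Uz (fst z) (snd z)"]) (simp add: uz_eq_iff unitization_mult_def)
  qed
  with c show False by (simp add: unital_spectrum_def)
qed

lemma spectrum_UNIV_subset: "spectrum UNIV a \<subseteq> unital_spectrum (Uz 0 a)"
  for a :: "'a::cstar_algebra"
proof (rule subsetI, rule ccontr)
  fix c assume c: "c \<in> spectrum UNIV a" and "c \<notin> unital_spectrum (Uz 0 a)"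
  then obtain v where v: "(c *\<^sub>C 1 - Uz 0 a) * v = 1" "v * (c *\<^sub>C 1 - Uz 0 a) = 1"
    by (auto simp: unital_spectrum_def invertible_elt_def)
  let ?d = "uz_scalar v" and ?w = "uz_part v"
  have d: "c * ?d = 1" and w: "c *\<^sub>C ?w - ?d *\<^sub>C a - a * ?w = 0" "c *\<^sub>C ?w - ?d *\<^sub>C a - ?w * a = 0"
    using v by (simp_all add: uz_eq_iff)
  show False
  proof (cases "\<exists>e. unit_of (UNIV::'a set) e")
    case True
    then obtain e :: 'a where e: "unit_of UNIV e" by blast
    then have [simp]: "e * x = x" "x * e = x" for x by (auto simp: unit_of_def)
    \<comment> \<open>Sending the adjoined unit to \<open>e\<close> is a homomorphism onto the
      unital algebra, so it carries the inverse \<open>v\<close> to an inverse of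
      \<open>c e - a\<close>.\<close>
    have "(c *\<^sub>C e - a) * (?d *\<^sub>C e + ?w) = (c * ?d) *\<^sub>C e + (c *\<^sub>C ?w - ?d *\<^sub>C a - a * ?w)"
      "(?d *\<^sub>C e + ?w) * (c *\<^sub>C e - a) = (c * ?d) *\<^sub>C e + (c *\<^sub>C ?w - ?d *\<^sub>C a - ?w * a)"
      by (simp_all add: left_diff_distrib right_diff_distrib distrib_left distrib_right
          mult_scaleC_left mult_scaleC_right scaleC_scaleC scaleC_add_right
          scaleC.scale_right_diff_distrib mult.commute)
    with d w e c True show False by (auto simp: spectrum_def)
  next
    case False
    with c have "\<not> (\<exists>z. unitization_mult (c, - a) z = (1, 0) \<and> unitization_mult z (c, - a) = (1, 0))"
      by (simp add: spectrum_def)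
    moreover have "unitization_mult (c, - a) (?d, ?w) = (1, 0)" "unitization_mult (?d, ?w) (c, - a) = (1, 0)"
      using d w by (simp_all add: unitization_mult_def algebra_simps)
    ultimately show False by blast
  qed
qed

lemma spectrum_unital: "spectrum UNIV a = unital_spectrum (a :: 'a::unital_cstar_algebra)"
proof -
  have "unit_of UNIV (1::'a)" by (simp add: unit_of_def)
  with unit_of_unique[of UNIV "1::'a"] show ?thesis
    by (auto simp: spectrum_def unital_spectrum_def invertible_elt_def)
qed

text \<open>The spectrum in the unitization exceeds the intrinsic one by at most 0, which is
  harmless for positivity. As \<open>B\<close> is arbitrary, this carries positivity from the fixed
  point algebra to the whole algebra.\<close>

lemma positive_elt_psd: "positive_elt B a \<Longrightarrow> psd (Uz 0 a)"
proof (rule psdI_spectrum)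
  assume "positive_elt B a"
  then show "star (Uz 0 a) = Uz 0 a" "unital_spectrum (Uz 0 a) \<subseteq> complex_of_real ` {0..}"
    using unital_spectrum_Uz_subset[of a B] by (force simp: positive_elt_def Uz_simps[symmetric])+
qed

lemma positive_elt_iff_psd: "positive_elt UNIV a \<longleftrightarrow> psd (Uz 0 a)"
proof
  assume p: "psd (Uz 0 a)"
  then have "star a = a" using psd_selfadjoint[OF p] by (simp add: Uz_simps(7)[symmetric])
  with unital_spectrum_psd[OF p] spectrum_UNIV_subset[of a] show "positive_elt UNIV a"
    by (auto simp: positive_elt_def)
qed (rule positive_elt_psd)

section \<open>Continuous functional calculus\<close>

lemma rpeval_altdef: "rpeval q u = (\<Sum>i\<le>degree q. coeff q i *\<^sub>R u ^ i)"
proof (induction q)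
  case (pCons c q)
  show ?case
  proof (cases "q = 0")
    case False
    have "u * rpeval q u = (\<Sum>i\<le>degree q. coeff q i *\<^sub>R u ^ Suc i)"
      by (simp add: pCons.IH sum_distrib_left)
    with False show ?thesis
      by (simp add: sum.atMost_Suc_shift del: sum.atMost_Suc)
  qed simp
qed simp

lemma Uz_poly_calc: "Uz 0 (poly_calc q a) = rpeval (pCons 0 q) (Uz 0 a)"
proof -
  have "Uz 0 (((\<lambda>x. a * x) ^^ i) a) = Uz 0 a * Uz 0 a ^ i" for i
    by (induction i) (simp_all add: Uz_simps power_commutes)
  then show ?thesis
    by (simp add: poly_calc_def rpeval_altdef[of q] Uz_sum Uz_simps sum_distrib_left)
qed

definition real_spectrum :: "'a::cstar_algebra \<Rightarrow> real set" where
  "real_spectrum a = {t. complex_of_real t \<in> spectrum UNIV a}"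

lemma poly_calc_diff: "poly_calc (p - q) a = poly_calc p a - poly_calc q a"
proof -
  have "Uz 0 (poly_calc (p - q) a) = Uz 0 (poly_calc p a - poly_calc q a)"
    by (simp add: Uz_poly_calc Uz_simps rpeval_diff right_diff_distrib)
  then show ?thesis by simp
qed

lemma poly_calc_mult: "poly_calc (pCons 0 (p * q)) a = poly_calc p a * poly_calc q a"
proof -
  have "Uz 0 (poly_calc (pCons 0 (p * q)) a) = Uz 0 (poly_calc p a * poly_calc q a)"
    by (simp add: Uz_poly_calc Uz_simps rpeval_mult mult.assoc) (metis mult.assoc rpeval_commute)
  then show ?thesis by simp
qed

lemma poly_calc_1 [simp]: "poly_calc [:1:] a = a"
  by (simp add: poly_calc_def)

lemma poly_calc_selfadjoint:
  assumes "star a = a" shows "star (poly_calc q a) = poly_calc q a"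
proof -
  have "star (Uz 0 (poly_calc q a)) = Uz 0 (poly_calc q a)"
    unfolding Uz_poly_calc using assms by (intro rpeval_selfadjoint) (simp add: Uz_simps(7)[symmetric])
  then show ?thesis by (simp add: Uz_simps(7)[symmetric])
qed

text \<open>The unitization may add the spectral value 0, where \<open>t * poly q t\<close>
  vanishes; the assumption \<open>0 \<le> M\<close> takes care of it.\<close>

lemma norm_poly_calc_le:
  assumes "star a = a" "0 \<le> M" "\<And>t. t \<in> real_spectrum a \<Longrightarrow> \<bar>t * poly q t\<bar> \<le> M"
  shows "norm (poly_calc q a) \<le> M"
proof -
  have "norm (rpeval (pCons 0 q) (Uz 0 a)) \<le> M"
  proof (rule norm_rpeval_le)
    show "star (Uz 0 a) = Uz 0 a" using assms(1) by (simp add: Uz_simps(7)[symmetric])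
    fix t assume "complex_of_real t \<in> unital_spectrum (Uz 0 a)"
    then have "t \<in> real_spectrum a \<or> t = 0"
      using unital_spectrum_Uz_subset[of a UNIV] by (auto simp: real_spectrum_def)
    with assms show "\<bar>poly (pCons 0 q) t\<bar> \<le> M" by auto
  qed
  then show ?thesis by (metis Uz_poly_calc norm_Uz)
qed

lemma norm_poly_calc_ge:
  assumes "t \<in> real_spectrum a" shows "\<bar>t * poly q t\<bar> \<le> norm (poly_calc q a)"
proof -
  have "complex_of_real t \<in> unital_spectrum (Uz 0 a)"
    using assms spectrum_UNIV_subset by (auto simp: real_spectrum_def)
  from norm_rpeval_ge[OF this, of "pCons 0 q"] show ?thesis
    by (simp add: Uz_poly_calc[symmetric] del: rpeval_pCons)
qed

lemma real_spectrum_norm: "t \<in> real_spectrum a \<Longrightarrow> \<bar>t\<bar> \<le> norm a"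
  using norm_poly_calc_ge[of t a "[:1:]"] by simp

lemma spectrum_selfadjoint:
  assumes "star a = a" "c \<in> spectrum UNIV a"
  shows "\<exists>t\<in>real_spectrum a. c = complex_of_real t"
proof -
  have "c \<in> \<real>"
    using assms spectrum_UNIV_subset[of a]
    by (intro unital_spectrum_selfadjoint[of "Uz 0 a"]) (auto simp: Uz_simps(7)[symmetric])
  with assms show ?thesis by (auto simp: real_spectrum_def elim!: Reals_cases)
qed

lemma positive_real_spectrum: "positive_elt UNIV a \<Longrightarrow> t \<in> real_spectrum a \<Longrightarrow> 0 \<le> t"
  by (auto simp: positive_elt_def real_spectrum_def)

lemma positive_eltI:
  assumes "star a = a" "\<And>t. t \<in> real_spectrum a \<Longrightarrow> 0 \<le> t" shows "positive_elt UNIV a"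
  unfolding positive_elt_def
proof (intro conjI subsetI UNIV_I assms(1))
  fix c assume "c \<in> spectrum UNIV a"
  with spectrum_selfadjoint[OF assms(1)] assms(2) show "c \<in> complex_of_real ` {0..}" by force
qed

text \<open>Two approximating sequences become uniformly close on the spectrum, so their values at
  \<open>a\<close> become close in norm. Applied to one sequence this is convergence, applied to two
  it is independence of the choice, which determines the \<open>THE\<close> in
  \<open>fun_calc\<close>.\<close>

lemma fun_calc_tendsto:
  assumes sa: "star a = a"
    and q: "uniform_limit (real_spectrum a) (\<lambda>n t. t * poly (q n) t) f sequentially"
  shows "(\<lambda>n. poly_calc (q n) a) \<longlonglongrightarrow> fun_calc UNIV f a"
proof -
  have close: "\<exists>N. \<forall>m\<ge>N. \<forall>n\<ge>N. norm (poly_calc (p m) a - poly_calc (q n) a) < e"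
    if p: "uniform_limit (real_spectrum a) (\<lambda>n t. t * poly (p n) t) f sequentially"
      and q: "uniform_limit (real_spectrum a) (\<lambda>n t. t * poly (q n) t) f sequentially"
      and e: "0 < e" for p q :: "nat \<Rightarrow> real poly" and e :: real
  proof -
    from uniform_limitD[OF p, of "e / 4"] e obtain N1 where
      N1: "\<And>n t. n \<ge> N1 \<Longrightarrow> t \<in> real_spectrum a \<Longrightarrow> \<bar>t * poly (p n) t - f t\<bar> < e / 4"
      by (auto simp: eventually_sequentially dist_real_def)
    from uniform_limitD[OF q, of "e / 4"] e obtain N2 where
      N2: "\<And>n t. n \<ge> N2 \<Longrightarrow> t \<in> real_spectrum a \<Longrightarrow> \<bar>t * poly (q n) t - f t\<bar> < e / 4"
      by (auto simp: eventually_sequentially dist_real_def)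
    have "norm (poly_calc (p m) a - poly_calc (q n) a) < e" if "m \<ge> max N1 N2" "n \<ge> max N1 N2" for m n
    proof -
      have "norm (poly_calc (p m - q n) a) \<le> e / 2"
      proof (rule norm_poly_calc_le[OF sa])
        fix t assume "t \<in> real_spectrum a"
        with that have "\<bar>t * poly (p m) t - f t\<bar> < e / 4" "\<bar>t * poly (q n) t - f t\<bar> < e / 4"
          using N1[of m t] N2[of n t] by simp_all
        then have "\<bar>t * poly (p m) t - t * poly (q n) t\<bar> \<le> e / 2" by linarith
        then show "\<bar>t * poly (p m - q n) t\<bar> \<le> e / 2" by (simp add: right_diff_distrib)
      qed (use e in simp)
      with e show ?thesis by (simp add: poly_calc_diff)
    qed
    then show ?thesis by blast
  qed
  have "Cauchy (\<lambda>n. poly_calc (q n) a)"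
    using close[OF q q] by (auto simp: Cauchy_def dist_norm)
  then obtain c where c: "(\<lambda>n. poly_calc (q n) a) \<longlonglongrightarrow> c"
    by (auto simp: Cauchy_convergent_iff convergent_def)
  have "fun_calc UNIV f a = c"
    unfolding fun_calc_def real_spectrum_def[symmetric]
  proof (rule the_equality)
    show "\<exists>q. uniform_limit (real_spectrum a) (\<lambda>n t. t * poly (q n) t) f sequentially \<and>
      (\<lambda>n. poly_calc (q n) a) \<longlonglongrightarrow> c"
      using q c by blast
    fix d assume "\<exists>p. uniform_limit (real_spectrum a) (\<lambda>n t. t * poly (p n) t) f sequentially \<and>
      (\<lambda>n. poly_calc (p n) a) \<longlonglongrightarrow> d"
    then obtain p where p: "uniform_limit (real_spectrum a) (\<lambda>n t. t * poly (p n) t) f sequentially"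
      "(\<lambda>n. poly_calc (p n) a) \<longlonglongrightarrow> d" by blast
    have "(\<lambda>n. poly_calc (p n) a - poly_calc (q n) a) \<longlonglongrightarrow> 0"
      using close[OF p(1) q] unfolding LIMSEQ_iff by (metis diff_zero)
    with tendsto_diff[OF p(2) c] have "d - c = 0" using LIMSEQ_unique by blast
    then show "d = c" by simp
  qed
  with c show ?thesis by simp
qed

text \<open>Continuity is asked on the whole line instead of the spectrum, so that it can be checked
  without reference to an element. In return, functions below are written with absolute values and
  maxima to make sense for negative arguments.\<close>

definition admissible :: "(real \<Rightarrow> real) \<Rightarrow> bool" where
  "admissible f \<longleftrightarrow> continuous_on UNIV f \<and> f 0 = 0"

lemma admissible_approx:
  assumes "admissible f"
  shows "\<exists>q. uniform_limit (real_spectrum a) (\<lambda>n t. t * poly (q n) t) f sequentially"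
proof -
  let ?R = "norm a"
  have "\<exists>q. \<forall>t\<in>{- ?R..?R}. \<bar>t * poly q t - f t\<bar> < e" if e: "0 < e" for e
  proof -
    have "continuous_on {- ?R..?R} f"
      using assms continuous_on_subset by (auto simp: admissible_def)
    from Stone_Weierstrass_real_polynomial_function[OF _ this, of "e / 2"] e
    obtain g where g: "real_polynomial_function g" "\<And>t. t \<in> {- ?R..?R} \<Longrightarrow> \<bar>f t - g t\<bar> < e / 2"
      by auto
    then obtain c n where "g = (\<lambda>t. \<Sum>i\<le>n. c i * t ^ i)"
      by (auto simp: real_polynomial_function_iff_sum)
    then have "g = poly (\<Sum>i\<le>n. monom (c i) i)" by (auto simp: poly_sum poly_monom)
    then obtain p where p: "g = poly p" by blast
    \<comment> \<open>The constant coefficient \<open>c\<close> approximates \<open>f 0 = 0\<close>,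
      so dropping it costs another \<open>e / 2\<close> and leaves a polynomial of the form
      \<open>t * poly q t\<close>.\<close>
    obtain c q where q: "p = pCons c q" by (cases p)
    have "\<bar>c\<bar> < e / 2" using g(2)[of 0] assms by (simp add: p q admissible_def)
    moreover have "\<bar>f t - (c + t * poly q t)\<bar> < e / 2" if "t \<in> {- ?R..?R}" for t
      using g(2)[OF that] by (simp add: p q)
    ultimately have "\<bar>t * poly q t - f t\<bar> < e" if "t \<in> {- ?R..?R}" for t
      using that by (smt (verit) field_sum_of_halves)
    then show ?thesis by blast
  qed
  then have "\<exists>q. \<forall>t\<in>{- ?R..?R}. \<bar>t * poly q t - f t\<bar> < inverse (real (Suc n))" for n
    by simp
  then obtain q where q: "\<And>n t. t \<in> {- ?R..?R} \<Longrightarrow> \<bar>t * poly (q n) t - f t\<bar> < inverse (real (Suc n))"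
    by metis
  have "uniform_limit (real_spectrum a) (\<lambda>n t. t * poly (q n) t) f sequentially"
  proof (rule uniform_limitI)
    fix e :: real assume "0 < e"
    then obtain N where N: "inverse (real (Suc N)) < e" using reals_Archimedean by blast
    show "\<forall>\<^sub>F n in sequentially. \<forall>t\<in>real_spectrum a. dist (t * poly (q n) t) (f t) < e"
    proof (rule eventually_sequentiallyI, rule ballI)
      fix n t assume n: "N \<le> n" and "t \<in> real_spectrum a"
      then have "t \<in> {- ?R..?R}" using real_spectrum_norm[of t a] by auto
      from q[OF this, of n] have "\<bar>t * poly (q n) t - f t\<bar> < inverse (real (Suc n))" .
      also have "\<dots> \<le> inverse (real (Suc N))" using n by (intro le_imp_inverse_le) auto
      finally show "dist (t * poly (q n) t) (f t) < e" using N by (simp add: dist_real_def)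
    qed
  qed
  then show ?thesis by blast
qed

context
  fixes a :: "'a::cstar_algebra"
  assumes sa: "star a = a"
begin

lemma fun_calc_mult:
  assumes f: "admissible f" and g: "admissible g"
  shows "fun_calc UNIV (\<lambda>t. f t * g t) a = fun_calc UNIV f a * fun_calc UNIV g a"
proof -
  obtain p where p: "uniform_limit (real_spectrum a) (\<lambda>n t. t * poly (p n) t) f sequentially"
    using admissible_approx[OF f] by blast
  obtain q where q: "uniform_limit (real_spectrum a) (\<lambda>n t. t * poly (q n) t) g sequentially"
    using admissible_approx[OF g] by blast
  have b: "bounded (h ` real_spectrum a)" if "admissible h" for h
  proof -
    have "compact (h ` {- norm a..norm a})"
      using that by (intro compact_continuous_image) (auto simp: admissible_def intro: continuous_on_subset)
    moreover have "h ` real_spectrum a \<subseteq> h ` {- norm a..norm a}"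
      using real_spectrum_norm by fastforce
    ultimately show ?thesis by (meson bounded_subset compact_imp_bounded)
  qed
  have "uniform_limit (real_spectrum a) (\<lambda>n t. (t * poly (p n) t) * (t * poly (q n) t))
      (\<lambda>t. f t * g t) sequentially"
    by (intro uniform_lim_mult p q b f g)
  then have "uniform_limit (real_spectrum a) (\<lambda>n t. t * poly (pCons 0 (p n * q n)) t)
      (\<lambda>t. f t * g t) sequentially"
    by (simp add: mult_ac)
  then have 1: "(\<lambda>n. poly_calc (p n) a * poly_calc (q n) a) \<longlonglongrightarrow> fun_calc UNIV (\<lambda>t. f t * g t) a"
    unfolding poly_calc_mult[symmetric] by (rule fun_calc_tendsto[OF sa])
  have "(\<lambda>n. poly_calc (p n) a * poly_calc (q n) a) \<longlonglongrightarrow> fun_calc UNIV f a * fun_calc UNIV g a"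
    by (intro tendsto_mult fun_calc_tendsto sa p q)
  with 1 show ?thesis by (rule LIMSEQ_unique)
qed

lemma fun_calc_diff:
  assumes f: "admissible f" and g: "admissible g"
  shows "fun_calc UNIV (\<lambda>t. f t - g t) a = fun_calc UNIV f a - fun_calc UNIV g a"
proof -
  obtain p where p: "uniform_limit (real_spectrum a) (\<lambda>n t. t * poly (p n) t) f sequentially"
    using admissible_approx[OF f] by blast
  obtain q where q: "uniform_limit (real_spectrum a) (\<lambda>n t. t * poly (q n) t) g sequentially"
    using admissible_approx[OF g] by blast
  have "uniform_limit (real_spectrum a) (\<lambda>n t. t * poly (p n) t - t * poly (q n) t)
      (\<lambda>t. f t - g t) sequentially"
    by (intro uniform_limit_intros p q)
  then have "uniform_limit (real_spectrum a) (\<lambda>n t. t * poly (p n - q n) t) (\<lambda>t. f t - g t) sequentially"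
    by (simp add: right_diff_distrib)
  then have 1: "(\<lambda>n. poly_calc (p n) a - poly_calc (q n) a) \<longlonglongrightarrow> fun_calc UNIV (\<lambda>t. f t - g t) a"
    unfolding poly_calc_diff[symmetric] by (rule fun_calc_tendsto[OF sa])
  have "(\<lambda>n. poly_calc (p n) a - poly_calc (q n) a) \<longlonglongrightarrow> fun_calc UNIV f a - fun_calc UNIV g a"
    by (intro tendsto_diff fun_calc_tendsto sa p q)
  with 1 show ?thesis by (rule LIMSEQ_unique)
qed

lemma fun_calc_id: "fun_calc UNIV (\<lambda>t. t) a = a"
proof -
  have "uniform_limit (real_spectrum a) (\<lambda>n t. t * poly [:1:] t) (\<lambda>t. t) sequentially"
    by (auto intro!: uniform_limitI)
  from fun_calc_tendsto[OF sa this] show ?thesis by (simp add: LIMSEQ_const_iff)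
qed

lemma fun_calc_selfadjoint:
  assumes "admissible f" shows "star (fun_calc UNIV f a) = fun_calc UNIV f a"
proof -
  obtain p where p: "uniform_limit (real_spectrum a) (\<lambda>n t. t * poly (p n) t) f sequentially"
    using admissible_approx[OF assms] by blast
  have "(\<lambda>n. poly_calc (p n) a) \<longlonglongrightarrow> star (fun_calc UNIV f a)"
    using tendsto_star[OF fun_calc_tendsto[OF sa p]] by (simp add: poly_calc_selfadjoint[OF sa])
  then show ?thesis using fun_calc_tendsto[OF sa p] by (rule LIMSEQ_unique)
qed

lemma norm_fun_calc_le:
  assumes f: "admissible f" and "0 \<le> M" and M: "\<And>t. t \<in> real_spectrum a \<Longrightarrow> \<bar>f t\<bar> \<le> M"
  shows "norm (fun_calc UNIV f a) \<le> M"
proof (rule field_le_epsilon)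
  fix e :: real assume e: "0 < e"
  obtain p where p: "uniform_limit (real_spectrum a) (\<lambda>n t. t * poly (p n) t) f sequentially"
    using admissible_approx[OF f] by blast
  have "\<forall>\<^sub>F n in sequentially. norm (poly_calc (p n) a) \<le> M + e"
    using uniform_limitD[OF p e]
  proof (rule eventually_mono)
    fix n assume n: "\<forall>t\<in>real_spectrum a. dist (t * poly (p n) t) (f t) < e"
    show "norm (poly_calc (p n) a) \<le> M + e"
    proof (rule norm_poly_calc_le[OF sa])
      fix t assume t: "t \<in> real_spectrum a"
      with n M[OF t] show "\<bar>t * poly (p n) t\<bar> \<le> M + e" by (auto simp: dist_real_def)
    qed (use e assms in simp)
  qed
  with tendsto_norm[OF fun_calc_tendsto[OF sa p]] show "norm (fun_calc UNIV f a) \<le> M + e"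
    by (auto intro: tendsto_upperbound)
qed

lemma norm_fun_calc_ge:
  assumes f: "admissible f" and t: "t \<in> real_spectrum a"
  shows "\<bar>f t\<bar> \<le> norm (fun_calc UNIV f a)"
proof -
  obtain p where p: "uniform_limit (real_spectrum a) (\<lambda>n t. t * poly (p n) t) f sequentially"
    using admissible_approx[OF f] by blast
  have "(\<lambda>n. \<bar>t * poly (p n) t\<bar>) \<longlonglongrightarrow> \<bar>f t\<bar>"
    by (intro tendsto_rabs tendsto_uniform_limitI[OF p t])
  from LIMSEQ_le[OF this tendsto_norm[OF fun_calc_tendsto[OF sa p]]] show ?thesis
    using norm_poly_calc_ge[OF t] by blast
qed

lemma fun_calc_cong:
  assumes f: "admissible f" and g: "admissible g" and "\<And>t. t \<in> real_spectrum a \<Longrightarrow> f t = g t"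
  shows "fun_calc UNIV f a = fun_calc UNIV g a"
proof -
  have "admissible (\<lambda>t. f t - g t)"
    using f g by (auto simp: admissible_def intro!: continuous_intros)
  from norm_fun_calc_le[OF this, of 0] assms show ?thesis by (simp add: fun_calc_diff)
qed

text \<open>Values of the calculus are limits of polynomials without constant term, so they stay in
  every closed subalgebra containing \<open>a\<close>. This makes functions of invariant elements
  invariant.\<close>

lemma fun_calc_mem:
  assumes f: "admissible f" and B: "a \<in> B" "closed B"
    and B': "\<And>x y. x \<in> B \<Longrightarrow> y \<in> B \<Longrightarrow> x + y \<in> B" "\<And>x y. x \<in> B \<Longrightarrow> y \<in> B \<Longrightarrow> x * y \<in> B"
      "\<And>r x. x \<in> B \<Longrightarrow> r *\<^sub>R x \<in> B"
  shows "fun_calc UNIV f a \<in> B"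
proof -
  obtain p where p: "uniform_limit (real_spectrum a) (\<lambda>n t. t * poly (p n) t) f sequentially"
    using admissible_approx[OF f] by blast
  have pw: "((\<lambda>x. a * x) ^^ i) a \<in> B" for i
    by (induction i) (simp_all add: B B')
  have "0 \<in> B" using B'(3)[OF B(1), of 0] by simp
  then have "(\<Sum>i\<in>A. coeff q i *\<^sub>R ((\<lambda>x. a * x) ^^ i) a) \<in> B" for A q
    by (induction A rule: infinite_finite_induct) (simp_all add: pw B')
  then have "poly_calc q a \<in> B" for q by (simp add: poly_calc_def)
  then show ?thesis
    using closed_sequentially[OF B(2) _ fun_calc_tendsto[OF sa p]] by blast
qed

end

lemma admissible_sqrt: "admissible f \<Longrightarrow> admissible (\<lambda>t. sqrt (f t))"
  by (auto simp: admissible_def intro!: continuous_intros)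

lemma admissible_mult: "admissible f \<Longrightarrow> admissible g \<Longrightarrow> admissible (\<lambda>t. f t * g t)"
  by (auto simp: admissible_def intro!: continuous_intros)

lemma admissible_id: "admissible (\<lambda>t. t)"
  by (auto simp: admissible_def intro!: continuous_intros)

lemma psd_Uz_square: "star h = h \<Longrightarrow> psd (Uz 0 (h * h))"
  unfolding Uz_simps by (rule psd_square) (simp add: Uz_simps(7)[symmetric])

lemma fun_calc_sqrt:
  assumes "star a = a" "admissible f" "\<And>t. 0 \<le> f t"
  shows "fun_calc UNIV (\<lambda>t. sqrt (f t)) a * fun_calc UNIV (\<lambda>t. sqrt (f t)) a = fun_calc UNIV f a"
  using fun_calc_mult[OF assms(1) admissible_sqrt admissible_sqrt, OF assms(2,2)] assms(3) by simp

text \<open>If \<open>x\<^sup>* x\<close> had negative part \<open>n \<noteq> 0\<close>, then \<open>y = x n\<close> would satisfy \<open>y\<^sup>* y = - n\<^sup>3 \<le> 0\<close>, hence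
  \<open>y y\<^sup>* \<le> 0\<close> as well; but \<open>y\<^sup>* y + y y\<^sup>* \<ge> 0\<close>.\<close>

theorem positive_star_mult: "positive_elt UNIV (star x * x)" for x :: "'a::cstar_algebra"
proof -
  let ?h = "star x * x"
  have h: "star ?h = ?h" by (simp add: star_mult star_star)
  let ?m = "\<lambda>t::real. max 0 (- t)"
  have m: "admissible ?m" by (auto simp: admissible_def intro!: continuous_intros)
  let ?n = "fun_calc UNIV ?m ?h"
  let ?m3 = "\<lambda>t. ?m t * (?m t * ?m t)"
  have m3: "admissible ?m3" by (intro admissible_mult m)
  let ?k = "fun_calc UNIV ?m3 ?h"
  define y where "y = x * ?n"
  have "star y * y = ?n * (?h * ?n)"
    by (simp add: y_def star_mult fun_calc_selfadjoint[OF h m] mult.assoc)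
  also have "\<dots> = fun_calc UNIV (\<lambda>t. ?m t * (t * ?m t)) ?h"
    by (simp only: fun_calc_mult[OF h] fun_calc_id[OF h] m admissible_mult admissible_id)
  also have "\<dots> = fun_calc UNIV (\<lambda>t. 0 - ?m3 t) ?h"
    by (rule arg_cong[where f="\<lambda>f. fun_calc UNIV f ?h"]) (auto simp: max_def)
  also have "\<dots> = fun_calc UNIV (\<lambda>t. 0) ?h - ?k"
    by (intro fun_calc_diff h m3) (simp add: admissible_def)
  also have "fun_calc UNIV (\<lambda>t. 0) ?h = 0"
    using norm_fun_calc_le[OF h, of "\<lambda>t. 0" 0] by (simp add: admissible_def)
  finally have yk: "star y * y = - ?k" by simp
  have "psd (Uz 0 ?k)"
    using psd_Uz_square[OF fun_calc_selfadjoint[OF h admissible_sqrt[OF m3]]] fun_calc_sqrt[OF h m3] by simp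
  let ?Y = "Uz 0 y" and ?K = "Uz 0 ?k"
  have YK: "star ?Y * ?Y = - ?K" using yk by (simp add: Uz_simps[symmetric])
  \<comment> \<open>The products \<open>star y * y\<close> and \<open>y * star y\<close> share their
    nonzero spectrum, so that of \<open>- (y * star y)\<close> lies in the spectrum of
    \<open>?k\<close> together with 0.\<close>
  have "psd (- (?Y * star ?Y))"
  proof (rule psdI_spectrum)
    show "star (- (?Y * star ?Y)) = - (?Y * star ?Y)" by (simp add: star_mult star_star)
    show "unital_spectrum (- (?Y * star ?Y)) \<subseteq> complex_of_real ` {0..}"
    proof
      fix c assume c: "c \<in> unital_spectrum (- (?Y * star ?Y))"
      show "c \<in> complex_of_real ` {0..}"
      proof (cases "c = 0")
        case False
        have "c \<in> unital_spectrum ((- ?Y) * star ?Y)" using c by simp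
        from unital_spectrum_mult_commute[OF this False] have "c \<in> unital_spectrum ?K"
          by (simp add: YK)
        with unital_spectrum_psd[OF \<open>psd ?K\<close>] show ?thesis by blast
      qed auto
    qed
  qed
  moreover have "psd (?Y * star ?Y)"
  proof -
    \<comment> \<open>\<open>p\<close> and \<open>q\<close> are the real and imaginary parts of
      \<open>y\<close>; twice the sum of their squares is
      \<open>y * star y + star y * y\<close>.\<close>
    define p where "p = (1/2) *\<^sub>R (?Y + star ?Y)"
    define q where "q = (\<i> / 2) *\<^sub>C (star ?Y - ?Y)"
    have "star p = p" "star q = q"
      by (simp_all add: p_def q_def star_scaleR star_add star_star star_scaleC star_diff add.commute)
        (metis minus_diff_eq scaleC.scale_minus_left scaleC.scale_minus_right)
    then have "psd (2 *\<^sub>R (p * p + q * q) + ?K)"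
      by (intro psd_add psd_scaleR psd_square \<open>psd ?K\<close>) auto
    also have "2 *\<^sub>R (p * p + q * q) = ?Y * star ?Y + star ?Y * ?Y"
    proof -
      have "4 *\<^sub>R (p * p) = (?Y + star ?Y) * (?Y + star ?Y)" by (simp add: p_def)
      moreover have "4 *\<^sub>R (q * q) = - ((star ?Y - ?Y) * (star ?Y - ?Y))"
        by (simp add: q_def mult_scaleC_left mult_scaleC_right scaleC_scaleC scaleR_scaleC)
      ultimately have "4 *\<^sub>R (p * p + q * q) = 2 *\<^sub>R (?Y * star ?Y + star ?Y * ?Y)"
        by (simp add: scaleR_add_right algebra_simps scaleR_2)
      then have "(1/2) *\<^sub>R 4 *\<^sub>R (p * p + q * q) = (1/2) *\<^sub>R 2 *\<^sub>R (?Y * star ?Y + star ?Y * ?Y)"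
        by simp
      then show ?thesis by simp
    qed
    finally show ?thesis by (simp add: YK)
  qed
  ultimately have "?Y * star ?Y = 0" by (intro psd_antisym)
  then have "norm y = 0" using cstar_identity'[of ?Y] by simp
  then have "?k = 0" using yk by simp
  show ?thesis
  proof (rule positive_eltI[OF h])
    fix t assume "t \<in> real_spectrum ?h"
    from norm_fun_calc_ge[OF h m3 this] have "?m3 t = 0"
      by (simp only: \<open>?k = 0\<close> norm_zero abs_le_zero_iff)
    then have "?m t = 0" by (simp only: mult_eq_0_iff disj_absorb)
    then show "0 \<le> t" by linarith
  qed
qed

lemma psd_star_mult: "psd (star u * u)" for u :: "'a::unital_cstar_algebra"
  using positive_star_mult[of u] by (intro psdI_spectrum) (auto simp: positive_elt_def spectrum_unital)

section \<open>Cuntz subequivalence of corners\<close>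

lemma psd_zero [simp]: "psd 0"
  using psd_of_real[of 0] by simp

lemma psd_sum: "(\<And>i. i \<in> A \<Longrightarrow> psd (f i)) \<Longrightarrow> psd (sum f A)"
  by (induction A rule: infinite_finite_induct) (simp_all add: psd_add)

lemma psd_conjugate:
  fixes a :: "'a::unital_cstar_algebra"
  assumes "psd a" shows "psd (star u * a * u)"
proof -
  obtain s where s: "star s = s" "s * s = a" using psd_sqrt[OF assms] by blast
  have "star u * a * u = star (s * u) * (s * u)"
    unfolding s(2)[symmetric] by (simp add: star_mult s(1) mult.assoc)
  then show ?thesis using psd_star_mult by metis
qed

lemma psd_Uz_star_mult: "psd (Uz 0 (star x * x))"
  using positive_star_mult positive_elt_iff_psd by blast

lemma psd_Uz_norm_mono: "psd (Uz 0 a) \<Longrightarrow> psd (Uz 0 (b - a)) \<Longrightarrow> norm a \<le> norm b"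
  using psd_norm_mono[of "Uz 0 a" "Uz 0 b"] by (simp add: Uz_simps(2))

lemma psd_Uz_column: "psd (Uz 0 (\<Sum>i\<in>A. star (v i) * v i))"
  unfolding Uz_sum by (rule psd_sum) (rule psd_Uz_star_mult)

section \<open>Columns over a C*-algebra as a Hilbert module\<close>

lemma column_norm_nonneg: "0 \<le> column_norm n v"
  by (simp add: column_norm_def)

lemma column_norm_square: "(column_norm n v)\<^sup>2 = norm (\<Sum>i<n. star (v i) * v i)"
  by (simp add: column_norm_def)

lemma norm_component_le_column_norm:
  assumes "i < n" shows "norm (v i) \<le> column_norm n v"
proof -
  have "norm (star (v i) * v i) \<le> norm (\<Sum>i<n. star (v i) * v i)"
  proof (rule psd_Uz_norm_mono[OF psd_Uz_star_mult])
    have "(\<Sum>i<n. star (v i) * v i) - star (v i) * v i = (\<Sum>i\<in>{..<n} - {i}. star (v i) * v i)"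
      using assms by (simp add: sum_diff1)
    then show "psd (Uz 0 ((\<Sum>i<n. star (v i) * v i) - star (v i) * v i))"
      using psd_Uz_column by metis
  qed
  then have "(norm (v i))\<^sup>2 \<le> (column_norm n v)\<^sup>2"
    by (simp add: cstar_identity column_norm_square)
  then show ?thesis using column_norm_nonneg power2_le_imp_le by blast
qed

text \<open>Cauchy-Schwarz for the inner product of columns. With \<open>Z\<close> the inner product
  of \<open>u\<close> and \<open>v\<close> and \<open>M\<close> the norm of that of \<open>u\<close>
  with itself, expand the positive inner square of \<open>v - u Z / M\<close> and estimate the inner
  square of \<open>u\<close> by \<open>M\<close>; what remains is
  \<open>star Z * Z \<le> M * V\<close>, where \<open>V\<close> is the inner square of
  \<open>v\<close>.\<close>

lemma norm_sum_star_mult_le: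
  "norm (\<Sum>i<n. star (u i) * v i) \<le> column_norm n u * column_norm n v"
proof (cases "column_norm n u = 0")
  case True
  then have "u i = 0" if "i < n" for i
    using norm_component_le_column_norm[OF that, of u] by simp
  with True show ?thesis by simp
next
  case False
  let ?S = "\<Sum>i<n. star (u i) * u i" and ?V = "\<Sum>i<n. star (v i) * v i"
  let ?Z = "\<Sum>i<n. star (u i) * v i"
  define M where "M = (column_norm n u)\<^sup>2"
  have M: "0 < M" using False by (simp add: M_def)
  have sZ: "star ?Z = (\<Sum>i<n. star (v i) * u i)" by (simp add: star_sum star_mult star_star)
  define w where "w i = v i - (1/M) *\<^sub>R (u i * ?Z)" for i
  have "(\<Sum>i<n. star (w i) * w i) = ?V - (1/M) *\<^sub>R (star ?Z * ?Z) - (1/M) *\<^sub>R (star ?Z * ?Z)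
      + (1/M * (1/M)) *\<^sub>R (star ?Z * ?S * ?Z)"
  proof -
    have "star (w i) * w i = star (v i) * v i - (1/M) *\<^sub>R ((star (v i) * u i) * ?Z)
      - (1/M) *\<^sub>R (star ?Z * (star (u i) * v i))
      + (1/M * (1/M)) *\<^sub>R (star ?Z * (star (u i) * u i) * ?Z)" for i
      by (simp add: w_def star_diff star_scaleR star_mult left_diff_distrib right_diff_distrib
          scaleR_diff_right mult.assoc)
    then show ?thesis
      unfolding sZ
      by (simp add: sum.distrib sum_subtractf sum_distrib_left[symmetric] sum_distrib_right[symmetric]
          scaleR_sum_right[symmetric])
  qed
  then have 1: "psd (Uz 0 (?V - (1/M) *\<^sub>R (star ?Z * ?Z) - (1/M) *\<^sub>R (star ?Z * ?Z)
      + (1/M * (1/M)) *\<^sub>R (star ?Z * ?S * ?Z)))"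
    using psd_Uz_column by metis
  have "norm ?S = M" by (simp add: M_def column_norm_square)
  moreover have "psd (norm (Uz 0 ?S) *\<^sub>R 1 - Uz 0 ?S)"
    by (rule psd_norm_minus) (simp add: Uz_simps(7)[symmetric] star_sum star_mult star_star)
  ultimately have "psd ((1/M * (1/M)) *\<^sub>R (star (Uz 0 ?Z) * (M *\<^sub>R 1 - Uz 0 ?S) * Uz 0 ?Z))"
    using M by (intro psd_scaleR psd_conjugate) auto
  also have "(1/M * (1/M)) *\<^sub>R (star (Uz 0 ?Z) * (M *\<^sub>R 1 - Uz 0 ?S) * Uz 0 ?Z)
    = Uz 0 ((1/M) *\<^sub>R (star ?Z * ?Z) - (1/M * (1/M)) *\<^sub>R (star ?Z * ?S * ?Z))"
    using M by (simp add: Uz_simps left_diff_distrib right_diff_distrib scaleR_diff_right)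
  finally have 2: "psd (Uz 0 ((1/M) *\<^sub>R (star ?Z * ?Z) - (1/M * (1/M)) *\<^sub>R (star ?Z * ?S * ?Z)))" .
  from psd_add[OF 1 2] have "psd (Uz 0 (?V - (1/M) *\<^sub>R (star ?Z * ?Z)))"
    unfolding Uz_simps(1)[symmetric] by simp
  moreover have "psd (Uz 0 ((1/M) *\<^sub>R (star ?Z * ?Z)))"
    unfolding Uz_simps(5) using M by (intro psd_scaleR psd_Uz_star_mult) auto
  ultimately have "norm ((1/M) *\<^sub>R (star ?Z * ?Z)) \<le> norm ?V" by (rule psd_Uz_norm_mono[rotated])
  then have "(norm ?Z)\<^sup>2 \<le> M * norm ?V" using M by (simp add: cstar_identity field_simps)
  then have "(norm ?Z)\<^sup>2 \<le> (column_norm n u * column_norm n v)\<^sup>2"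
    by (simp add: M_def power_mult_distrib column_norm_square)
  then show ?thesis
    using column_norm_nonneg power2_le_imp_le mult_nonneg_nonneg by blast
qed

lemma column_norm_triangle:
  "column_norm n (\<lambda>i. u i + v i) \<le> column_norm n u + column_norm n v"
proof -
  have "(column_norm n (\<lambda>i. u i + v i))\<^sup>2 = norm ((\<Sum>i<n. star (u i) * u i) + (\<Sum>i<n. star (u i) * v i)
      + (\<Sum>i<n. star (v i) * u i) + (\<Sum>i<n. star (v i) * v i))"
    by (simp add: column_norm_square star_add distrib_left distrib_right sum.distrib add_ac)
  also have "\<dots> \<le> (column_norm n u)\<^sup>2 + column_norm n u * column_norm n v
      + column_norm n v * column_norm n u + (column_norm n v)\<^sup>2"
    by (intro norm_triangle_le add_mono norm_sum_star_mult_le) (simp_all add: column_norm_square)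
  also have "\<dots> = (column_norm n u + column_norm n v)\<^sup>2"
    by (simp add: power2_eq_square algebra_simps)
  finally show ?thesis
    using column_norm_nonneg power2_le_imp_le add_nonneg_nonneg by blast
qed

lemma column_norm_uminus [simp]: "column_norm n (\<lambda>i. - v i) = column_norm n v"
  by (simp add: column_norm_def)

lemma column_norm_mult_right:
  "column_norm n (\<lambda>i. u i * t) \<le> column_norm n u * norm t"
proof -
  have "(\<Sum>i<n. star (u i * t) * (u i * t)) = star t * (\<Sum>i<n. star (u i) * u i) * t"
    by (simp add: star_mult sum_distrib_left sum_distrib_right mult.assoc)
  then have "(column_norm n (\<lambda>i. u i * t))\<^sup>2 = norm (star t * (\<Sum>i<n. star (u i) * u i) * t)"
    by (simp add: column_norm_square)
  also have "\<dots> \<le> norm t * (column_norm n u)\<^sup>2 * norm t"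
    unfolding column_norm_square
    by (rule order_trans[OF norm_mult_ineq], rule mult_right_mono)
      (rule order_trans[OF norm_mult_ineq], simp_all)
  also have "\<dots> = (column_norm n u * norm t)\<^sup>2" by (simp add: power2_eq_square)
  finally show ?thesis
    using column_norm_nonneg power2_le_imp_le mult_nonneg_nonneg norm_ge_zero by blast
qed

lemma column_norm_single: "column_norm (Suc n) (\<lambda>i. if i = 0 then x else 0) = norm x"
proof -
  have "(\<Sum>i<Suc n. star (if i = 0 then x else 0) * (if i = 0 then x else 0))
      = (\<Sum>i<Suc n. if i = 0 then star x * x else 0)"
    by (intro sum.cong) auto
  then have "(column_norm (Suc n) (\<lambda>i. if i = 0 then x else 0))\<^sup>2 = (norm x)\<^sup>2"
    by (simp add: column_norm_square cstar_identity del: sum.lessThan_Suc)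
  from power2_eq_imp_eq[OF this column_norm_nonneg norm_ge_zero] show ?thesis .
qed

lemma column_norm_le_sum: "column_norm n v \<le> (\<Sum>i<n. norm (v i))"
proof -
  have "(column_norm n v)\<^sup>2 \<le> (\<Sum>i<n. (norm (v i))\<^sup>2)"
    unfolding column_norm_square by (rule order_trans[OF norm_sum]) (simp add: cstar_identity)
  then have "column_norm n v \<le> L2_set (\<lambda>i. norm (v i)) {..<n}"
    unfolding L2_set_def by (rule real_le_rsqrt)
  also have "\<dots> \<le> (\<Sum>i<n. norm (v i))" by (rule L2_set_le_sum) simp
  finally show ?thesis .
qed

section \<open>Matrix norms and the reduction to the upper left entry\<close>

definition star_subalgebra :: "'a::cstar_algebra set \<Rightarrow> bool" where
  "star_subalgebra B \<longleftrightarrow> 0 \<in> B \<and> (\<forall>x\<in>B. \<forall>y\<in>B. x + y \<in> B \<and> x * y \<in> B) \<and>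
    (\<forall>x\<in>B. star x \<in> B \<and> (\<forall>c. c *\<^sub>C x \<in> B))"

lemma star_subalgebraD:
  assumes "star_subalgebra B"
  shows "0 \<in> B" "\<And>x y. x \<in> B \<Longrightarrow> y \<in> B \<Longrightarrow> x + y \<in> B" "\<And>x y. x \<in> B \<Longrightarrow> y \<in> B \<Longrightarrow> x * y \<in> B"
    "\<And>x. x \<in> B \<Longrightarrow> star x \<in> B" "\<And>c x. x \<in> B \<Longrightarrow> c *\<^sub>C x \<in> B" "\<And>r x. x \<in> B \<Longrightarrow> r *\<^sub>R x \<in> B"
    "\<And>x y. x \<in> B \<Longrightarrow> y \<in> B \<Longrightarrow> x - y \<in> B"
    "\<And>f A. (\<And>i. i \<in> A \<Longrightarrow> f i \<in> B) \<Longrightarrow> sum f A \<in> B"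
proof -
  show *: "0 \<in> B" "\<And>x y. x \<in> B \<Longrightarrow> y \<in> B \<Longrightarrow> x + y \<in> B" "\<And>x y. x \<in> B \<Longrightarrow> y \<in> B \<Longrightarrow> x * y \<in> B"
    "\<And>x. x \<in> B \<Longrightarrow> star x \<in> B" "\<And>c x. x \<in> B \<Longrightarrow> c *\<^sub>C x \<in> B"
    using assms by (auto simp: star_subalgebra_def)
  then show "\<And>r x. x \<in> B \<Longrightarrow> r *\<^sub>R x \<in> B" by (simp add: scaleR_scaleC)
  show "x - y \<in> B" if "x \<in> B" "y \<in> B" for x y
    using *(2)[OF that(1) *(5)[OF that(2), of "-1"]] by simp
  show "\<And>f A. (\<And>i. i \<in> A \<Longrightarrow> f i \<in> B) \<Longrightarrow> sum f A \<in> B"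
    subgoal for f A by (induction A rule: infinite_finite_induct) (use * in auto)
    done
qed

text \<open>The crude bound by the sum of the norms of all entries shows that the supremum in
  \<open>corner_norm\<close> is taken over a bounded set.\<close>

lemma corner_norm_upper:
  assumes "\<forall>i<n. v i \<in> B" "column_norm n v \<le> 1"
  shows "column_norm n (\<lambda>i. \<Sum>j<n. X i j * v j) \<le> corner_norm B n X"
  unfolding corner_norm_def
proof (rule cSup_upper)
  show "bdd_above {column_norm n (\<lambda>i. \<Sum>j<n. X i j * v j) |v. (\<forall>i<n. v i \<in> B) \<and> column_norm n v \<le> 1}"
  proof (rule bdd_aboveI[where M="\<Sum>i<n. \<Sum>j<n. norm (X i j)"], clarify)
    fix v :: "nat \<Rightarrow> 'a" assume v: "column_norm n v \<le> 1"
    have "column_norm n (\<lambda>i. \<Sum>j<n. X i j * v j) \<le> (\<Sum>i<n. norm (\<Sum>j<n. X i j * v j))"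
      by (rule column_norm_le_sum)
    also have "\<dots> \<le> (\<Sum>i<n. \<Sum>j<n. norm (X i j))"
    proof (intro sum_mono order_trans[OF norm_sum])
      fix i j assume "j \<in> {..<n}"
      then have "norm (v j) \<le> 1" using norm_component_le_column_norm[of j n v] v by auto
      then have "norm (X i j) * norm (v j) \<le> norm (X i j) * 1" by (intro mult_left_mono) auto
      then show "norm (X i j * v j) \<le> norm (X i j)" using norm_mult_ineq order_trans by fastforce
    qed
    finally show "column_norm n (\<lambda>i. \<Sum>j<n. X i j * v j) \<le> (\<Sum>i<n. \<Sum>j<n. norm (X i j))" .
  qed
qed (use assms in blast)

lemma corner_norm_least:
  assumes "0 \<in> B"
    and "\<And>v. (\<And>i. i < n \<Longrightarrow> v i \<in> B) \<Longrightarrow> column_norm n v \<le> 1 \<Longrightarrow>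
      column_norm n (\<lambda>i. \<Sum>j<n. X i j * v j) \<le> M"
  shows "corner_norm B n X \<le> M"
  unfolding corner_norm_def
proof (rule cSup_least)
  have "column_norm n (\<lambda>i. 0 :: 'a) \<le> 1" by (simp add: column_norm_def)
  then show "{column_norm n (\<lambda>i. \<Sum>j<n. X i j * v j) |v. (\<forall>i<n. v i \<in> B) \<and> column_norm n v \<le> 1} \<noteq> {}"
    using assms(1) by (force intro: exI[of _ "\<lambda>i. 0 :: 'a"])
qed (use assms(2) in blast)

lemma corner_norm_nonneg:
  assumes "0 \<in> B" shows "0 \<le> corner_norm B n X"
proof -
  have "column_norm n (\<lambda>i. \<Sum>j<n. X i j * 0) \<le> corner_norm B n X"
    by (rule corner_norm_upper) (use assms in \<open>auto simp: column_norm_def\<close>)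
  with column_norm_nonneg order_trans show ?thesis by blast
qed

text \<open>The 1 by 1 corner is tested on the normalized adjoint of the entry, because
  \<open>B\<close> may lack a unit; the C*-identity then returns the full norm.\<close>

lemma norm_entry_le_matrix_norm:
  assumes B: "star_subalgebra B" and X: "X 0 0 \<in> B" and bdd: "bdd_above (range (\<lambda>n. corner_norm B n X))"
  shows "norm (X 0 0) \<le> matrix_norm B X"
proof (cases "X 0 0 = 0")
  case True
  have "corner_norm B 0 X \<le> matrix_norm B X"
    unfolding matrix_norm_def by (rule cSUP_upper[OF _ bdd]) simp
  with True corner_norm_nonneg[OF star_subalgebraD(1)[OF B]] show ?thesis
    by (metis norm_zero order_trans)
next
  case False
  let ?x = "X 0 0"
  let ?v = "\<lambda>i::nat. (1 / norm ?x) *\<^sub>R star ?x"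
  have c1: "column_norm (Suc 0) w = norm (w 0)" for w :: "nat \<Rightarrow> 'a"
    by (simp add: column_norm_def cstar_identity)
  have "column_norm 1 (\<lambda>i. \<Sum>j<1. X i j * ?v j) \<le> corner_norm B 1 X"
    by (rule corner_norm_upper) (use False X B in \<open>auto simp: c1 intro!: star_subalgebraD(4,6)\<close>)
  then have "norm ?x \<le> corner_norm B 1 X"
    using False by (simp add: c1 cstar_identity' power2_eq_square)
  also have "\<dots> \<le> matrix_norm B X"
    unfolding matrix_norm_def by (rule cSUP_upper[OF _ bdd]) simp
  finally show ?thesis .
qed

lemma corner_norm_corner:
  assumes "0 \<in> B" shows "corner_norm B n (corner z) \<le> norm z"
proof (rule corner_norm_least[OF assms])
  fix v :: "nat \<Rightarrow> 'a" assume v: "column_norm n v \<le> 1"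
  show "column_norm n (\<lambda>i. \<Sum>j<n. corner z i j * v j) \<le> norm z"
  proof (cases n)
    case (Suc m)
    have "(\<Sum>j<n. corner z i j * v j) = (if i = 0 then z * v 0 else 0)" for i
    proof -
      have "(\<Sum>j<n. corner z i j * v j) = (\<Sum>j<n. if j = 0 then if i = 0 then z * v 0 else 0 else 0)"
        by (intro sum.cong) (auto simp: corner_def)
      then show ?thesis using Suc by (simp del: sum.lessThan_Suc)
    qed
    then have "column_norm n (\<lambda>i. \<Sum>j<n. corner z i j * v j) = norm (z * v 0)"
      unfolding Suc by (simp add: column_norm_single del: sum.lessThan_Suc)
    also have "\<dots> \<le> norm z * 1"
      using norm_component_le_column_norm[of 0 n v] v Suc
      by (intro order_trans[OF norm_mult_ineq] mult_left_mono) auto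
    finally show ?thesis by simp
  qed (simp add: column_norm_def)
qed

lemma matrix_norm_corner:
  assumes "0 \<in> B" shows "0 \<le> matrix_norm B (corner z)" "matrix_norm B (corner z) \<le> norm z"
    "bdd_above (range (\<lambda>n. corner_norm B n (corner z)))"
proof -
  show bdd: "bdd_above (range (\<lambda>n. corner_norm B n (corner z)))"
    using corner_norm_corner[OF assms] by (auto intro!: bdd_aboveI2)
  have "corner_norm B 0 (corner z) \<le> matrix_norm B (corner z)"
    unfolding matrix_norm_def by (rule cSUP_upper[OF _ bdd]) simp
  then show "0 \<le> matrix_norm B (corner z)" using corner_norm_nonneg[OF assms] order_trans by blast
  show "matrix_norm B (corner z) \<le> norm z"
    unfolding matrix_norm_def by (rule cSUP_least) (simp_all add: corner_norm_corner[OF assms])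
qed

lemma matrix_mult_corner_star:
  "matrix_mult (matrix_mult W (corner b)) (matrix_star W) = (\<lambda>i j. W i 0 * b * star (W j 0))"
proof (intro ext)
  fix i j
  have 1: "matrix_mult W (corner b) i k = (if k = 0 then W i 0 * b else 0)" for k
    unfolding matrix_mult_def by (subst suminf_finite[of "{0}"]) (auto simp: corner_def)
  show "matrix_mult (matrix_mult W (corner b)) (matrix_star W) i j = W i 0 * b * star (W j 0)"
    unfolding matrix_mult_def[of "matrix_mult W (corner b)"] 1 matrix_star_def
    by (subst suminf_finite[of "{0}"]) auto
qed

text \<open>With a unit one would apply \<open>W\<close> to the first basis column. In its place
  stands \<open>x\<close> in the first coordinate, where \<open>x\<close> is the normalized inner
  square \<open>?S\<close> of the column itself, so that \<open>x * ?S * x\<close> is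
  \<open>norm ?S\<close> times the cube of \<open>x\<close>.\<close>

lemma first_column_bounded:
  assumes B: "star_subalgebra B" and W: "\<And>i j. W i j \<in> B" and C: "corner_norm B (Suc n) W \<le> C"
  shows "column_norm (Suc n) (\<lambda>i. W i 0) \<le> C"
proof -
  let ?N = "Suc n"
  let ?S = "\<Sum>i<?N. star (W i 0) * W i 0"
  have C0: "0 \<le> C" using C corner_norm_nonneg[OF star_subalgebraD(1)[OF B]] order_trans by blast
  show ?thesis
  proof (cases "?S = 0")
    case False
    define x where "x = (1 / norm ?S) *\<^sub>R ?S"
    have sS: "star ?S = ?S" by (simp add: star_sum star_mult star_star del: sum.lessThan_Suc)
    then have sx: "star x = x" by (simp only: x_def star_scaleR)
    have SB: "?S \<in> B" by (intro star_subalgebraD[OF B] W)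
    then have xB: "x \<in> B" unfolding x_def by (rule star_subalgebraD(6)[OF B])
    have nx: "norm x = 1" using False by (simp add: x_def del: sum.lessThan_Suc)
    let ?v = "\<lambda>i. if i = 0 then x else (0::'a)"
    have "column_norm ?N (\<lambda>i. \<Sum>j<?N. W i j * ?v j) \<le> corner_norm B ?N W"
      by (rule corner_norm_upper)
        (use xB star_subalgebraD(1)[OF B] in \<open>auto simp: column_norm_single nx\<close>)
    moreover have "(\<Sum>j<?N. W i j * ?v j) = W i 0 * x" for i
    proof -
      have "(\<Sum>j<?N. W i j * ?v j) = (\<Sum>j<?N. if j = 0 then W i 0 * x else 0)"
        by (intro sum.cong) auto
      then show ?thesis by (simp del: sum.lessThan_Suc)
    qed
    ultimately have le: "column_norm ?N (\<lambda>i. W i 0 * x) \<le> C" using C by simp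
    have "(\<Sum>i<?N. star (W i 0 * x) * (W i 0 * x)) = x * ?S * x"
      by (simp add: star_mult sx sum_distrib_left sum_distrib_right mult.assoc del: sum.lessThan_Suc)
    then have "norm (x * ?S * x) = (column_norm ?N (\<lambda>i. W i 0 * x))\<^sup>2"
      by (simp add: column_norm_square del: sum.lessThan_Suc)
    with le have 1: "norm (x * ?S * x) \<le> C\<^sup>2" by (simp add: power_mono column_norm_nonneg)
    \<comment> \<open>For self-adjoint \<open>x\<close> of norm 1 the fourth power has norm 1, which
      forces the cube to have norm at least 1.\<close>
    have "norm (x * x * x * x) = 1"
      using norm_selfadjoint_square[OF sx] norm_selfadjoint_square[of "x * x"] sx nx
      by (simp add: star_mult mult.assoc)
    then have "1 \<le> norm (x * x * x)" using norm_mult_ineq[of "x * x * x" x] nx by simp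
    moreover have "x * ?S * x = norm ?S *\<^sub>R (x * x * x)"
      using False by (simp add: x_def del: sum.lessThan_Suc)
    ultimately have "norm ?S * 1 \<le> norm (x * ?S * x)"
      unfolding \<open>x * ?S * x = norm ?S *\<^sub>R (x * x * x)\<close> norm_scaleR abs_norm_cancel
      by (intro mult_left_mono norm_ge_zero)
    with 1 have "(column_norm ?N (\<lambda>i. W i 0))\<^sup>2 \<le> C\<^sup>2" by (simp add: column_norm_square del: sum.lessThan_Suc)
    then show ?thesis using C0 power2_le_imp_le by blast
  qed (use C0 in \<open>simp add: column_norm_def del: sum.lessThan_Suc\<close>)
qed

text \<open>\<open>matrix_norm\<close> is a supremum and bounds the entries only for bounded
  matrices, so boundedness must precede the passage to the entry. The matrix acts on a column
  \<open>v\<close> by multiplying the first column of \<open>W\<close> with a single element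
  \<open>t\<close>, which Cauchy-Schwarz controls.\<close>

lemma corner_conjugate_bounded:
  assumes B: "star_subalgebra B" and W: "bounded_matrix B W"
  shows "bdd_above (range (\<lambda>n. corner_norm B n (matrix_diff (\<lambda>i j. W i 0 * b * star (W j 0)) (corner a))))"
proof -
  have WB: "W i j \<in> B" for i j using W by (simp add: bounded_matrix_def)
  obtain C where C: "\<And>n. corner_norm B n W \<le> C"
    using W unfolding bounded_matrix_def bdd_above_def by blast
  have C0: "0 \<le> C" using C[of 0] corner_norm_nonneg[OF star_subalgebraD(1)[OF B]] order_trans by blast
  have "corner_norm B n (matrix_diff (\<lambda>i j. W i 0 * b * star (W j 0)) (corner a)) \<le> C * (norm b * C) + norm a"
    for n
  proof (rule corner_norm_least[OF star_subalgebraD(1)[OF B]])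
    fix v :: "nat \<Rightarrow> 'a" assume vB: "\<And>i. i < n \<Longrightarrow> v i \<in> B" and v: "column_norm n v \<le> 1"
    have Wn: "column_norm n (\<lambda>i. W i 0) \<le> C"
    proof (cases n)
      case (Suc m)
      then show ?thesis using first_column_bounded[OF B WB C] by simp
    qed (use C0 in \<open>simp add: column_norm_def\<close>)
    define t where "t = b * (\<Sum>j<n. star (W j 0) * v j)"
    have "norm t \<le> norm b * C"
    proof -
      have "norm (\<Sum>j<n. star (W j 0) * v j) \<le> C * 1"
        by (rule order_trans[OF norm_sum_star_mult_le]) (intro mult_mono Wn v C0 column_norm_nonneg)
      then show ?thesis
        unfolding t_def by (intro order_trans[OF norm_mult_ineq] mult_left_mono) auto
    qed
    then have 1: "column_norm n (\<lambda>i. W i 0 * t) \<le> C * (norm b * C)"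
      using C0 by (intro order_trans[OF column_norm_mult_right] mult_mono Wn) auto
    have 2: "column_norm n (\<lambda>i. - (\<Sum>j<n. corner a i j * v j)) \<le> norm a"
      unfolding column_norm_uminus
      by (rule order_trans[OF corner_norm_upper corner_norm_corner])
        (use vB v star_subalgebraD(1)[OF B] in auto)
    have "(\<Sum>j<n. matrix_diff (\<lambda>i j. W i 0 * b * star (W j 0)) (corner a) i j * v j)
        = W i 0 * t + - (\<Sum>j<n. corner a i j * v j)" for i
      by (simp add: matrix_diff_def left_diff_distrib sum_subtractf t_def sum_distrib_left mult.assoc)
    then show "column_norm n (\<lambda>i. \<Sum>j<n. matrix_diff (\<lambda>i j. W i 0 * b * star (W j 0)) (corner a) i j * v j)
        \<le> C * (norm b * C) + norm a"
      using column_norm_triangle[of n "\<lambda>i. W i 0 * t" "\<lambda>i. - (\<Sum>j<n. corner a i j * v j)"] 1 2 by simp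
  qed
  then show ?thesis by (auto intro!: bdd_aboveI2)
qed

text \<open>Conjugating a corner involves only the first column of \<open>W\<close>, and the upper
  left entry of the result involves only \<open>W 0 0\<close>; these entries form the required
  sequence. Conversely, corners of elements of \<open>B\<close> are admissible conjugators.\<close>

proposition cuntz_le_corner_iff:
  assumes B: "star_subalgebra B" and a: "a \<in> B" and b: "b \<in> B"
  shows "cuntz_le B (corner a) (corner b) \<longleftrightarrow>
    (\<exists>w. (\<forall>n. w n \<in> B) \<and> (\<lambda>n. w n * b * star (w n)) \<longlonglongrightarrow> a)"
proof
  assume "cuntz_le B (corner a) (corner b)"
  then obtain W where W: "\<And>n. W n \<in> stabilization B" and lim: "(\<lambda>n. matrix_norm B
       (matrix_diff (\<lambda>i j. W n i 0 * b * star (W n j 0)) (corner a))) \<longlonglongrightarrow> 0"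
    unfolding cuntz_le_def matrix_mult_corner_star by blast
  have bW: "bounded_matrix B (W n)" for n using W by (simp add: stabilization_def)
  then have WB: "W n i j \<in> B" for n i j by (simp add: bounded_matrix_def)
  have le: "norm (W n 0 0 * b * star (W n 0 0) - a)
      \<le> matrix_norm B (matrix_diff (\<lambda>i j. W n i 0 * b * star (W n j 0)) (corner a))" for n
  proof -
    let ?D = "matrix_diff (\<lambda>i j. W n i 0 * b * star (W n j 0)) (corner a)"
    have D: "?D 0 0 = W n 0 0 * b * star (W n 0 0) - a" by (simp add: matrix_diff_def corner_def)
    have "?D 0 0 \<in> B" unfolding D by (intro star_subalgebraD[OF B] WB a b)
    from norm_entry_le_matrix_norm[OF B this corner_conjugate_bounded[OF B bW]] show ?thesis
      by (simp add: D)
  qed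
  have "(\<lambda>n. W n 0 0 * b * star (W n 0 0) - a) \<longlonglongrightarrow> 0"
    by (rule Lim_null_comparison[OF _ lim]) (use le in auto)
  then have "(\<lambda>n. W n 0 0 * b * star (W n 0 0)) \<longlonglongrightarrow> a" by (simp add: LIM_zero_iff)
  with WB show "\<exists>w. (\<forall>n. w n \<in> B) \<and> (\<lambda>n. w n * b * star (w n)) \<longlonglongrightarrow> a"
    by (intro exI[of _ "\<lambda>n. W n 0 0"]) simp
next
  assume "\<exists>w. (\<forall>n. w n \<in> B) \<and> (\<lambda>n. w n * b * star (w n)) \<longlonglongrightarrow> a"
  then obtain w where w: "\<And>n. w n \<in> B" "(\<lambda>n. w n * b * star (w n)) \<longlonglongrightarrow> a" by blast
  have 0: "0 \<in> B" by (rule star_subalgebraD[OF B])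
  have "corner (w n) \<in> stabilization B" for n
  proof -
    have 1: "corner (w n) i j \<in> B" for i j by (simp add: corner_def w 0)
    have "corner (w n) \<in> finite_matrices B"
      unfolding finite_matrices_def using 1 by (auto simp: corner_def intro!: exI[of _ 1])
    moreover have "matrix_norm B (matrix_diff (corner (w n)) (corner (w n))) = 0"
    proof -
      have "matrix_diff (corner (w n)) (corner (w n)) = corner 0"
        by (simp add: matrix_diff_def corner_def fun_eq_iff)
      then show ?thesis using matrix_norm_corner(1,2)[OF 0, of 0] by simp
    qed
    ultimately show ?thesis
      unfolding stabilization_def bounded_matrix_def using 1 matrix_norm_corner(3)[OF 0]
      by (auto intro!: exI[of _ "\<lambda>_. corner (w n)"])
  qed
  moreover have "(\<lambda>n. matrix_norm B (matrix_diff
      (matrix_mult (matrix_mult (corner (w n)) (corner b)) (matrix_star (corner (w n)))) (corner a))) \<longlonglongrightarrow> 0"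
  proof (rule Lim_null_comparison)
    have "matrix_diff (\<lambda>i j. corner (w n) i 0 * b * star (corner (w n) j 0)) (corner a)
        = corner (w n * b * star (w n) - a)" for n
      by (auto simp: matrix_diff_def corner_def fun_eq_iff)
    then show "\<forall>\<^sub>F n in sequentially. norm (matrix_norm B (matrix_diff
        (matrix_mult (matrix_mult (corner (w n)) (corner b)) (matrix_star (corner (w n)))) (corner a)))
      \<le> norm (w n * b * star (w n) - a)"
      unfolding matrix_mult_corner_star using matrix_norm_corner(1,2)[OF 0] by simp
    show "(\<lambda>n. norm (w n * b * star (w n) - a)) \<longlonglongrightarrow> 0"
      using w(2) by (simp add: tendsto_norm_zero LIM_zero)
  qed
  ultimately show "cuntz_le B (corner a) (corner b)"
    unfolding cuntz_le_def by (intro exI[of _ "\<lambda>n. corner (w n)"]) blast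
qed

section \<open>Finite group actions\<close>

lemma star_automorphismD:
  assumes "star_automorphism \<phi>"
  shows "\<phi> (x + y) = \<phi> x + \<phi> y" "\<phi> (c *\<^sub>C x) = c *\<^sub>C \<phi> x" "\<phi> (x * y) = \<phi> x * \<phi> y"
    "\<phi> (star x) = star (\<phi> x)" "\<phi> 0 = 0" "\<phi> (r *\<^sub>R x) = r *\<^sub>R \<phi> x" "\<phi> (x - y) = \<phi> x - \<phi> y"
    "\<phi> (sum h A) = (\<Sum>i\<in>A. \<phi> (h i))"
proof -
  show *: "\<phi> (x + y) = \<phi> x + \<phi> y" "\<phi> (c *\<^sub>C x) = c *\<^sub>C \<phi> x" "\<phi> (x * y) = \<phi> x * \<phi> y"
    "\<phi> (star x) = star (\<phi> x)" for x y c
    using assms by (auto simp: star_automorphism_def)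
  show 0: "\<phi> 0 = 0" using *(2)[of 0 0] by simp
  show "\<phi> (r *\<^sub>R x) = r *\<^sub>R \<phi> x" by (simp add: scaleR_scaleC *)
  show "\<phi> (x - y) = \<phi> x - \<phi> y" using *(1)[of x "(-1) *\<^sub>C y"] by (simp only: *(2)) simp
  show "\<phi> (sum h A) = (\<Sum>i\<in>A. \<phi> (h i))"
    by (induction A rule: infinite_finite_induct) (simp_all add: 0 *)
qed

text \<open>An automorphism preserves the spectrum of a self-adjoint element, hence its norm.\<close>

lemma star_automorphism_norm:
  assumes "star_automorphism \<phi>"
  shows "norm (\<phi> x) = norm x"
proof -
  have le: "norm (\<psi> h) \<le> norm h" if \<psi>: "star_automorphism \<psi>" and h: "star h = h" for \<psi> and h :: 'a
  proof -
    note [simp] = star_automorphismD[OF \<psi>]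
    \<comment> \<open>The automorphism extends to the unitization, fixing the unit, and thus
      preserves invertibility of \<open>r - h\<close>.\<close>
    define E where "E u = Uz (uz_scalar u) (\<psi> (uz_part u))" for u
    have E: "E (u * v) = E u * E v" "E 1 = 1" for u v
      by (simp_all add: E_def uz_eq_iff)
    have "star (Uz 0 (\<psi> h)) = Uz 0 (\<psi> h)"
      using h by (metis Uz_simps(7) star_automorphismD(4)[OF \<psi>])
    then obtain r where r: "\<bar>r\<bar> = norm (Uz 0 (\<psi> h))" "complex_of_real r \<in> unital_spectrum (Uz 0 (\<psi> h))"
      using norm_in_unital_spectrum by blast
    have "complex_of_real r \<in> unital_spectrum (Uz 0 h)"
    proof (rule ccontr)
      assume "complex_of_real r \<notin> unital_spectrum (Uz 0 h)"
      then obtain z where z: "(complex_of_real r *\<^sub>C 1 - Uz 0 h) * z = 1" "z * (complex_of_real r *\<^sub>C 1 - Uz 0 h) = 1"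
        by (auto simp: unital_spectrum_def invertible_elt_def)
      have "E (complex_of_real r *\<^sub>C 1 - Uz 0 h) = complex_of_real r *\<^sub>C 1 - Uz 0 (\<psi> h)"
        by (simp add: E_def uz_eq_iff star_automorphismD(7)[OF \<psi>, of 0, simplified])
      with z E have "invertible_elt (complex_of_real r *\<^sub>C 1 - Uz 0 (\<psi> h))"
        unfolding invertible_elt_def by metis
      with r(2) show False by (simp add: unital_spectrum_def)
    qed
    from unital_spectrum_norm[OF this] r(1) show ?thesis by simp
  qed
  have sa: "star (star x * x) = star x * x" by (simp add: star_mult star_star)
  have "norm (\<phi> (star x * x)) = norm (star x * x)"
  proof (rule antisym)
    have "inv_into UNIV \<phi> (\<phi> (star x * x)) = star x * x"
      using assms by (intro inv_f_f) (simp add: star_automorphism_def bij_is_inj)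
    then show "norm (star x * x) \<le> norm (\<phi> (star x * x))"
      using le[OF star_automorphism_inv[OF assms], of "\<phi> (star x * x)"] sa
      by (metis star_automorphismD(4)[OF assms])
  qed (rule le[OF assms sa])
  then have "(norm (\<phi> x))\<^sup>2 = (norm x)\<^sup>2"
    by (simp add: star_automorphismD[OF assms] cstar_identity)
  then show ?thesis by (rule power2_eq_imp_eq) simp_all
qed

locale cstar_action = group G for G :: "('g, 'm) monoid_scheme" (structure) +
  fixes \<alpha> :: "'g \<Rightarrow> 'a::cstar_algebra \<Rightarrow> 'a"
  assumes finite_carrier: "finite (carrier G)"
    and hom: "\<alpha> \<in> hom G Aut"
begin

lemma automorphism: "g \<in> carrier G \<Longrightarrow> star_automorphism (\<alpha> g)"
  using hom by (auto simp: hom_def Aut_def)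

lemmas act_simps = star_automorphismD[OF automorphism]
lemmas norm_act = star_automorphism_norm[OF automorphism]

lemma act_act: "g \<in> carrier G \<Longrightarrow> h \<in> carrier G \<Longrightarrow> \<alpha> g (\<alpha> h x) = \<alpha> (g \<otimes> h) x"
  using hom by (simp add: hom_def Aut_def)

abbreviation fixed where "fixed \<equiv> fixed_algebra G \<alpha>"

lemma fixedD: "x \<in> fixed \<Longrightarrow> g \<in> carrier G \<Longrightarrow> \<alpha> g x = x"
  by (simp add: fixed_algebra_def)

lemma star_subalgebra_fixed: "star_subalgebra fixed"
  by (auto simp: star_subalgebra_def fixed_algebra_def act_simps)

lemmas fixed_intros = star_subalgebraD[OF star_subalgebra_fixed]

lemma closed_fixed: "closed fixed"
proof -
  have "closed {x. \<alpha> g x = x}" if g: "g \<in> carrier G" for g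
  proof -
    have "bounded_linear (\<alpha> g)"
      by (rule bounded_linear_intro[where K=1]) (simp_all add: act_simps[OF g] norm_act[OF g])
    then have "continuous_on UNIV (\<alpha> g)"
      by (simp add: linear_continuous_on)
    then show ?thesis
      by (intro closed_Collect_eq) (auto intro: continuous_on_id)
  qed
  then have "closed (\<Inter>g\<in>carrier G. {x. \<alpha> g x = x})" by auto
  then show ?thesis by (simp add: fixed_algebra_def Collect_ball_eq)
qed

lemma fun_calc_fixed:
  "star b = b \<Longrightarrow> b \<in> fixed \<Longrightarrow> admissible f \<Longrightarrow> fun_calc UNIV f b \<in> fixed"
  by (rule fun_calc_mem) (auto intro: closed_fixed fixed_intros)

lemma average_fixed: "(\<Sum>g\<in>carrier G. \<alpha> g x) \<in> fixed"
  unfolding fixed_algebra_def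
proof (intro CollectI ballI)
  fix h assume h: "h \<in> carrier G"
  have b: "bij_betw (\<lambda>g. h \<otimes> g) (carrier G) (carrier G)"
    by (rule bij_betw_byWitness[where f'="\<lambda>g. inv h \<otimes> g"]) (auto simp: h m_assoc[symmetric])
  have "\<alpha> h (\<Sum>g\<in>carrier G. \<alpha> g x) = (\<Sum>g\<in>carrier G. \<alpha> (h \<otimes> g) x)"
    by (simp add: act_simps[OF h] act_act[OF h])
  also have "\<dots> = (\<Sum>g\<in>carrier G. \<alpha> g x)"
    by (rule sum.reindex_bij_betw[OF b])
  finally show "\<alpha> h (\<Sum>g\<in>carrier G. \<alpha> g x) = (\<Sum>g\<in>carrier G. \<alpha> g x)" .
qed

definition N :: real where "N = real (card (carrier G))"

lemma N_ge_1: "1 \<le> N"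
proof -
  have "carrier G \<noteq> {}" using one_closed by blast
  then have "card (carrier G) \<noteq> 0" using finite_carrier by simp
  then show ?thesis unfolding N_def by simp
qed

lemma norm_sum_carrier_le:
  "(\<And>g. g \<in> carrier G \<Longrightarrow> norm (F g) \<le> K) \<Longrightarrow> norm (\<Sum>g\<in>carrier G. F g) \<le> N * K"
  unfolding N_def by (rule sum_norm_bound)

end

section \<open>Rokhlin elements\<close>

lemma orthogonal_sum_square:
  fixes f :: "'g \<Rightarrow> 'a::cstar_algebra"
  assumes "finite A" "\<And>g h. g \<in> A \<Longrightarrow> h \<in> A \<Longrightarrow> g \<noteq> h \<Longrightarrow> f g * f h = 0"
  shows "sum f A * sum f A = (\<Sum>g\<in>A. f g * f g)"
proof -
  have "sum f A * sum f A = (\<Sum>g\<in>A. \<Sum>h\<in>A. f g * f h)" by (rule sum_product)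
  also have "\<dots> = (\<Sum>g\<in>A. \<Sum>h\<in>A. if h = g then f g * f g else 0)"
    using assms(2) by (intro sum.cong refl) (simp split: if_split)
  also have "\<dots> = (\<Sum>g\<in>A. f g * f g)" using assms(1) by simp
  finally show ?thesis .
qed

text \<open>Squaring the sum gives the sum of the squares, again an orthogonal family of
  self-adjoint contractions. Iterating, all powers of the norm with exponent \<open>2^k\<close> are
  bounded by the cardinality of \<open>A\<close>, which is impossible for a norm above 1.\<close>

lemma norm_orthogonal_sum:
  fixes f :: "'g \<Rightarrow> 'a::cstar_algebra"
  assumes fin: "finite A" and f: "\<And>g. g \<in> A \<Longrightarrow> star (f g) = f g \<and> norm (f g) \<le> 1"
    and orth: "\<And>g h. g \<in> A \<Longrightarrow> h \<in> A \<Longrightarrow> g \<noteq> h \<Longrightarrow> f g * f h = 0"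
  shows "norm (sum f A) \<le> 1"
proof (rule ccontr)
  assume gt: "\<not> norm (sum f A) \<le> 1"
  have pow: "norm (sum f A) ^ 2 ^ k \<le> real (card A)" for k
    using f orth
  proof (induction k arbitrary: f)
    case 0
    then show ?case using sum_norm_bound[of A f 1] by simp
  next
    case (Suc k)
    let ?s = "sum f A" and ?f = "\<lambda>g. f g * f g"
    have "star ?s = ?s" unfolding star_sum by (rule sum.cong[OF refl]) (simp only: Suc.prems(1))
    moreover have "?s * ?s = sum ?f A"
      by (rule orthogonal_sum_square[OF fin]) (rule Suc.prems(2))
    ultimately have "(norm ?s)\<^sup>2 = norm (sum ?f A)"
      using norm_selfadjoint_square[of ?s] by (simp only:)
    moreover have "norm (sum ?f A) ^ 2 ^ k \<le> real (card A)"
    proof (rule Suc.IH)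
      fix g assume g: "g \<in> A"
      have "norm (f g) * norm (f g) \<le> 1 * 1" using Suc.prems(1)[OF g] by (intro mult_mono) auto
      then show "star (?f g) = ?f g \<and> norm (?f g) \<le> 1"
        using Suc.prems(1)[OF g] norm_mult_ineq[of "f g" "f g"] by (simp add: star_mult)
    next
      fix g h assume "g \<in> A" "h \<in> A" "g \<noteq> h"
      then have "f g * (f g * f h) * f h = 0" using Suc.prems(2) by simp
      then show "?f g * ?f h = 0" by (simp add: mult.assoc)
    qed
    ultimately show ?case by (simp add: power_mult)
  qed
  obtain n where n: "real (card A) < norm (sum f A) ^ n"
    using gt real_arch_pow by (metis not_le)
  have "norm (sum f A) ^ n \<le> norm (sum f A) ^ 2 ^ n"
    using gt by (intro power_increasing) (auto intro: less_imp_le)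
  with pow[of n] n show False by simp
qed

lemma norm_cut_down:
  assumes "positive_elt UNIV r" "0 \<le> \<epsilon>"
  shows "norm (cut_down UNIV r \<epsilon> - r) \<le> \<epsilon>"
proof -
  have sr: "star r = r" using assms(1) by (simp add: positive_elt_def)
  let ?f = "\<lambda>t. max 0 (t - \<epsilon>)"
  have f: "admissible ?f" using assms(2) by (auto simp: admissible_def intro!: continuous_intros)
  have g: "admissible (\<lambda>t. ?f t - t)" using assms(2) by (auto simp: admissible_def intro!: continuous_intros)
  have "norm (fun_calc UNIV (\<lambda>t. ?f t - t) r) \<le> \<epsilon>"
  proof (rule norm_fun_calc_le[OF sr g assms(2)])
    fix t assume "t \<in> real_spectrum r"
    then have "0 \<le> t" using positive_real_spectrum[OF assms(1)] by blast
    then show "\<bar>?f t - t\<bar> \<le> \<epsilon>" using assms(2) by auto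
  qed
  then show ?thesis
    by (simp add: cut_down_def fun_calc_diff[OF sr f admissible_id] fun_calc_id[OF sr])
qed

lemma star_subalgebra_UNIV: "star_subalgebra UNIV"
  by (simp add: star_subalgebra_def)

text \<open>The form in which the property is applied. Condition (3) becomes an actual element
  \<open>v\<close>: the cut-down costs one \<epsilon>, a term of the approximating sequence
  another.\<close>

lemma (in cstar_action) Rokhlin_elements:
  assumes R: "weak_tracial_Rokhlin G \<alpha>" and e: "0 < \<epsilon>" and F: "finite F"
    and x: "positive_elt UNIV x" "norm x = 1" and y: "positive_elt UNIV y"
  obtains f v where
    "\<And>g. g \<in> carrier G \<Longrightarrow> star (f g) = f g" "\<And>g. g \<in> carrier G \<Longrightarrow> norm (f g) \<le> 1"
    "\<And>g h. g \<in> carrier G \<Longrightarrow> h \<in> carrier G \<Longrightarrow> g \<noteq> h \<Longrightarrow> f g * f h = 0"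
    "\<And>g a. g \<in> carrier G \<Longrightarrow> a \<in> F \<Longrightarrow> norm (a * f g - f g * a) \<le> \<epsilon>"
    "\<And>g. g \<in> carrier G \<Longrightarrow> norm (\<alpha> g (f \<one>) - f g) \<le> \<epsilon>"
    "psd (Uz 0 (sum f (carrier G)))" "norm (sum f (carrier G)) \<le> 1"
    "norm (y * y - y * sum f (carrier G) * y - v * x * star v) \<le> 2 * \<epsilon>"
    "1 - \<epsilon> < norm (sum f (carrier G) * x * sum f (carrier G))"
proof -
  note R' = R[unfolded weak_tracial_Rokhlin_def Let_def, THEN spec[of _ \<epsilon>], THEN mp, OF e,
      THEN spec[of _ F], THEN spec[of _ x], THEN spec[of _ y], THEN mp]
  have "finite F \<and> positive_elt UNIV x \<and> positive_elt UNIV y \<and> norm x = 1"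
    using F x y by simp
  from R'[OF this] show ?thesis
  proof (elim exE conjE, goal_cases)
    case (1 f)
    note f = 1(1)[rule_format] and orth = 1(2)[rule_format] and comm = 1(3)[rule_format]
      and eqv = 1(4)[rule_format] and cz = 1(5) and big = 1(6)
    let ?s = "sum f (carrier G)"
    have sf: "star (f g) = f g" if "g \<in> carrier G" for g
      using f[OF that] by (simp add: positive_elt_def)
    have ns: "norm ?s \<le> 1"
      by (rule norm_orthogonal_sum[OF finite_carrier]) (auto intro: f[THEN conjunct2] orth sf)
    have ps: "psd (Uz 0 ?s)"
      unfolding Uz_sum by (rule psd_sum) (use f positive_elt_psd in blast)
    \<comment> \<open>A positive contraction lies below 1, so \<open>y * y - y * ?s * y\<close> is
      positive, as the estimate for its cut-down requires.\<close>
    have "psd ((norm (Uz 0 ?s) *\<^sub>R 1 - Uz 0 ?s) + (1 - norm ?s) *\<^sub>R 1)"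
      using ns by (intro psd_add psd_norm_minus psd_of_real psd_selfadjoint[OF ps]) auto
    then have "psd (1 - Uz 0 ?s)" by (simp add: algebra_simps)
    then have "psd (star (Uz 0 y) * (1 - Uz 0 ?s) * Uz 0 y)" by (rule psd_conjugate)
    moreover have "star (Uz 0 y) * (1 - Uz 0 ?s) * Uz 0 y = Uz 0 (y * y - y * ?s * y)"
      using psd_selfadjoint[OF positive_elt_psd[OF y]]
      by (simp add: Uz_simps left_diff_distrib right_diff_distrib)
    ultimately have r: "positive_elt UNIV (y * y - y * ?s * y)" by (simp add: positive_elt_iff_psd)
    obtain w where w: "(\<lambda>n. w n * x * star (w n)) \<longlonglongrightarrow> cut_down UNIV (y * y - y * ?s * y) \<epsilon>"
      using cz cuntz_le_corner_iff[OF star_subalgebra_UNIV UNIV_I UNIV_I] by blast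
    then obtain n where n: "norm (w n * x * star (w n) - cut_down UNIV (y * y - y * ?s * y) \<epsilon>) < \<epsilon>"
      using e unfolding LIMSEQ_iff by blast
    have v: "norm (y * y - y * ?s * y - w n * x * star (w n)) \<le> 2 * \<epsilon>"
      using norm_diff_triangle_le[of "y * y - y * ?s * y" "cut_down UNIV (y * y - y * ?s * y) \<epsilon>" \<epsilon>
          "w n * x * star (w n)" \<epsilon>] norm_cut_down[OF r less_imp_le[OF e]] n
      by (simp only: norm_minus_commute mult_2 less_imp_le)
    have eqv': "norm (\<alpha> g (f \<one>) - f g) \<le> \<epsilon>" if "g \<in> carrier G" for g
      using eqv[OF that one_closed] r_one[OF that] by simp
    show ?case
      by (rule that[of f "w n"])
        (fact sf | fact ps | fact ns | fact v | fact big | erule eqv'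
          | rule f[THEN conjunct2], assumption | rule orth, assumption+
          | rule comm[THEN less_imp_le], assumption+)+
  qed
qed

section \<open>Averaging a Cuntz comparison\<close>

lemma norm_mult_bound:
  fixes x y :: "'a::real_normed_algebra"
  shows "norm x \<le> A \<Longrightarrow> norm y \<le> B \<Longrightarrow> norm (x * y) \<le> A * B"
  by (meson mult_mono norm_ge_zero norm_mult_ineq order_trans)

lemma sqrt_one_plus_approx:
  fixes \<eta> :: real assumes "0 < \<eta>"
  shows "\<exists>\<sigma>. \<forall>t\<in>{0..1}. \<bar>poly \<sigma> t * poly \<sigma> t - (1 + t)\<bar> \<le> \<eta>"
proof -
  \<comment> \<open>In the difference of squares the second factor is at most 5: the root is bounded
    by 2, and the approximation exceeds it by at most 1.\<close>
  define \<eta>' where "\<eta>' = min 1 (\<eta> / 5)"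
  have \<eta>': "0 < \<eta>'" "\<eta>' \<le> 1" "5 * \<eta>' \<le> \<eta>" using assms by (auto simp: \<eta>'_def)
  have "continuous_on {0..1} (\<lambda>t::real. sqrt (1 + t))" by (intro continuous_intros)
  from Stone_Weierstrass_real_polynomial_function[OF _ this \<eta>'(1)]
  obtain g where g: "real_polynomial_function g" "\<And>t. t \<in> {0..1} \<Longrightarrow> \<bar>sqrt (1 + t) - g t\<bar> < \<eta>'"
    by auto
  then obtain c n where "g = (\<lambda>t. \<Sum>i\<le>n. c i * t ^ i)"
    by (auto simp: real_polynomial_function_iff_sum)
  then have \<sigma>: "g = poly (\<Sum>i\<le>n. monom (c i) i)" by (auto simp: poly_sum poly_monom)
  have "\<bar>g t * g t - (1 + t)\<bar> \<le> \<eta>" if t: "t \<in> {0..1}" for t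
  proof -
    let ?r = "sqrt (1 + t)"
    have r: "?r * ?r = 1 + t" "0 \<le> ?r" "?r \<le> 2"
      using t real_sqrt_le_mono[of "1 + t" 4] by auto
    then have "g t * g t - (1 + t) = (g t - ?r) * (g t + ?r)" by (simp add: algebra_simps)
    then have "\<bar>g t * g t - (1 + t)\<bar> = \<bar>g t - ?r\<bar> * \<bar>g t + ?r\<bar>" by (simp add: abs_mult)
    also have "\<dots> \<le> \<eta>' * 5"
    proof (rule mult_mono)
      show "\<bar>g t - ?r\<bar> \<le> \<eta>'" using g(2)[OF t] by linarith
      show "\<bar>g t + ?r\<bar> \<le> 5" using g(2)[OF t] r \<eta>'(2) by linarith
    qed (use \<eta>' in auto)
    finally show ?thesis using \<eta>'(3) by linarith
  qed
  then show ?thesis unfolding \<sigma> by blast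
qed

text \<open>Induction along the Horner scheme with the product rule for commutators. The point is
  that \<open>C\<close> depends on the polynomial alone, since later \<open>s\<close> is chosen
  after \<open>C\<close>.\<close>

lemma rpeval_commutator_bound:
  "\<exists>C\<ge>0. \<forall>s Y :: 'a::unital_cstar_algebra. norm s \<le> 1 \<longrightarrow>
    norm (rpeval \<sigma> s) \<le> C \<and> norm (rpeval \<sigma> s * Y - Y * rpeval \<sigma> s) \<le> C * norm (s * Y - Y * s)"
proof (induction \<sigma>)
  case 0
  then show ?case by (intro exI[of _ 0]) simp
next
  case (pCons c q)
  then obtain C where C: "0 \<le> C" and IH: "\<And>s Y :: 'a. norm s \<le> 1 \<Longrightarrow>
    norm (rpeval q s) \<le> C \<and> norm (rpeval q s * Y - Y * rpeval q s) \<le> C * norm (s * Y - Y * s)"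
    by blast
  show ?case
  proof (intro exI[of _ "\<bar>c\<bar> + 2 * C"] conjI allI impI)
    fix s Y :: 'a assume s: "norm s \<le> 1"
    let ?q = "rpeval q s"
    have "norm (s * ?q) \<le> 1 * C" using IH[OF s] s by (intro norm_mult_bound) auto
    then show "norm (rpeval (pCons c q) s) \<le> \<bar>c\<bar> + 2 * C"
      using norm_triangle_ineq[of "c *\<^sub>R 1" "s * ?q"] C by simp
    have "rpeval (pCons c q) s * Y - Y * rpeval (pCons c q) s
        = s * (?q * Y - Y * ?q) + (s * Y - Y * s) * ?q"
      by (simp add: algebra_simps)
    also have "norm \<dots> \<le> 1 * (C * norm (s * Y - Y * s)) + norm (s * Y - Y * s) * C"
      using IH[OF s] s by (intro norm_triangle_mono norm_mult_bound) auto
    also have "\<dots> \<le> (\<bar>c\<bar> + 2 * C) * norm (s * Y - Y * s)" by (simp add: algebra_simps)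
    finally show "norm (rpeval (pCons c q) s * Y - Y * rpeval (pCons c q) s)
      \<le> (\<bar>c\<bar> + 2 * C) * norm (s * Y - Y * s)" .
  qed (use C in simp)
qed

text \<open>\<open>y (1 - s\<^sup>2) y \<approx> \<kappa> y (1 - s) y \<kappa>\<close>, where \<open>\<kappa>\<close> is a polynomial in \<open>s\<close> close to \<open>(1 + s)\<^bsup>1/2\<^esup>\<close>.\<close>

lemma defect_of_square:
  fixes \<eta> :: real
  assumes \<eta>: "0 < \<eta>" "\<eta> \<le> 2"
  shows "\<exists>C\<ge>0. \<forall>s y v x :: 'a::cstar_algebra. psd (Uz 0 s) \<longrightarrow> norm s \<le> 1 \<longrightarrow>
    (\<exists>v'. norm (y * y - y * s * s * y - v' * x * star v')
      \<le> 2 * \<eta> * (norm y)\<^sup>2 + C * norm (s * y - y * s) * norm y + 4 * norm (y * y - y * s * y - v * x * star v))"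
proof -
  obtain \<sigma> where \<sigma>: "\<And>t. t \<in> {0..1} \<Longrightarrow> \<bar>poly \<sigma> t * poly \<sigma> t - (1 + t)\<bar> \<le> \<eta>"
    using sqrt_one_plus_approx[OF \<eta>(1)] by blast
  obtain C where C: "0 \<le> C" and CC: "\<And>s Y :: 'a uz. norm s \<le> 1 \<Longrightarrow>
      norm (rpeval \<sigma> s * Y - Y * rpeval \<sigma> s) \<le> C * norm (s * Y - Y * s)"
    using rpeval_commutator_bound[of \<sigma>] by blast
  show ?thesis
  proof (intro exI[of _ "8 * C"] conjI allI impI)
    fix s y v x :: 'a assume ps: "psd (Uz 0 s)" and ns: "norm s \<le> 1"
    define S Y V X where "S = Uz 0 s" and "Y = Uz 0 y" and "V = Uz 0 v" and "X = Uz 0 x"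
    note defs = S_def Y_def V_def X_def
    define \<kappa> where "\<kappa> = rpeval \<sigma> S"
    have sS: "star S = S" using psd_selfadjoint[OF ps] by (simp add: S_def)
    have nS: "norm S \<le> 1" using ns by (simp add: S_def)
    have s\<kappa>: "star \<kappa> = \<kappa>" unfolding \<kappa>_def by (rule rpeval_selfadjoint[OF sS])
    have S\<kappa>: "S * \<kappa> = \<kappa> * S" unfolding \<kappa>_def by (rule rpeval_commute)
    have \<kappa>2: "norm (1 + S - \<kappa> * \<kappa>) \<le> \<eta>"
    proof -
      have "norm (rpeval (\<sigma> * \<sigma> - [:1, 1:]) S) \<le> \<eta>"
      proof (rule norm_rpeval_le[OF sS])
        fix t assume t: "complex_of_real t \<in> unital_spectrum S"
        have "0 \<le> t" using unital_spectrum_psd[OF ps] t by (auto simp: S_def)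
        moreover have "t \<le> 1" using unital_spectrum_norm[OF t] nS by simp
        ultimately show "\<bar>poly (\<sigma> * \<sigma> - [:1, 1:]) t\<bar> \<le> \<eta>" using \<sigma>[of t] by simp
      qed
      moreover have "rpeval (\<sigma> * \<sigma> - [:1, 1:]) S = - (1 + S - \<kappa> * \<kappa>)"
        unfolding rpeval_diff rpeval_mult by (simp add: \<kappa>_def)
      ultimately show ?thesis by (metis norm_minus_cancel)
    qed
    \<comment> \<open>Here \<eta> \<le> 2 enters: \<open>1 + S\<close> has norm at most 2, so the
      square of \<kappa> has norm at most 4.\<close>
    have "norm (\<kappa> * \<kappa>) \<le> norm (1 + S) + norm (1 + S - \<kappa> * \<kappa>)"
      using norm_triangle_ineq4[of "1 + S" "1 + S - \<kappa> * \<kappa>"] by simp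
    also have "\<dots> \<le> 2\<^sup>2" using norm_triangle_ineq[of 1 S] \<kappa>2 nS \<eta>(2) by simp
    finally have "(norm \<kappa>)\<^sup>2 \<le> 2\<^sup>2" using norm_selfadjoint_square[OF s\<kappa>] by simp
    then have n\<kappa>: "norm \<kappa> \<le> 2" by (rule power2_le_imp_le) simp
    have n1S: "norm (1 - S) \<le> 2" using norm_triangle_ineq4[of 1 S] nS by simp
    \<comment> \<open>The identity below starts from \<open>Y * (1 - S) * (1 + S) * Y\<close>,
      replaces \<open>1 + S\<close> by \<open>\<kappa> * \<kappa>\<close>, moves \<kappa> outside
      through \<open>Y\<close> on both sides and puts \<open>V * X * star V\<close> for
      \<open>Y * (1 - S) * Y\<close>. Each of the two moves costs
      \<open>4 * norm Y * norm D\<close>, which explains the constant 8.\<close>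
    define D where "D = \<kappa> * Y - Y * \<kappa>"
    \<comment> \<open>Although \<kappa> lives in the unitization, its product with \<open>V\<close>
      lies in the ideal \<open>A\<close>.\<close>
    define v' where "v' = uz_part (\<kappa> * V)"
    have v': "Uz 0 v' = \<kappa> * V" by (simp add: uz_eq_iff v'_def V_def)
    let ?Q = "y * y - y * s * y - v * x * star v"
    have Q: "Uz 0 ?Q = Y * (1 - S) * Y - V * X * star V"
      by (simp add: Uz_simps defs left_diff_distrib right_diff_distrib)
    have "Uz 0 (y * y - y * s * s * y - v' * x * star v')
        = Y * Y - Y * S * S * Y - (\<kappa> * V) * X * star (\<kappa> * V)"
      by (simp only: Uz_simps v' defs)
    also have "\<dots> = Y * (1 - S) * (1 + S - \<kappa> * \<kappa>) * Y + (Y * (1 - S) * \<kappa> * D - D * (1 - S) * Y * \<kappa>)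
        + \<kappa> * Uz 0 ?Q * \<kappa>"
    proof -
      have c: "(1 - S) * \<kappa> = \<kappa> * (1 - S)" using S\<kappa> by (simp add: left_diff_distrib right_diff_distrib)
      have 1: "Y * (1 - S) * (1 + S - \<kappa> * \<kappa>) * Y = Y * Y - Y * S * S * Y - Y * ((1 - S) * \<kappa>) * \<kappa> * Y"
        by (simp add: left_diff_distrib right_diff_distrib distrib_left distrib_right mult.assoc)
      have 2: "Y * (1 - S) * \<kappa> * D = Y * ((1 - S) * \<kappa>) * \<kappa> * Y - Y * ((1 - S) * \<kappa>) * Y * \<kappa>"
        by (simp only: D_def right_diff_distrib[of _ "\<kappa> * Y"] mult.assoc)
      have "(\<kappa> * Y - Y * \<kappa>) * T * Y * \<kappa> = \<kappa> * Y * T * Y * \<kappa> - Y * (\<kappa> * T) * Y * \<kappa>" for T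
        by (simp add: left_diff_distrib mult.assoc)
      then have 3: "D * (1 - S) * Y * \<kappa> = \<kappa> * Y * (1 - S) * Y * \<kappa> - Y * (\<kappa> * (1 - S)) * Y * \<kappa>"
        unfolding D_def .
      have 4: "\<kappa> * Uz 0 ?Q * \<kappa> = \<kappa> * Y * (1 - S) * Y * \<kappa> - \<kappa> * V * X * star V * \<kappa>"
        unfolding Q by (simp only: left_diff_distrib[of "_ * _"] right_diff_distrib[of \<kappa>] mult.assoc)
      have 5: "(\<kappa> * V) * X * star (\<kappa> * V) = \<kappa> * V * X * star V * \<kappa>"
        by (simp add: star_mult s\<kappa> mult.assoc)
      show ?thesis unfolding 1 2 3 4 5 c by simp
    qed
    also have "norm \<dots> \<le> norm Y * 2 * \<eta> * norm Y
        + (norm Y * 2 * 2 * norm D + norm D * 2 * norm Y * 2) + 2 * norm ?Q * 2"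
      by (intro norm_triangle_mono order_trans[OF norm_triangle_ineq4] add_mono norm_mult_bound
          n1S \<kappa>2 n\<kappa> order_refl) simp
    also have "\<dots> \<le> 2 * \<eta> * (norm y)\<^sup>2 + 8 * (C * norm (s * y - y * s)) * norm y + 4 * norm ?Q"
    proof -
      have "norm D \<le> C * norm (S * Y - Y * S)" unfolding D_def \<kappa>_def by (rule CC[OF nS])
      also have "norm (S * Y - Y * S) = norm (s * y - y * s)"
        by (simp only: S_def Y_def Uz_simps[symmetric] norm_Uz)
      finally have "norm D * norm y \<le> C * norm (s * y - y * s) * norm y" by (rule mult_right_mono) simp
      moreover have "norm Y = norm y" by (simp add: Y_def)
      ultimately show ?thesis by (simp add: power2_eq_square algebra_simps)
    qed
    finally have "norm (y * y - y * s * s * y - v' * x * star v')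
      \<le> 2 * \<eta> * (norm y)\<^sup>2 + 8 * C * norm (s * y - y * s) * norm y + 4 * norm ?Q"
      unfolding norm_Uz by (simp add: mult.assoc)
    then show "\<exists>v'. norm (y * y - y * s * s * y - v' * x * star v')
      \<le> 2 * \<eta> * (norm y)\<^sup>2 + 8 * C * norm (s * y - y * s) * norm y + 4 * norm ?Q" by blast
  qed (use C in simp)
qed

context cstar_action
begin

text \<open>The element \<open>z = \<Sum>\<^sub>g \<alpha>\<^sub>g(f\<^sub>1 w)\<close> is invariant and satisfies \<open>z b z\<^sup>* \<approx> y s\<^sup>2 y\<close>, where \<open>s\<close> is the sum of the
  Rokhlin elements.\<close>

lemma Rokhlin_approximation:
  assumes R: "weak_tracial_Rokhlin G \<alpha>" and x: "positive_elt UNIV x" "norm x = 1"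
    and y: "positive_elt UNIV y" "y * y \<in> fixed" and b: "b \<in> fixed"
    and w: "norm (w * b * star w - y * y) \<le> \<epsilon>'" and e: "0 < \<epsilon>"
  shows "\<exists>z v. z \<in> fixed \<and> norm (y * y - z * b * star z - v * x * star v) \<le> N * \<epsilon>' + \<epsilon> \<and>
    norm (v * x * star v) \<le> 2 * (norm y)\<^sup>2 + \<epsilon>"
proof -
  let ?Y = "norm y" and ?G = "carrier G"
  \<comment> \<open>The second argument of the minimum makes \<open>2 * \<eta> * ?Y\<^sup>2\<close>
    at most half of \<epsilon>; the bound 2 is required by \<open>defect_of_square\<close>.\<close>
  define \<eta> where "\<eta> = min 2 (\<epsilon> / (4 * (?Y\<^sup>2 + 1)))"
  have Y1: "0 < 4 * (?Y\<^sup>2 + 1)" by (simp add: add_nonneg_pos)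
  have \<eta>: "0 < \<eta>" "\<eta> \<le> 2" using e Y1 by (auto simp: \<eta>_def)
  have "\<eta> * ?Y\<^sup>2 \<le> \<epsilon> / (4 * (?Y\<^sup>2 + 1)) * (?Y\<^sup>2 + 1)"
    using e Y1 by (intro mult_mono) (auto simp: \<eta>_def)
  also have "\<dots> = \<epsilon> / 4" using Y1 by (simp add: field_simps)
  finally have \<eta>Y: "2 * \<eta> * ?Y\<^sup>2 \<le> \<epsilon> / 2" by simp
  obtain C where C: "0 \<le> C" and CC: "\<And>s y v x :: 'a. psd (Uz 0 s) \<Longrightarrow> norm s \<le> 1 \<Longrightarrow>
    \<exists>v'. norm (y * y - y * s * s * y - v' * x * star v')
      \<le> 2 * \<eta> * (norm y)\<^sup>2 + C * norm (s * y - y * s) * norm y + 4 * norm (y * y - y * s * y - v * x * star v)"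
    using defect_of_square[OF \<eta>] by blast
  define \<mu> where "\<mu> = norm w * norm b * norm w"
  have \<mu>: "0 \<le> \<mu>" by (simp add: \<mu>_def)
  \<comment> \<open>\<open>D\<close> collects the coefficients of \<delta>: commutator and
    comparison errors of the defect, the errors \<open>E g h\<close> of all pairs, and the
    commutators with \<open>y\<close> on the diagonal.\<close>
  define D where "D = C * N * ?Y + 8 + N * (N * (2 * \<mu> + 1)) + N * (2 * ?Y)"
  have N0: "0 \<le> N" using N_ge_1 by simp
  have D0: "0 \<le> D" unfolding D_def using C N0 \<mu> by (intro add_nonneg_nonneg mult_nonneg_nonneg) auto
  define \<delta> where "\<delta> = \<epsilon> / 2 / (D + 1)"
  have \<delta>: "0 < \<delta>" using e D0 by (simp add: \<delta>_def)
  have "D * \<delta> \<le> (D + 1) * \<delta>" using \<delta> by (simp add: distrib_right)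
  also have "\<dots> = \<epsilon> / 2"
    using D0 nonzero_mult_div_cancel_left[of "D + 1" "\<epsilon> / 2"] by (simp only: \<delta>_def times_divide_eq_right)
  finally have D\<delta>: "D * \<delta> \<le> \<epsilon> / 2" .
  define m where "m g h = \<alpha> g w * b * star (\<alpha> h w)" for g h
  have m\<mu>: "norm (m g h) \<le> \<mu>" if "g \<in> ?G" "h \<in> ?G" for g h
    unfolding m_def \<mu>_def using that by (intro norm_mult_bound) (simp_all add: norm_act)
  \<comment> \<open>The Rokhlin elements must nearly commute with all mixed products
    \<open>m g h\<close>, so that the two factors in
    \<open>\<alpha> g (f \<one>) * m g h * \<alpha> h (f \<one>)\<close> meet and annihilate each
    other for distinct \<open>g\<close> and \<open>h\<close>.\<close>
  let ?F = "insert y ((\<lambda>(g, h). m g h) ` (?G \<times> ?G))"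
  have "finite ?F" using finite_carrier by simp
  then obtain f v0 where
    sf: "\<And>g. g \<in> ?G \<Longrightarrow> star (f g) = f g" and nf: "\<And>g. g \<in> ?G \<Longrightarrow> norm (f g) \<le> 1"
    and orth: "\<And>g h. g \<in> ?G \<Longrightarrow> h \<in> ?G \<Longrightarrow> g \<noteq> h \<Longrightarrow> f g * f h = 0"
    and comm: "\<And>g a. g \<in> ?G \<Longrightarrow> a \<in> ?F \<Longrightarrow> norm (a * f g - f g * a) \<le> \<delta>"
    and eqv: "\<And>g. g \<in> ?G \<Longrightarrow> norm (\<alpha> g (f \<one>) - f g) \<le> \<delta>"
    and ps: "psd (Uz 0 (sum f ?G))" and ns: "norm (sum f ?G) \<le> 1"
    and v0: "norm (y * y - y * sum f ?G * y - v0 * x * star v0) \<le> 2 * \<delta>"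
    by (rule Rokhlin_elements[OF R \<delta> _ x y(1)]) (rule that)
  define s where "s = sum f ?G"
  have sy: "norm (s * y - y * s) \<le> N * \<delta>"
  proof -
    have "s * y - y * s = (\<Sum>g\<in>?G. f g * y - y * f g)"
      by (simp add: s_def sum_distrib_left sum_distrib_right sum_subtractf)
    also have "norm \<dots> \<le> N * \<delta>"
      by (rule norm_sum_carrier_le) (metis comm insertI1 norm_minus_commute)
    finally show ?thesis .
  qed
  obtain v where v: "norm (y * y - y * s * s * y - v * x * star v)
      \<le> 2 * \<eta> * ?Y\<^sup>2 + C * norm (s * y - y * s) * ?Y + 4 * norm (y * y - y * s * y - v0 * x * star v0)"
    using CC ps ns unfolding s_def by blast
  also have "\<dots> \<le> \<epsilon> / 2 + C * (N * \<delta>) * ?Y + 4 * (2 * \<delta>)"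
    using v0 sy C \<eta>Y N0 \<delta> unfolding s_def by (intro add_mono mult_mono) auto
  finally have v1: "norm (y * y - y * s * s * y - v * x * star v) \<le> \<epsilon> / 2 + (C * N * ?Y + 8) * \<delta>"
    by (simp add: algebra_simps)
  define z where "z = (\<Sum>g\<in>?G. \<alpha> g (f \<one> * w))"
  have zf: "z \<in> fixed" unfolding z_def by (rule average_fixed)
  define E where "E g h = \<alpha> g (f \<one>) * m g h * \<alpha> h (f \<one>) - m g h * f g * f h" for g h
  have nE: "norm (E g h) \<le> (2 * \<mu> + 1) * \<delta>" if g: "g \<in> ?G" and h: "h \<in> ?G" for g h
  proof -
    have "E g h = (\<alpha> g (f \<one>) - f g) * m g h * \<alpha> h (f \<one>) + f g * m g h * (\<alpha> h (f \<one>) - f h)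
        + (f g * m g h - m g h * f g) * f h"
      unfolding E_def by (simp add: left_diff_distrib right_diff_distrib)
    also have "norm \<dots> \<le> \<delta> * \<mu> * 1 + 1 * \<mu> * \<delta> + \<delta> * 1"
    proof (intro norm_triangle_mono norm_mult_bound eqv m\<mu> nf g h)
      show "norm (\<alpha> h (f \<one>)) \<le> 1" using h nf[OF one_closed] by (simp add: norm_act)
      have "m g h \<in> ?F" using g h by auto
      from comm[OF g this] show "norm (f g * m g h - m g h * f g) \<le> \<delta>" by (simp add: norm_minus_commute)
    qed
    finally show ?thesis by (simp add: algebra_simps)
  qed
  have diag: "norm (m g g * f g * f g - y * f g * f g * y) \<le> \<epsilon>' + 2 * ?Y * \<delta>" if g: "g \<in> ?G" for g
  proof -
    \<comment> \<open>Only the square of \<open>y\<close> is known to be invariant; together with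
      invariance of \<open>b\<close> this moves the given estimate by \<alpha> without
      change.\<close>
    have "m g g - y * y = \<alpha> g (w * b * star w - y * y)"
      using fixedD[OF b g] fixedD[OF y(2) g] g by (simp add: m_def act_simps)
    then have 1: "norm (m g g - y * y) \<le> \<epsilon>'" using w g by (simp add: norm_act)
    have 2: "norm (y * f g - f g * y) \<le> \<delta>" using comm[OF g] by simp
    have "m g g * f g * f g - y * f g * f g * y
        = (m g g - y * y) * f g * f g + y * ((y * f g - f g * y) * f g + f g * (y * f g - f g * y))"
      by (simp add: left_diff_distrib right_diff_distrib distrib_left mult.assoc)
    also have "norm \<dots> \<le> \<epsilon>' * 1 * 1 + ?Y * (\<delta> * 1 + 1 * \<delta>)"
      by (intro norm_triangle_mono norm_mult_bound 1 2 nf g order_refl)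
    finally show ?thesis by (simp add: algebra_simps)
  qed
  have "z * b * star z = (\<Sum>g\<in>?G. \<Sum>h\<in>?G. \<alpha> g (f \<one>) * m g h * \<alpha> h (f \<one>))"
  proof -
    have "z * b * star z = (\<Sum>g\<in>?G. \<Sum>h\<in>?G. (\<alpha> g (f \<one> * w) * b) * star (\<alpha> h (f \<one> * w)))"
      unfolding z_def star_sum sum_distrib_right[where r=b] by (rule sum_product)
    also have "\<dots> = (\<Sum>g\<in>?G. \<Sum>h\<in>?G. \<alpha> g (f \<one>) * m g h * \<alpha> h (f \<one>))"
    proof (intro sum.cong refl)
      fix g h assume g: "g \<in> ?G" and h: "h \<in> ?G"
      have "star (\<alpha> h (f \<one>)) = \<alpha> h (f \<one>)"
        using act_simps(4)[OF h, of "f \<one>"] sf[OF one_closed] by simp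
      then show "(\<alpha> g (f \<one> * w) * b) * star (\<alpha> h (f \<one> * w)) = \<alpha> g (f \<one>) * m g h * \<alpha> h (f \<one>)"
        by (simp add: act_simps(3)[OF g] act_simps(3)[OF h] star_mult m_def mult.assoc)
    qed
    finally show ?thesis .
  qed
  also have "\<dots> = (\<Sum>g\<in>?G. \<Sum>h\<in>?G. E g h) + (\<Sum>g\<in>?G. \<Sum>h\<in>?G. m g h * f g * f h)"
    by (simp add: E_def sum_subtractf)
  also have "(\<Sum>g\<in>?G. \<Sum>h\<in>?G. m g h * f g * f h) = (\<Sum>g\<in>?G. m g g * f g * f g)"
  proof (rule sum.cong[OF refl])
    fix g assume g: "g \<in> ?G"
    have "(\<Sum>h\<in>?G. m g h * f g * f h) = (\<Sum>h\<in>?G. if h = g then m g g * f g * f g else 0)"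
    proof (rule sum.cong[OF refl])
      fix h assume h: "h \<in> ?G"
      show "m g h * f g * f h = (if h = g then m g g * f g * f g else 0)"
        using orth[OF g h] by (cases "h = g") (simp_all add: mult.assoc)
    qed
    then show "(\<Sum>h\<in>?G. m g h * f g * f h) = m g g * f g * f g" using g finite_carrier by simp
  qed
  finally have zz: "z * b * star z = (\<Sum>g\<in>?G. \<Sum>h\<in>?G. E g h) + (\<Sum>g\<in>?G. m g g * f g * f g)" .
  have "s * s = (\<Sum>g\<in>?G. f g * f g)"
    unfolding s_def by (rule orthogonal_sum_square[OF finite_carrier]) (rule orth)
  then have "y * (s * s) * y = y * (\<Sum>g\<in>?G. f g * f g) * y" by simp
  then have "y * s * s * y = (\<Sum>g\<in>?G. y * f g * f g * y)"
    by (simp only: mult.assoc sum_distrib_left sum_distrib_right)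
  with zz have "z * b * star z - y * s * s * y
      = (\<Sum>g\<in>?G. \<Sum>h\<in>?G. E g h) + (\<Sum>g\<in>?G. m g g * f g * f g - y * f g * f g * y)"
    by (simp add: sum_subtractf)
  also have "norm \<dots> \<le> N * (N * ((2 * \<mu> + 1) * \<delta>)) + N * (\<epsilon>' + 2 * ?Y * \<delta>)"
    by (intro norm_triangle_mono norm_sum_carrier_le nE diag)
  finally have v2: "norm (z * b * star z - y * s * s * y)
      \<le> N * (N * ((2 * \<mu> + 1) * \<delta>)) + N * (\<epsilon>' + 2 * ?Y * \<delta>)" .
  have "y * y - z * b * star z - v * x * star v
      = (y * y - y * s * s * y - v * x * star v) - (z * b * star z - y * s * s * y)" by simp
  then have "norm (y * y - z * b * star z - v * x * star v)
      \<le> norm (y * y - y * s * s * y - v * x * star v) + norm (z * b * star z - y * s * s * y)"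
    by (metis norm_triangle_ineq4)
  also have "\<dots> \<le> \<epsilon> / 2 + N * \<epsilon>' + D * \<delta>"
    using v1 v2 by (simp add: D_def algebra_simps)
  also have "\<dots> \<le> N * \<epsilon>' + \<epsilon>" using D\<delta> by simp
  finally have 1: "norm (y * y - z * b * star z - v * x * star v) \<le> N * \<epsilon>' + \<epsilon>" .
  \<comment> \<open>The second claim bounds \<open>v * x * star v\<close> by \<open>y\<close> and
    \<epsilon> alone, since it approximates \<open>y * y - y * s * s * y\<close>; no bound on
    \<open>v\<close> results or is available.\<close>
  have "(C * N * ?Y + 8) * \<delta> \<le> D * \<delta>"
    unfolding D_def using N0 \<mu> \<delta> by (intro mult_right_mono) auto
  with v1 D\<delta> have v3: "norm (y * y - y * s * s * y - v * x * star v) \<le> \<epsilon>" by simp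
  have "norm (y * s * s * y) \<le> ?Y * 1 * 1 * ?Y"
    using ns by (intro norm_mult_bound order_refl) (simp_all add: s_def)
  moreover have "norm (y * y) \<le> ?Y * ?Y" by (rule norm_mult_ineq)
  moreover have "norm (v * x * star v) \<le> norm (y * y) + norm (y * s * s * y)
      + norm (y * y - y * s * s * y - v * x * star v)"
    using norm_triangle_ineq4[of "y * y - y * s * s * y" "y * y - y * s * s * y - v * x * star v"]
      norm_triangle_ineq4[of "y * y" "y * s * s * y"] by simp
  ultimately have "norm (v * x * star v) \<le> 2 * ?Y\<^sup>2 + \<epsilon>" using v3 by (simp add: power2_eq_square)
  with zf 1 show ?thesis by blast
qed

text \<open>\<open>d\<close> is the normalization of
  \<open>d0 = c * f \<one> * f \<one> * c\<close>. As \<open>c\<close> is invariant and almost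
  commutes with the Rokhlin elements, the translates of \<open>d0\<close> are close to the almost
  orthogonal elements \<open>e g\<close>. Condition (4) keeps \<open>norm d0\<close> above
  \<open>1 / (2 * N)\<close>, so normalizing enlarges products of translates by a bounded factor.
  The form \<open>k * c\<close> is what later allows a comparison with \<open>c * c\<close>.\<close>

lemma almost_orthogonal_translates:
  assumes R: "weak_tracial_Rokhlin G \<alpha>" and c: "c \<in> fixed" "star c = c" "norm c = 1" and \<eta>: "0 < \<eta>"
  shows "\<exists>d k. positive_elt UNIV d \<and> norm d = 1 \<and> d = k * c \<and>
    (\<forall>g\<in>carrier G. \<forall>h\<in>carrier G. g \<noteq> h \<longrightarrow> norm (\<alpha> g d * \<alpha> h d) \<le> \<eta>)"
proof -
  let ?G = "carrier G"
  have N0: "0 < N" using N_ge_1 by simp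
  \<comment> \<open>The first bound leaves \<open>N * norm d0 > 1/2\<close>; the second makes the
    product estimate \<open>6 * \<delta>\<close>, enlarged by the square of \<open>2 * N\<close>, at
    most \<eta>.\<close>
  define \<delta> where "\<delta> = min (1 / (6 * N)) (\<eta> / (24 * N\<^sup>2))"
  have \<delta>: "0 < \<delta>" "\<delta> * (6 * N) \<le> 1" "\<delta> * (24 * N\<^sup>2) \<le> \<eta>"
    using \<eta> N0 by (auto simp: \<delta>_def pos_le_divide_eq[symmetric])
  have px: "positive_elt UNIV (c * c)" using positive_star_mult[of c] c(2) by simp
  have nx: "norm (c * c) = 1" using norm_selfadjoint_square[OF c(2)] c(3) by simp
  have "psd (Uz 0 (0::'a))" by (simp add: Uz_simps(8))
  then have p0: "positive_elt UNIV (0::'a)" by (simp only: positive_elt_iff_psd)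
  have "finite {c}" by simp
  then obtain f where
    sf: "\<And>g. g \<in> ?G \<Longrightarrow> star (f g) = f g" and nf: "\<And>g. g \<in> ?G \<Longrightarrow> norm (f g) \<le> 1"
    and orth: "\<And>g h. g \<in> ?G \<Longrightarrow> h \<in> ?G \<Longrightarrow> g \<noteq> h \<Longrightarrow> f g * f h = 0"
    and comm: "\<And>g a. g \<in> ?G \<Longrightarrow> a \<in> {c} \<Longrightarrow> norm (a * f g - f g * a) \<le> \<delta>"
    and eqv: "\<And>g. g \<in> ?G \<Longrightarrow> norm (\<alpha> g (f \<one>) - f g) \<le> \<delta>"
    and big: "1 - \<delta> < norm (sum f ?G * (c * c) * sum f ?G)"
    by (rule Rokhlin_elements[OF R \<delta>(1) _ px nx p0]) (rule that)
  let ?s = "sum f ?G"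
  define e where "e g = c * f g * f g * c" for g
  define d0 where "d0 = e \<one>"
  have f1: "star (f \<one>) = f \<one>" "norm (f \<one>) \<le> 1" using sf nf by auto
  have near: "norm (\<alpha> g d0 - e g) \<le> 2 * \<delta>" if g: "g \<in> ?G" for g
  proof -
    let ?p = "\<alpha> g (f \<one>)"
    have "\<alpha> g d0 - e g = c * ((?p - f g) * ?p + f g * (?p - f g)) * c"
      using fixedD[OF c(1) g]
      by (simp add: d0_def e_def act_simps[OF g] left_diff_distrib right_diff_distrib distrib_left
          distrib_right mult.assoc)
    also have "norm \<dots> \<le> 1 * (\<delta> * 1 + 1 * \<delta>) * 1"
      using c(3) f1(2) g by (intro norm_mult_bound norm_triangle_mono eqv nf) (simp_all add: norm_act)
    finally show ?thesis by simp
  qed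
  have ne: "norm (e g) \<le> 1" if "g \<in> ?G" for g
  proof -
    have "norm (e g) \<le> 1 * 1 * 1 * 1"
      unfolding e_def using nf[OF that] c(3) by (intro norm_mult_bound) auto
    then show ?thesis by simp
  qed
  have "norm (?s * (c * c) * ?s) = norm (\<Sum>g\<in>?G. e g)"
  proof -
    have ss: "star ?s = ?s" unfolding star_sum by (rule sum.cong[OF refl]) (rule sf)
    \<comment> \<open>The C*-identity exchanges the order of \<open>c\<close> and \<open>?s\<close>,
      which places the square of \<open>?s\<close> in the middle, where orthogonality splits
      it.\<close>
    have "norm (?s * (c * c) * ?s) = norm (star (c * ?s) * (c * ?s))"
      by (simp only: star_mult ss c(2) mult.assoc)
    also have "\<dots> = norm ((c * ?s) * star (c * ?s))" by (simp only: cstar_identity cstar_identity')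
    also have "(c * ?s) * star (c * ?s) = c * (?s * ?s) * c"
      by (simp only: star_mult ss c(2) mult.assoc)
    also have "?s * ?s = (\<Sum>g\<in>?G. f g * f g)"
      by (rule orthogonal_sum_square[OF finite_carrier]) (rule orth)
    also have "c * (\<Sum>g\<in>?G. f g * f g) * c = (\<Sum>g\<in>?G. e g)"
      by (simp only: sum_distrib_left sum_distrib_right e_def mult.assoc)
    finally show ?thesis .
  qed
  also have "\<dots> \<le> N * (norm d0 + 2 * \<delta>)"
  proof (rule norm_sum_carrier_le)
    fix g assume g: "g \<in> ?G"
    have "norm (e g) \<le> norm (\<alpha> g d0) + norm (\<alpha> g d0 - e g)"
      using norm_triangle_ineq4[of "\<alpha> g d0" "\<alpha> g d0 - e g"] by simp
    with near[OF g] show "norm (e g) \<le> norm d0 + 2 * \<delta>" by (simp add: norm_act[OF g])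
  qed
  finally have "1 - \<delta> < N * (norm d0 + 2 * \<delta>)" using big by linarith
  moreover have "\<delta> \<le> N * \<delta>" using \<delta>(1) N_ge_1 by simp
  ultimately have "1 < N * norm d0 + 3 * (N * \<delta>)" by (simp add: algebra_simps)
  with \<delta>(2) have nd: "1 < norm d0 * (2 * N)" by (simp add: algebra_simps)
  then have d0p: "0 < norm d0" using N0 zero_less_mult_pos2[of "norm d0" "2 * N"] by fastforce
  have cross: "norm (\<alpha> g d0 * \<alpha> h d0) \<le> 6 * \<delta>" if g: "g \<in> ?G" and h: "h \<in> ?G" and gh: "g \<noteq> h" for g h
  proof -
    have cg: "norm (f g * c - c * f g) \<le> \<delta>" using comm[OF g] by (simp add: norm_minus_commute)
    have "f g * c * c * f h = (f g * c - c * f g) * c * f h + c * (f g * c - c * f g) * f h"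
      using orth[OF g h gh] by (simp add: left_diff_distrib right_diff_distrib mult.assoc)
    also have "norm \<dots> \<le> \<delta> * 1 * 1 + 1 * \<delta> * 1"
      using c(3) by (intro norm_triangle_mono norm_mult_bound cg nf h) auto
    finally have fcf: "norm (f g * c * c * f h) \<le> 2 * \<delta>" by simp
    have "e g * e h = c * f g * (f g * c * c * f h) * f h * c" by (simp add: e_def mult.assoc)
    also have "norm \<dots> \<le> 1 * 1 * (2 * \<delta>) * 1 * 1"
      using c(3) by (intro norm_mult_bound fcf nf g h) auto
    finally have ee: "norm (e g * e h) \<le> 2 * \<delta>" by simp
    have nd0: "norm d0 \<le> 1" unfolding d0_def by (rule ne) simp
    have "\<alpha> g d0 * \<alpha> h d0 = (\<alpha> g d0 - e g) * \<alpha> h d0 + e g * (\<alpha> h d0 - e h) + e g * e h"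
      by (simp add: left_diff_distrib right_diff_distrib)
    also have "norm \<dots> \<le> (2 * \<delta>) * 1 + 1 * (2 * \<delta>) + 2 * \<delta>"
      using nd0 by (intro norm_triangle_mono norm_mult_bound near ne ee g h) (simp add: norm_act[OF h])
    finally show ?thesis by simp
  qed
  define r where "r = 1 / norm d0"
  define d where "d = r *\<^sub>R d0"
  have r: "0 < r" "r * norm d0 = 1" "r < 2 * N" using d0p nd by (auto simp: r_def field_simps)
  have "psd (Uz 0 d0)"
  proof -
    have "d0 = star (f \<one> * c) * (f \<one> * c)" by (simp add: d0_def e_def star_mult f1 c(2) mult.assoc)
    then show ?thesis using psd_Uz_star_mult by metis
  qed
  then have "psd (Uz 0 d)" unfolding d_def Uz_simps(5) using r(1) by (intro psd_scaleR) auto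
  then have 1: "positive_elt UNIV d" by (simp add: positive_elt_iff_psd)
  have 2: "norm d = 1" using r by (simp add: d_def)
  have 3: "d = (r *\<^sub>R (c * f \<one> * f \<one>)) * c" by (simp add: d_def d0_def e_def)
  have 4: "norm (\<alpha> g d * \<alpha> h d) \<le> \<eta>" if g: "g \<in> ?G" and h: "h \<in> ?G" and gh: "g \<noteq> h" for g h
  proof -
    have "norm (\<alpha> g d * \<alpha> h d) = (r * r) * norm (\<alpha> g d0 * \<alpha> h d0)"
      using r(1) by (simp add: d_def act_simps(6)[OF g] act_simps(6)[OF h])
    also have "\<dots> \<le> ((2 * N) * (2 * N)) * (6 * \<delta>)"
      using r N0 by (intro mult_mono cross that) auto
    also have "\<dots> = \<delta> * (24 * N\<^sup>2)" by (simp add: power2_eq_square)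
    finally show ?thesis using \<delta>(3) by linarith
  qed
  from 1 2 3 4 show ?thesis by blast
qed

text \<open>With \<open>u = v \<rho>(d)\<close> the cross terms of \<open>W W\<^sup>*\<close>, \<open>W = \<Sum>\<^sub>g \<alpha>\<^sub>g(u)\<close>, are small relative to \<open>\<parallel>u\<parallel>\<^sup>2\<close> alone,
  whatever the norm of \<open>v\<close>, because \<open>u = u \<kappa>(d) d\<close> with \<open>\<parallel>\<kappa>(d)\<parallel> \<le> 2\<close>.\<close>

definition bump :: "real \<Rightarrow> real" where
  "bump t = max 0 (2 * t - 1)"

text \<open>Equal to 1/t from 1/2 on, where \<open>bump\<close> lives, and to 4 t below, which gives
  continuity, the value 0 at 0 and the bound 2 on [0, 1].\<close>

definition damped_inverse :: "real \<Rightarrow> real" where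
  "damped_inverse t = t / (max (1/2) t)\<^sup>2"

lemma admissible_bump: "admissible bump"
  by (auto simp: admissible_def bump_def intro!: continuous_intros)

lemma admissible_damped_inverse: "admissible damped_inverse"
proof -
  have "(max (1/2) t)\<^sup>2 \<noteq> 0" for t :: real by (auto simp: max_def)
  then have "continuous_on UNIV (\<lambda>t::real. t / (max (1/2) t)\<^sup>2)"
    by (intro continuous_intros) auto
  then show ?thesis
    unfolding admissible_def damped_inverse_def by simp
qed

text \<open>Each diagonal term \<open>\<alpha> g (u * star u)\<close> is close to \<open>r\<close>
  because \<open>r\<close> is invariant, so \<open>W * star W\<close> is close to \<open>N\<close>
  times \<open>r\<close>. Since \<open>d\<close> is a multiple of the invariant \<open>c\<close>, so
  is \<open>W\<close>, with an invariant coefficient.\<close>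

lemma average_comparison:
  assumes c: "c \<in> fixed" "star c = c" and d: "positive_elt UNIV d" "norm d = 1" "d = k * c"
    and orth: "\<And>g h. g \<in> carrier G \<Longrightarrow> h \<in> carrier G \<Longrightarrow> g \<noteq> h \<Longrightarrow> norm (\<alpha> g d * \<alpha> h d) \<le> \<eta>"
    and r: "r \<in> fixed" "norm (r - v * (fun_calc UNIV bump d * fun_calc UNIV bump d) * star v) \<le> \<theta>"
    and K: "norm (v * (fun_calc UNIV bump d * fun_calc UNIV bump d) * star v) \<le> K" and \<eta>: "0 \<le> \<eta>"
  shows "\<exists>z\<in>fixed. norm (r - z * (c * c) * star z) \<le> 4 * N * K * \<eta> + \<theta>"
proof -
  let ?G = "carrier G"
  have sd: "star d = d" using d(1) by (simp add: positive_elt_def)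
  define \<rho> where "\<rho> = fun_calc UNIV bump d"
  define \<kappa> where "\<kappa> = fun_calc UNIV damped_inverse d"
  have s\<rho>: "star \<rho> = \<rho>" unfolding \<rho>_def by (rule fun_calc_selfadjoint[OF sd admissible_bump])
  have s\<kappa>: "star \<kappa> = \<kappa>" unfolding \<kappa>_def by (rule fun_calc_selfadjoint[OF sd admissible_damped_inverse])
  have pd: "0 \<le> t" "t \<le> 1" if "t \<in> real_spectrum d" for t
    using positive_real_spectrum[OF d(1) that] real_spectrum_norm[OF that] d(2) by auto
  have n\<kappa>: "norm \<kappa> \<le> 2"
    unfolding \<kappa>_def
  proof (rule norm_fun_calc_le[OF sd admissible_damped_inverse])
    fix t assume "t \<in> real_spectrum d"
    from pd[OF this] show "\<bar>damped_inverse t\<bar> \<le> 2"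
      by (auto simp: damped_inverse_def max_def power2_eq_square divide_simps)
  qed simp
  have \<rho>\<kappa>: "\<rho> = \<rho> * \<kappa> * d"
  proof -
    have "\<rho> * \<kappa> * d = fun_calc UNIV (\<lambda>t. bump t * damped_inverse t * t) d"
      unfolding \<rho>_def \<kappa>_def
      by (simp only: fun_calc_mult[OF sd] fun_calc_id[OF sd] admissible_mult admissible_bump
          admissible_damped_inverse admissible_id)
    also have "(\<lambda>t. bump t * damped_inverse t * t) = bump"
    proof
      fix t :: real
      show "bump t * damped_inverse t * t = bump t"
      proof (cases "1/2 \<le> t")
        case True
        then show ?thesis by (simp add: damped_inverse_def max_def power2_eq_square)
      qed (simp add: bump_def)
    qed
    finally show ?thesis by (simp add: \<rho>_def)
  qed
  \<comment> \<open>\<open>u * star u\<close> is the given approximation of \<open>r\<close>, hence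
    the square of \<open>norm u\<close> is at most \<open>K\<close>, although \<open>norm v\<close>
    is unknown.\<close>
  define u where "u = v * \<rho>"
  have uu: "u * star u = v * (\<rho> * \<rho>) * star v" by (simp add: u_def star_mult s\<rho> mult.assoc)
  have nu: "norm u * norm u \<le> K"
    using K cstar_identity'[of u] uu by (simp add: \<rho>_def power2_eq_square)
  then have K0: "0 \<le> K" using mult_nonneg_nonneg[OF norm_ge_zero norm_ge_zero] order_trans by blast
  have u\<kappa>: "u = u * \<kappa> * d"
    unfolding u_def by (subst \<rho>\<kappa>) (simp only: mult.assoc)
  have u\<kappa>': "star u = d * star (u * \<kappa>)"
    by (subst u\<kappa>) (simp only: star_mult sd)
  define W' where "W' = (\<Sum>g\<in>?G. \<alpha> g (u * \<kappa> * k))"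
  define W where "W = (\<Sum>g\<in>?G. \<alpha> g u)"
  have WW': "W = W' * c"
  proof -
    have "\<alpha> g u = \<alpha> g (u * \<kappa> * k) * c" if g: "g \<in> ?G" for g
    proof -
      have "u = (u * \<kappa> * k) * c" using u\<kappa> unfolding d(3) by (simp only: mult.assoc)
      then have "\<alpha> g u = \<alpha> g ((u * \<kappa> * k) * c)" by simp
      then show ?thesis using fixedD[OF c(1) g] by (simp only: act_simps(3)[OF g])
    qed
    then show ?thesis by (simp add: W_def W'_def sum_distrib_right)
  qed
  have entry: "norm (\<alpha> g u * star (\<alpha> h u) - (if h = g then r else 0))
      \<le> 4 * K * \<eta> + (if h = g then \<theta> else 0)" if g: "g \<in> ?G" and h: "h \<in> ?G" for g h
  proof (cases "h = g")
    case True
    have "\<alpha> g u * star (\<alpha> g u) - r = \<alpha> g (u * star u - r)"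
      using fixedD[OF r(1) g] by (simp add: act_simps[OF g])
    then have "norm (\<alpha> g u * star (\<alpha> g u) - r) \<le> \<theta>"
      using r(2) unfolding uu by (simp add: norm_act[OF g] norm_minus_commute \<rho>_def)
    moreover have "0 \<le> 4 * K * \<eta>" using K0 \<eta> by simp
    ultimately show ?thesis using True by simp
  next
    case False
    have "\<alpha> g u * star (\<alpha> h u) = \<alpha> g (u * \<kappa> * d) * \<alpha> h (d * star (u * \<kappa>))"
      using u\<kappa> u\<kappa>' by (simp only: act_simps(4)[OF h, symmetric])
    also have "\<dots> = \<alpha> g (u * \<kappa>) * (\<alpha> g d * \<alpha> h d) * \<alpha> h (star (u * \<kappa>))"
      by (simp only: act_simps(3)[OF g] act_simps(3)[OF h] mult.assoc)
    also have "norm \<dots> \<le> (norm u * 2) * \<eta> * (norm u * 2)"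
    proof (intro norm_mult_bound orth g h)
      have "norm (u * \<kappa>) \<le> norm u * 2" using n\<kappa> by (intro norm_mult_bound) auto
      then show "norm (\<alpha> g (u * \<kappa>)) \<le> norm u * 2" "norm (\<alpha> h (star (u * \<kappa>))) \<le> norm u * 2"
        by (simp_all only: norm_act[OF g] norm_act[OF h] norm_star)
    qed (use False in simp)
    also have "\<dots> = 4 * (norm u * norm u) * \<eta>" by simp
    also have "\<dots> \<le> 4 * K * \<eta>" using nu \<eta> by (intro mult_right_mono) auto
    finally show ?thesis using False by simp
  qed
  have "W * star W = (\<Sum>g\<in>?G. \<Sum>h\<in>?G. \<alpha> g u * star (\<alpha> h u))"
    unfolding W_def star_sum by (rule sum_product)
  moreover have "(\<Sum>g\<in>?G. \<Sum>h\<in>?G. if h = g then r else 0) = N *\<^sub>R r"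
    using finite_carrier by (simp add: N_def sum_constant_scaleR)
  ultimately have "W * star W - N *\<^sub>R r
      = (\<Sum>g\<in>?G. \<Sum>h\<in>?G. \<alpha> g u * star (\<alpha> h u) - (if h = g then r else 0))"
    by (simp only: sum_subtractf)
  also have "norm \<dots> \<le> (\<Sum>g\<in>?G. \<Sum>h\<in>?G. 4 * K * \<eta> + (if h = g then \<theta> else 0))"
    by (intro order_trans[OF norm_sum] sum_mono entry)
  also have "\<dots> = N * (N * (4 * K * \<eta>)) + N * \<theta>"
    using finite_carrier by (simp add: N_def sum.distrib distrib_left)
  finally have nW: "norm (W * star W - N *\<^sub>R r) \<le> N * (N * (4 * K * \<eta>) + \<theta>)"
    by (simp add: algebra_simps)
  have N0: "0 < N" using N_ge_1 by simp
  \<comment> \<open>The factor compensates for the \<open>N\<close> copies of \<open>r\<close> and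
    also absorbs one of the two factors \<open>N\<close> in the number of off-diagonal
    terms.\<close>
  define z where "z = (1 / sqrt N) *\<^sub>R W'"
  have "z \<in> fixed" unfolding z_def W'_def by (intro fixed_intros(6) average_fixed)
  have "z * (c * c) * star z = (1 / N) *\<^sub>R (W * star W)"
    using N0 by (simp add: z_def WW' star_scaleR star_mult c(2) mult.assoc)
  also have "r - \<dots> = - ((1 / N) *\<^sub>R (W * star W - N *\<^sub>R r))"
    using N0 by (simp add: scaleR_diff_right)
  also have "norm \<dots> \<le> (1 / N) * (N * (N * (4 * K * \<eta>) + \<theta>))"
    using N0 nW unfolding norm_minus_cancel norm_scaleR by (intro mult_mono) auto
  also have "\<dots> = 4 * N * K * \<eta> + \<theta>" using N0 by simp
  finally show ?thesis using \<open>z \<in> fixed\<close> by blast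
qed

end

section \<open>Descent to the fixed point algebra\<close>

text \<open>The absolute value makes the function nonnegative on the whole line, as
  \<open>fun_calc_sqrt\<close> demands; on the spectrum of \<open>a\<close> it changes nothing.
  Positivity of the root follows by taking one more root.\<close>

lemma positive_sqrt:
  assumes "positive_elt UNIV a"
  shows "\<exists>y. positive_elt UNIV y \<and> y * y = a"
proof -
  have sa: "star a = a" using assms by (simp add: positive_elt_def)
  have abs: "admissible (\<lambda>t. \<bar>t\<bar>)" by (auto simp: admissible_def intro!: continuous_intros)
  let ?y = "fun_calc UNIV (\<lambda>t. sqrt \<bar>t\<bar>) a"
  have "fun_calc UNIV (\<lambda>t. sqrt (sqrt \<bar>t\<bar>)) a * fun_calc UNIV (\<lambda>t. sqrt (sqrt \<bar>t\<bar>)) a = ?y"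
    by (rule fun_calc_sqrt[OF sa admissible_sqrt[OF abs]]) simp
  then have "psd (Uz 0 ?y)"
    using psd_Uz_square[OF fun_calc_selfadjoint[OF sa admissible_sqrt[OF admissible_sqrt[OF abs]]]] by simp
  moreover have "?y * ?y = fun_calc UNIV (\<lambda>t. \<bar>t\<bar>) a"
    by (rule fun_calc_sqrt[OF sa abs]) simp
  moreover have "\<dots> = fun_calc UNIV (\<lambda>t. t) a"
    by (rule fun_calc_cong[OF sa abs admissible_id]) (use positive_real_spectrum[OF assms] in simp)
  ultimately show ?thesis using positive_elt_iff_psd fun_calc_id[OF sa] by metis
qed

text \<open>\<open>b\<close> splits into orthogonal parts: \<open>\<phi>(b) b \<phi>(b) \<approx> b\<close>, and \<open>c\<^sup>2 = \<psi>(b) b \<psi>(b) \<noteq> 0\<close>, where \<open>\<psi>\<close> lives on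
  \<open>(0, \<delta>)\<close> and therefore detects the spectrum of \<open>b\<close> near \<open>0\<close>.\<close>

lemma orthogonal_splitting:
  fixes b :: "'a::cstar_algebra"
  assumes b: "positive_elt UNIV b" and lim: "0 islimpt spectrum UNIV b" and \<delta>: "0 < \<delta>"
  shows "\<exists>\<phi> \<psi> \<xi>. admissible \<phi> \<and> admissible \<psi> \<and> admissible \<xi> \<and>
    norm (fun_calc UNIV \<phi> b * b * fun_calc UNIV \<phi> b - b) \<le> 2 * \<delta> \<and>
    fun_calc UNIV \<phi> b * b * fun_calc UNIV \<psi> b = 0 \<and> fun_calc UNIV \<psi> b * b * fun_calc UNIV \<phi> b = 0 \<and>
    fun_calc UNIV \<xi> b * fun_calc UNIV \<xi> b = fun_calc UNIV \<psi> b * b * fun_calc UNIV \<psi> b \<and>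
    fun_calc UNIV \<xi> b \<noteq> 0"
proof -
  have sb: "star b = b" using b by (simp add: positive_elt_def)
  have nonneg: "0 \<le> t" if "t \<in> real_spectrum b" for t using positive_real_spectrum[OF b that] .
  \<comment> \<open>\<phi> is 0 up to \<delta> and 1 from \<open>2 * \<delta>\<close> on, while
    \<psi> is supported on (0, \<delta>). The end of the transition zone is the error
    \<open>2 * \<delta>\<close> of the truncation.\<close>
  define \<phi> where "\<phi> t = max 0 (min 1 (t / \<delta> - 1))" for t
  define \<psi> where "\<psi> t = max 0 (min t (\<delta> - t))" for t
  define \<xi> where "\<xi> t = sqrt \<bar>t\<bar> * \<psi> t" for t
  have A\<phi>: "admissible \<phi>" unfolding \<phi>_def using \<delta> by (auto simp: admissible_def intro!: continuous_intros)
  have A\<psi>: "admissible \<psi>" unfolding \<psi>_def using \<delta> by (auto simp: admissible_def intro!: continuous_intros)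
  have abs: "admissible (\<lambda>t. \<bar>t\<bar>)" by (auto simp: admissible_def intro!: continuous_intros)
  have A\<xi>: "admissible \<xi>" unfolding \<xi>_def by (intro admissible_mult admissible_sqrt abs A\<psi>)
  have prod: "fun_calc UNIV f b * b * fun_calc UNIV g b = fun_calc UNIV (\<lambda>t. f t * t * g t) b"
    if "admissible f" "admissible g" for f g
    using that by (simp only: fun_calc_mult[OF sb] fun_calc_id[OF sb] admissible_mult admissible_id)
  have zero: "fun_calc UNIV (\<lambda>t. 0) b = 0"
    using norm_fun_calc_le[OF sb, of "\<lambda>t. 0" 0] by (simp add: admissible_def)
  have disj: "\<phi> t * t * \<psi> t = 0" "\<psi> t * t * \<phi> t = 0" for t
    using \<delta> by (auto simp: \<phi>_def \<psi>_def max_def min_def field_simps)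
  have 1: "norm (fun_calc UNIV \<phi> b * b * fun_calc UNIV \<phi> b - b) \<le> 2 * \<delta>"
  proof -
    have ad: "admissible (\<lambda>t. \<phi> t * t * \<phi> t - t)"
      using admissible_mult[OF admissible_mult[OF A\<phi> admissible_id] A\<phi>]
      by (auto simp: admissible_def intro!: continuous_intros)
    have "norm (fun_calc UNIV (\<lambda>t. \<phi> t * t * \<phi> t - t) b) \<le> 2 * \<delta>"
    proof (rule norm_fun_calc_le[OF sb ad])
      fix t assume "t \<in> real_spectrum b"
      then have t: "0 \<le> t" by (rule nonneg)
      show "\<bar>\<phi> t * t * \<phi> t - t\<bar> \<le> 2 * \<delta>"
      proof (cases "2 * \<delta> \<le> t")
        case True
        then have "1 \<le> t / \<delta> - 1" using \<delta> by (simp add: field_simps)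
        then have "\<phi> t = 1" by (simp add: \<phi>_def)
        then show ?thesis using \<delta> by simp
      next
        case False
        have \<phi>: "0 \<le> \<phi> t" "\<phi> t \<le> 1" by (auto simp: \<phi>_def)
        have "\<phi> t * \<phi> t \<le> 1" using mult_mono[of "\<phi> t" 1 "\<phi> t" 1] \<phi> by simp
        then have "t * (\<phi> t * \<phi> t) \<le> t * 1" using t by (rule mult_left_mono)
        moreover have "0 \<le> t * (\<phi> t * \<phi> t)" using t \<phi> by simp
        moreover have "\<phi> t * t * \<phi> t = t * (\<phi> t * \<phi> t)" by simp
        ultimately show ?thesis using False t by linarith
      qed
    qed (use \<delta> in simp)
    then show ?thesis
      using fun_calc_diff[OF sb admissible_mult[OF admissible_mult[OF A\<phi> admissible_id] A\<phi>] admissible_id]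
      by (simp only: prod[OF A\<phi> A\<phi>] fun_calc_id[OF sb])
  qed
  have 2: "fun_calc UNIV \<phi> b * b * fun_calc UNIV \<psi> b = 0" "fun_calc UNIV \<psi> b * b * fun_calc UNIV \<phi> b = 0"
    by (simp_all only: prod A\<phi> A\<psi> disj zero)
  have 3: "fun_calc UNIV \<xi> b * fun_calc UNIV \<xi> b = fun_calc UNIV \<psi> b * b * fun_calc UNIV \<psi> b"
  proof -
    have "fun_calc UNIV \<xi> b * fun_calc UNIV \<xi> b = fun_calc UNIV (\<lambda>t. \<xi> t * \<xi> t) b"
      by (rule fun_calc_mult[OF sb A\<xi> A\<xi>, symmetric])
    also have "\<dots> = fun_calc UNIV (\<lambda>t. \<psi> t * t * \<psi> t) b"
    proof (rule fun_calc_cong[OF sb])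
      fix t assume "t \<in> real_spectrum b"
      then have "sqrt \<bar>t\<bar> * sqrt \<bar>t\<bar> = t" using nonneg by simp
      moreover have "\<xi> t * \<xi> t = \<psi> t * (sqrt \<bar>t\<bar> * sqrt \<bar>t\<bar>) * \<psi> t" by (simp only: \<xi>_def mult_ac)
      ultimately show "\<xi> t * \<xi> t = \<psi> t * t * \<psi> t" by simp
    qed (intro admissible_mult admissible_id A\<psi> A\<xi>)+
    finally show ?thesis by (simp only: prod A\<psi>)
  qed
  have 4: "fun_calc UNIV \<xi> b \<noteq> 0"
  proof
    assume z: "fun_calc UNIV \<xi> b = 0"
    \<comment> \<open>The limit point provides a spectral value other than 0 within distance
      \<delta>; by positivity of \<open>b\<close> it lies strictly between 0 and \<delta>, where
      \<xi> is positive.\<close>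
    obtain c where c: "c \<in> spectrum UNIV b" "c \<noteq> 0" "dist c 0 < \<delta>"
      using lim \<delta> unfolding islimpt_approachable by blast
    then obtain t where t: "t \<in> real_spectrum b" "c = complex_of_real t"
      using spectrum_selfadjoint[OF sb] by blast
    then have "0 < t" "t < \<delta>" using c nonneg[OF t(1)] by (auto simp: dist_norm less_le)
    then have "0 < \<xi> t" by (simp add: \<xi>_def \<psi>_def)
    with norm_fun_calc_ge[OF sb A\<xi> t(1)] z show False by simp
  qed
  show ?thesis using A\<phi> A\<psi> A\<xi> 1 2 3 4 by blast
qed

text \<open>The order of the choices is decisive: \<delta> depends on the norm of \<open>v\<close>,
  so \<open>v\<close> comes before the splitting of \<open>b\<close>; \<open>K\<close> depends on
  \<open>y\<close> alone, so \<eta>, \<open>d\<close> and \<open>x\<close> can be fixed before the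
  element \<open>u\<close> of the defect exists.\<close>

lemma (in cstar_action) comparison_descends:
  assumes R: "weak_tracial_Rokhlin G \<alpha>"
    and a: "positive_elt UNIV a" "a \<in> fixed" and b: "positive_elt UNIV b" "b \<in> fixed"
    and lim: "0 islimpt spectrum UNIV b"
    and w: "(\<lambda>n. w n * b * star (w n)) \<longlonglongrightarrow> a" and e: "0 < \<epsilon>" "\<epsilon> \<le> 1"
  shows "\<exists>z\<in>fixed. norm (z * b * star z - a) \<le> \<epsilon>"
proof -
  have sb: "star b = b" using b by (simp add: positive_elt_def)
  have N0: "0 < N" using N_ge_1 by simp
  obtain y where y: "positive_elt UNIV y" "y * y = a" using positive_sqrt[OF a(1)] by blast
  \<comment> \<open>The summand 1 absorbs the error in the bound for \<open>u * x * star u\<close>;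
    this uses \<epsilon> \<le> 1.\<close>
  define K where "K = 2 * (norm y)\<^sup>2 + 1"
  have K: "0 < K" by (simp add: K_def add_nonneg_pos)
  \<comment> \<open>Truncating \<open>b\<close> doubles this error and averaging multiplies it by
    \<open>N\<close>, which gives a quarter of \<epsilon>.\<close>
  define \<epsilon>1 where "\<epsilon>1 = \<epsilon> / (8 * N)"
  have \<epsilon>1: "0 < \<epsilon>1" using e N0 by (simp add: \<epsilon>1_def)
  obtain n where n: "norm (w n * b * star (w n) - a) < \<epsilon>1"
    using w \<epsilon>1 unfolding LIMSEQ_iff by blast
  define v where "v = w n"
  define V where "V = (norm v)\<^sup>2 + 1"
  have V: "0 < V" by (simp add: V_def add_nonneg_pos)
  define \<delta> where "\<delta> = \<epsilon>1 / (2 * V)"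
  have \<delta>: "0 < \<delta>" using \<epsilon>1 V by (simp add: \<delta>_def)
  obtain \<phi> \<psi> \<xi> where adm: "admissible \<phi>" "admissible \<psi>" "admissible \<xi>"
    and b1: "norm (fun_calc UNIV \<phi> b * b * fun_calc UNIV \<phi> b - b) \<le> 2 * \<delta>"
    and cross: "fun_calc UNIV \<phi> b * b * fun_calc UNIV \<psi> b = 0" "fun_calc UNIV \<psi> b * b * fun_calc UNIV \<phi> b = 0"
    and \<xi>: "fun_calc UNIV \<xi> b * fun_calc UNIV \<xi> b = fun_calc UNIV \<psi> b * b * fun_calc UNIV \<psi> b"
      "fun_calc UNIV \<xi> b \<noteq> 0"
    using orthogonal_splitting[OF b(1) lim \<delta>] by blast
  define p where "p = fun_calc UNIV \<phi> b"
  define q where "q = fun_calc UNIV \<psi> b"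
  define c0 where "c0 = fun_calc UNIV \<xi> b"
  have fx: "p \<in> fixed" "q \<in> fixed" "c0 \<in> fixed"
    unfolding p_def q_def c0_def by (intro fun_calc_fixed sb b(2) adm)+
  have st: "star p = p" "star q = q" "star c0 = c0"
    unfolding p_def q_def c0_def by (intro fun_calc_selfadjoint sb adm)+
  define r where "r = 1 / norm c0"
  define c where "c = r *\<^sub>R c0"
  have r: "0 < r" "r * norm c0 = 1" using \<xi>(2) by (auto simp: r_def c0_def)
  have c: "c \<in> fixed" "star c = c" "norm c = 1"
    unfolding c_def using fixed_intros(6)[OF fx(3)] st(3) r by (auto simp: star_scaleR)
  have cc: "c * c = (r *\<^sub>R q) * b * (r *\<^sub>R q)"
    using \<xi>(1) by (simp add: c_def q_def c0_def)
  have vb: "norm (v * (p * b * p) * star v - y * y) \<le> 2 * \<epsilon>1"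
  proof -
    have "v * (p * b * p) * star v - y * y = v * (p * b * p - b) * star v + (v * b * star v - a)"
      by (simp add: y(2) left_diff_distrib right_diff_distrib)
    also have "norm \<dots> \<le> norm v * (2 * \<delta>) * norm v + \<epsilon>1"
      using b1 n by (intro norm_triangle_mono norm_mult_bound) (simp_all add: p_def v_def)
    also have "norm v * (2 * \<delta>) * norm v \<le> (2 * \<delta>) * V"
      using \<delta> by (simp add: V_def power2_eq_square algebra_simps)
    also have "(2 * \<delta>) * V = \<epsilon>1" using V by (simp add: \<delta>_def)
    finally show ?thesis by simp
  qed
  define \<eta> where "\<eta> = \<epsilon> / (16 * N * K)"
  have \<eta>: "0 < \<eta>" "4 * N * K * \<eta> = \<epsilon> / 4" using e N0 K by (auto simp: \<eta>_def)
  obtain d k where d: "positive_elt UNIV d" "norm d = 1" "d = k * c"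
    and orth: "\<And>g h. g \<in> carrier G \<Longrightarrow> h \<in> carrier G \<Longrightarrow> g \<noteq> h \<Longrightarrow> norm (\<alpha> g d * \<alpha> h d) \<le> \<eta>"
    using almost_orthogonal_translates[OF R c \<eta>(1)] by blast
  define x where "x = fun_calc UNIV bump d * fun_calc UNIV bump d"
  have sd: "star d = d" using d(1) by (simp add: positive_elt_def)
  have sx: "star (fun_calc UNIV bump d) = fun_calc UNIV bump d"
    by (rule fun_calc_selfadjoint[OF sd admissible_bump])
  have x: "positive_elt UNIV x" "norm x = 1"
  proof -
    show "positive_elt UNIV x" unfolding x_def using positive_star_mult[of "fun_calc UNIV bump d"] sx by simp
    have "norm (fun_calc UNIV bump d) \<le> 1"
    proof (rule norm_fun_calc_le[OF sd admissible_bump])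
      fix t assume "t \<in> real_spectrum d"
      then show "\<bar>bump t\<bar> \<le> 1"
        using real_spectrum_norm[of t d] d(2) by (auto simp: bump_def)
    qed simp
    moreover have "1 \<le> norm (fun_calc UNIV bump d)"
    proof -
      \<comment> \<open>A positive element of norm 1 has 1 in its spectrum, and there
        \<open>bump\<close> equals 1; hence \<open>x\<close> is a legitimate test element of norm
        1.\<close>
      obtain t where t: "\<bar>t\<bar> = norm (Uz 0 d)" "complex_of_real t \<in> unital_spectrum (Uz 0 d)"
        using norm_in_unital_spectrum[of "Uz 0 d"] sd by (auto simp: Uz_simps(7)[symmetric])
      then have ts: "t \<in> real_spectrum d"
        using unital_spectrum_Uz_subset[of d UNIV] d(2) by (auto simp: real_spectrum_def)
      then have "t = 1" using t(1) d(2) positive_real_spectrum[OF d(1)] by fastforce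
      then show ?thesis using norm_fun_calc_ge[OF sd admissible_bump ts] by (simp add: bump_def)
    qed
    ultimately show "norm x = 1" unfolding x_def norm_selfadjoint_square[OF sx] by simp
  qed
  have yf: "y * y \<in> fixed" using a(2) y(2) by simp
  have bf: "p * b * p \<in> fixed" by (intro fixed_intros(3) fx b(2))
  have "0 < \<epsilon> / 4" using e by simp
  from Rokhlin_approximation[OF R x y(1) yf bf vb this] obtain z1 u where z1: "z1 \<in> fixed"
    and u: "norm (y * y - z1 * (p * b * p) * star z1 - u * x * star u) \<le> N * (2 * \<epsilon>1) + \<epsilon> / 4"
      "norm (u * x * star u) \<le> 2 * (norm y)\<^sup>2 + \<epsilon> / 4"
    by blast
  have u1: "norm (y * y - z1 * (p * b * p) * star z1 - u * x * star u) \<le> \<epsilon> / 2"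
    using u(1) N0 by (simp add: \<epsilon>1_def)
  have u2: "norm (u * x * star u) \<le> K" using u(2) e by (simp add: K_def)
  \<comment> \<open>The defect is invariant because \<open>y * y\<close> and the averaged comparison
    are, so it can take the role of \<open>r\<close> in \<open>average_comparison\<close>.\<close>
  define s where "s = y * y - z1 * (p * b * p) * star z1"
  have sf: "s \<in> fixed"
    unfolding s_def by (intro fixed_intros(7) fixed_intros(3) fixed_intros(4) yf z1 fx b(2))
  obtain z2 where z2: "z2 \<in> fixed" "norm (s - z2 * (c * c) * star z2) \<le> 4 * N * K * \<eta> + \<epsilon> / 2"
    using average_comparison[OF c(1,2) d orth sf u1[unfolded x_def, folded s_def] u2[unfolded x_def] less_imp_le[OF \<eta>(1)]]
    by blast
  \<comment> \<open>The two invariant comparisons add up to one because \<open>p * b * q = 0\<close>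
    and \<open>q * b * p = 0\<close>: the mixed terms of \<open>z * b * star z\<close> vanish
    exactly.\<close>
  define z where "z = z1 * p + z2 * (r *\<^sub>R q)"
  have zf: "z \<in> fixed"
    unfolding z_def by (intro fixed_intros(2) fixed_intros(3) fixed_intros(6) z1 z2(1) fx)
  have "z * b * star z = z1 * (p * b * p) * star z1 + z2 * ((r *\<^sub>R q) * b * (r *\<^sub>R q)) * star z2
      + r *\<^sub>R (z1 * (p * b * q) * star z2) + r *\<^sub>R (z2 * (q * b * p) * star z1)"
    by (simp add: z_def star_add star_mult star_scaleR st distrib_left distrib_right scaleR_add_right mult.assoc)
  also have "\<dots> = z1 * (p * b * p) * star z1 + z2 * (c * c) * star z2"
    using cross unfolding cc by (simp add: p_def q_def)
  finally have "z * b * star z - a = - (s - z2 * (c * c) * star z2)"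
    by (simp add: s_def y(2))
  then have "norm (z * b * star z - a) \<le> \<epsilon> / 4 + \<epsilon> / 2"
    using z2(2) \<eta>(2) by (simp only: norm_minus_cancel)
  then show ?thesis using zf e by (intro bexI[of _ z]) auto
qed

theorem proposition3p10:
  fixes G :: "('g, 'm) monoid_scheme"
    and \<alpha> :: "'g \<Rightarrow> 'a::cstar_algebra \<Rightarrow> 'a"
    and a b :: 'a
  assumes "simple_cstar TYPE('a)"
    and "infinite_dimensional TYPE('a)"
    and "group G" and "finite (carrier G)"
    and "\<alpha> \<in> hom G Aut"
    and "weak_tracial_Rokhlin G \<alpha>"
    and "positive_elt (fixed_algebra G \<alpha>) a" and "positive_elt (fixed_algebra G \<alpha>) b"
    and "0 islimpt spectrum UNIV b"
  shows "cuntz_le UNIV (corner a) (corner b) \<longleftrightarrow>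
         cuntz_le (fixed_algebra G \<alpha>) (corner a) (corner b)"
proof -
  interpret cstar_action G \<alpha>
    by (intro cstar_action.intro cstar_action_axioms.intro assms)
  have af: "a \<in> fixed" and bf: "b \<in> fixed"
    using assms(7,8) by (auto simp: positive_elt_def)
  have a: "positive_elt UNIV a" and b: "positive_elt UNIV b"
    using assms(7,8) positive_elt_psd positive_elt_iff_psd by blast+
  note UNIV_iff = cuntz_le_corner_iff[OF star_subalgebra_UNIV UNIV_I UNIV_I, of a b]
  note fixed_iff = cuntz_le_corner_iff[OF star_subalgebra_fixed af bf]
  show ?thesis
  proof
    assume "cuntz_le UNIV (corner a) (corner b)"
    then obtain w where w: "(\<lambda>n. w n * b * star (w n)) \<longlonglongrightarrow> a" using UNIV_iff by blast
    \<comment> \<open>Approximation for each tolerance suffices, as Cuntz subequivalence of corners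
      only asks for some sequence in the fixed point algebra.\<close>
    have "\<exists>z\<in>fixed. norm (z * b * star z - a) \<le> inverse (real (Suc n))" for n
      by (rule comparison_descends[OF assms(6) a af b bf assms(9) w]) (simp_all add: inverse_le_1_iff)
    then obtain z where z: "\<And>n. z n \<in> fixed" "\<And>n. norm (z n * b * star (z n) - a) \<le> inverse (real (Suc n))"
      by metis
    have "(\<lambda>n. z n * b * star (z n) - a) \<longlonglongrightarrow> 0"
      by (rule Lim_null_comparison[OF _ LIMSEQ_inverse_real_of_nat]) (use z(2) in simp)
    then have "(\<lambda>n. z n * b * star (z n)) \<longlonglongrightarrow> a" by (simp only: LIM_zero_iff)
    with z(1) show "cuntz_le fixed (corner a) (corner b)" using fixed_iff by blast
  next
    assume "cuntz_le fixed (corner a) (corner b)"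
    then show "cuntz_le UNIV (corner a) (corner b)" using fixed_iff UNIV_iff by blast
  qed
qed

end
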